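(* Let $t\ge 1$ and let $F=\mathbb{Q}(\sqrt{-p_1\cdots p_t})$ with distinct primes $p_1,\dots,p_t$ such that $p_i\equiv 1\pmod 4$ for $i=1,\dots,t-1$ and $p_t\equiv 3\pmod 4$, and let $\Delta=-p_1\cdots p_t$. Let $\mathfrak{B}\colon V_0\times V_0\to\mathbb{F}_2$ be the bilinear form defined in the context, and let $Q_{\mathfrak{B}}$ be the quadratic form on $V_0$ defined by $Q_{\mathfrak{B}}(D)=\mathfrak{B}(D,D)$. Then for every $D\in V_0$, $$Q_{\mathfrak{B}}(D)=\xi\left(\left(\frac{\Delta/D}{D}\right)_4\right).$$
   Context: $\Delta$ is the discriminant of $F$. Let $\mathcal{C}$ be the ideal class group of $F$ (written additively when we write $2\mathcal{C}$, so $2\mathcal{C}$ is the subgroup of squares of ideal classes), and $\mathcal{C}[2]$ the subgroup of classes killed by $2$. Let $\xi\colon\{\pm1\}\to\mathbb{F}_2$ be the group isomorphism with $\xi(1)=0$, $\xi(-1)=1$. For $i=1,\dots,t$ let $\mathfrak{p}_i$ be the prime ideal of $F$ with $\mathfrak{p}_i^2=(p_i)$. Let $V'$ be the set of positive divisors of $p_1\cdots p_{t-1}$, an $\mathbb{F}_2$-vector space with addition $q_1\cdot q_2=q_1q_2/\gcd(q_1,q_2)^2$. The map $p_i\mapsto$ class of $\mathfrak{p}_i$ ($1\le i\le t-1$) extends to an isomorphism of $\mathbb{F}_2$-vector spaces $V'\to\mathcal{C}[2]$, sending $D$ to the class of $\mathfrak{a}_D=\prod_{p_i\mid D}\mathfrak{p}_i$.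 Let $V_0\subset V'$ be the subspace of those $D$ for which the class of $\mathfrak{a}_D$ lies in $2\mathcal{C}$; it is identified with $\mathcal{C}[2]\cap 2\mathcal{C}$. For $D\in V'$, let $\chi_D$ be the quadratic character of $\mathcal{C}$ given on (fractional) ideals by $\chi_D(\mathfrak{b})=\prod_{p\mid D}\left(\frac{N\mathfrak{b},\Delta}{p}\right)$, where $\left(\frac{a,b}{p}\right)$ is the Hilbert symbol over $\mathbb{Q}_p$ and $N$ is the ideal norm. For $D\in V_0$, $\chi_D$ is trivial on $\mathcal{C}[2]$. The bilinear form $\mathfrak{B}$ is defined by: for $D_1,D_2\in V_0$, choose an ideal $\mathfrak{b}$ of $F$ such that the class of $\mathfrak{b}^2$ equals the class of $\mathfrak{a}_{D_1}$, and set $\mathfrak{B}(D_1,D_2)=\xi(\chi_{D_2}(\mathfrak{b}))$ (this is independent of the choice of $\mathfrak{b}$). Quadratic form: for a vector space $W$ over a field $k$, a map $Q\colon W\to k$ is a quadratic form if there is a (not necessarily symmetric) bilinear form $B$ on $W$ with $Q(x)=B(x,x)$ for all $x$. Quartic symbol: for a prime $p\equiv1\pmod 4$ and an integer $a$ coprime to $p$ that is a quadratic residue mod $p$, $\left(\frac{a}{p}\right)_4=\pm1$ is defined by $\left(\frac{a}{p}\right)_4\equiv a^{(p-1)/4}\pmod p$. For $D$ a product of distinct primes $q_1,\dots,q_s\equiv1\pmod 4$ and $a\in\mathbb{Z}$ coprime to $D$ and a quadratic residue mod every $q_i$, $\left(\frac{a}{D}\right)_4=\prod_{i=1}^s\left(\frac{a}{q_i}\right)_4$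 (equal to $1$ if $D=1$). For $D\in V_0$, the integer $\Delta/D$ is a quadratic residue modulo every prime dividing $D$, so the symbol in the claim is defined. *)

theory Defs
  imports
    "HOL-Algebra.QuotRing"
    "HOL-Algebra.Ideal_Product"
    "HOL-Algebra.FiniteProduct"
    "HOL-Computational_Algebra.Computational_Algebra"
    "HOL-Number_Theory.Cong"
    "HOL-Library.Z2"
begin

subsection \<open>The \<open>p\<close>-adic numbers and the Hilbert symbol\<close>

definition padic_abs :: "nat \<Rightarrow> rat \<Rightarrow> real" where
  "padic_abs p x =
     (if x = 0 then 0
      else real p powi (int (multiplicity (int p) (snd (quotient_of x)))
                        - int (multiplicity (int p) (fst (quotient_of x)))))"

definition padic_cauchy :: "nat \<Rightarrow> (nat \<Rightarrow> rat) \<Rightarrow> bool" where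
  "padic_cauchy p x \<longleftrightarrow>
     (\<forall>e>0. \<exists>M. \<forall>m\<ge>M. \<forall>n\<ge>M. padic_abs p (x m - x n) < e)"

definition padic_null :: "nat \<Rightarrow> (nat \<Rightarrow> rat) set" where
  "padic_null p = {x. (\<lambda>n. padic_abs p (x n)) \<longlonglongrightarrow> 0}"

definition padic_cauchy_ring :: "nat \<Rightarrow> (nat \<Rightarrow> rat) ring" where
  "padic_cauchy_ring p =
     \<lparr>carrier = {x. padic_cauchy p x},
      monoid.mult = (\<lambda>x y n. x n * y n), one = (\<lambda>n. 1),
      zero = (\<lambda>n. 0), add = (\<lambda>x y n. x n + y n)\<rparr>"

text \<open>
  The field of \<open>p\<close>-adic numbers is the completion of the rationals at \<open>p\<close>: Cauchy sequences
  modulo null sequences.  Rational numbers embed as classes of constant sequences.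
\<close>

definition padic_field :: "nat \<Rightarrow> (nat \<Rightarrow> rat) set ring" where
  "padic_field p = padic_cauchy_ring p Quot padic_null p"

definition padic_of_rat :: "nat \<Rightarrow> rat \<Rightarrow> (nat \<Rightarrow> rat) set" where
  "padic_of_rat p a = padic_null p +>\<^bsub>padic_cauchy_ring p\<^esub> (\<lambda>n. a)"

definition hilbert_symbol :: "nat \<Rightarrow> rat \<Rightarrow> rat \<Rightarrow> int" where
  "hilbert_symbol p a b =
     (let K = padic_field p in
      if \<exists>x\<in>carrier K. \<exists>y\<in>carrier K. \<exists>z\<in>carrier K.
           \<not> (x = \<zero>\<^bsub>K\<^esub> \<and> y = \<zero>\<^bsub>K\<^esub> \<and> z = \<zero>\<^bsub>K\<^esub>) \<and>
           z \<otimes>\<^bsub>K\<^esub> z = (padic_of_rat p a \<otimes>\<^bsub>K\<^esub> (x \<otimes>\<^bsub>K\<^esub> x)) \<oplus>\<^bsub>K\<^esub>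
                      (padic_of_rat p b \<otimes>\<^bsub>K\<^esub> (y \<otimes>\<^bsub>K\<^esub> y))
      then 1 else -1)"


subsection \<open>Quadratic fields, ideals and the class group\<close>

definition complex_subring :: "complex set \<Rightarrow> complex ring" where
  "complex_subring S = \<lparr>carrier = S, monoid.mult = (*), one = 1, zero = 0, add = (+)\<rparr>"

text \<open>
  The quadratic field generated by the square root of an integer \<open>d\<close>, its ring of integers and
  its ideals are realised as subsets of the complex numbers.
\<close>

definition quad_field :: "int \<Rightarrow> complex set" where
  "quad_field d = {of_rat a + of_rat b * csqrt (of_int d) | a b. True}"

definition quad_integers :: "int \<Rightarrow> complex set" where
  "quad_integers d = {x \<in> quad_field d. algebraic_int x}"

definition fractional_ideals :: "int \<Rightarrow> complex set set" where
  "fractional_ideals d =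
     {I. additive_subgroup I (complex_subring (quad_field d)) \<and>
         (\<forall>r\<in>quad_integers d. \<forall>x\<in>I. r * x \<in> I) \<and>
         I \<noteq> {0} \<and>
         (\<exists>c\<in>quad_integers d. c \<noteq> 0 \<and> (\<forall>x\<in>I. c * x \<in> quad_integers d))}"

definition principal_ideal :: "int \<Rightarrow> complex \<Rightarrow> complex set" where
  "principal_ideal d x = (\<lambda>r. r * x) ` quad_integers d"

definition principal_ideals :: "int \<Rightarrow> complex set set" where
  "principal_ideals d = principal_ideal d ` (quad_field d - {0})"

text \<open>
  \<^const>\<open>ideal_prod\<close> only forms finite sums of products, so it is also the product of
  fractional ideals when taken in the field.
\<close>

definition ideal_group :: "int \<Rightarrow> complex set monoid" where
  "ideal_group d =
     \<lparr>carrier = fractional_ideals d,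
      monoid.mult = ideal_prod (complex_subring (quad_field d)),
      one = quad_integers d\<rparr>"

definition class_group :: "int \<Rightarrow> complex set set monoid" where
  "class_group d = ideal_group d Mod principal_ideals d"

definition ideal_class :: "int \<Rightarrow> complex set \<Rightarrow> complex set set" where
  "ideal_class d I = principal_ideals d #>\<^bsub>ideal_group d\<^esub> I"

definition class_squares :: "int \<Rightarrow> complex set set set" where
  "class_squares d = {c \<otimes>\<^bsub>class_group d\<^esub> c | c. c \<in> carrier (class_group d)}"

text \<open>
  For an integral ideal the least denominator is 1 and the norm is the index in the ring of
  integers; in general \<open>N I = N (c I) / c\<^sup>2\<close>, as the field has degree 2.
\<close>

definition ideal_norm :: "int \<Rightarrow> complex set \<Rightarrow> rat" where
  "ideal_norm d I =
     (let c = (LEAST c::nat. c > 0 \<and> (\<forall>x\<in>I. of_nat c * x \<in> quad_integers d))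
      in of_nat (card (carrier (complex_subring (quad_integers d) Quot ((\<lambda>x. of_nat c * x) ` I))))
           / of_nat (c\<^sup>2))"


subsection \<open>The form \<open>B\<close>\<close>

text \<open>Only used at primes \<open>q\<close> ramified in the field, where the ideal exists and is unique.\<close>

definition ramified_prime :: "int \<Rightarrow> nat \<Rightarrow> complex set" where
  "ramified_prime d q =
     (THE P. primeideal P (complex_subring (quad_integers d)) \<and>
             P \<otimes>\<^bsub>ideal_group d\<^esub> P = principal_ideal d (of_nat q))"

definition ramified_ideal :: "int \<Rightarrow> nat \<Rightarrow> complex set" where
  "ramified_ideal d D = finprod (ideal_group d) (ramified_prime d) (prime_factors D)"

definition V' :: "nat \<Rightarrow> (nat \<Rightarrow> nat) \<Rightarrow> nat set" where
  "V' t p = {D. D > 0 \<and> D dvd (\<Prod>i=1..<t. p i)}"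

definition V0 :: "int \<Rightarrow> nat \<Rightarrow> (nat \<Rightarrow> nat) \<Rightarrow> nat set" where
  "V0 d t p = {D \<in> V' t p. ideal_class d (ramified_ideal d D) \<in> class_squares d}"

definition genus_char :: "int \<Rightarrow> nat \<Rightarrow> complex set \<Rightarrow> int" where
  "genus_char d D b = (\<Prod>q\<in>prime_factors D. hilbert_symbol q (ideal_norm d b) (of_int d))"

text \<open>On \<open>{1, -1}\<close> this is the isomorphism onto the field with two elements.\<close>

definition xi :: "int \<Rightarrow> bit" where
  "xi s = (if s = -1 then 1 else 0)"

text \<open>The value does not depend on the ideal chosen when both arguments lie in \<^const>\<open>V0\<close>.\<close>

definition form_B :: "int \<Rightarrow> nat \<Rightarrow> nat \<Rightarrow> bit" where
  "form_B d D1 D2 =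
     xi (genus_char d D2
          (SOME b. b \<in> fractional_ideals d \<and>
                   ideal_class d (b \<otimes>\<^bsub>ideal_group d\<^esub> b) = ideal_class d (ramified_ideal d D1)))"

definition form_Q :: "int \<Rightarrow> nat \<Rightarrow> bit" where
  "form_Q d D = form_B d D D"


subsection \<open>Quartic symbols\<close>

definition quartic_symbol_prime :: "int \<Rightarrow> nat \<Rightarrow> int" where
  "quartic_symbol_prime a q =
     (THE s. s \<in> {1, -1} \<and> [s = a ^ ((q - 1) div 4)] (mod int q))"

definition quartic_symbol :: "int \<Rightarrow> nat \<Rightarrow> int" where
  "quartic_symbol a D = (\<Prod>q\<in>prime_factors D. quartic_symbol_prime a q)"

end

theory Submission
  imports Defs "HOL-Number_Theory.Quadratic_Reciprocity"
begin

text \<open>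
  Write \<open>d = \<Delta> = D * e\<close>, and let \<open>b\<close> be an ideal whose square is equivalent to the ideal
  \<open>a\<^sub>D\<close> with \<open>a\<^sub>D\<^sup>2 = (D)\<close>.  The proof reads one Diophantine equation in two ways.

  The equation comes from norms.  Up to a rational factor, which changes the norm by a square only,
  \<open>b\<close> is a lattice \<open>L = Z a + Z \<omega>\<close> of norm \<open>a\<close> with \<open>2 \<omega> = B + \<surd>d\<close>.  If
  \<open>L\<^sup>2 = \<gamma> a\<^sub>D\<close>, then \<open>\<gamma> D = (D u + w \<surd>d) / 2\<close> for integers \<open>u\<close> and \<open>w\<close>, and
  comparing \<open>L\<^sup>2\<close> times its conjugate on both sides gives \<open>4 a\<^sup>2 = D u\<^sup>2 - e w\<^sup>2\<close>.  Moreover the solution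
  is nearly primitive: a prime dividing both \<open>a\<close> and \<open>\<gamma> D\<close> divides \<open>d\<close>
  (lemma \<open>lattice_square_equation\<close>).

  Divide \<open>2 a, u, w\<close> by their greatest common divisor \<open>g\<close> to get \<open>n, u\<^sub>1, w\<^sub>1\<close>.  Modulo a prime
  \<open>q\<close> dividing \<open>D\<close> the equation says \<open>e w\<^sub>1\<^sup>2 = - n\<^sup>2\<close>, and raising this to the power
  \<open>(q - 1) / 4\<close> turns the quartic symbol of \<open>e\<close> into Legendre symbols.  As \<open>(-1)\<close> to the power
  \<open>(q - 1) / 4\<close> is \<open>(2/q)\<close>, the quartic symbol \<open>(e/D)\<^sub>4\<close> is \<open>(2/D) (n/D) (w\<^sub>1/D)\<close>.
  The genus character of \<open>b\<close>, on the other hand, is a product of Hilbert symbols \<open>(a, d)\<close>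
  at the primes of \<open>D\<close>; by \<open>2 a = g n\<close> and multiplicativity it is \<open>(2/D) (n/D)\<close> times the contribution of
  \<open>g\<close>.  Quadratic reciprocity compares the two: for an odd prime \<open>l\<close> dividing \<open>w\<^sub>1\<close> the equation makes
  \<open>D\<close> a square modulo \<open>l\<close>, hence \<open>(l/D) = 1\<close>, and every odd prime dividing \<open>g\<close> divides
  \<open>d\<close> and contributes 1 for similar reasons.  Only the prime 2 is left, and there the equation
  modulo 8 shows that \<open>g\<close> and \<open>w\<^sub>1\<close> contribute the same sign
  (lemma \<open>prod_tame_symbol_eq_quartic_symbol\<close>).

  Two computations connect this with the objects of the statement.  The Hilbert symbol, which is
  the solvability of \<open>z\<^sup>2 = a x\<^sup>2 + d y\<^sup>2\<close> over the completion, is reduced to Legendre symbols: a solution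
  over the completion can be approximated and rescaled to a primitive integral solution modulo any power of \<open>q\<close>, and
  conversely square roots lift from residues (lemma \<open>hilbert_symbol_eq_tame_symbol\<close>).  The ramified
  ideal \<open>a\<^sub>D\<close> turns out to consist of the integers \<open>(X + Y \<surd>d) / 2\<close> with
  \<open>D\<close> dividing \<open>X\<close> (lemma \<open>ramified_ideal_eq\<close>).
\<close>

section \<open>Legendre symbols and the quartic symbol\<close>

lemma legendre_euler:
  assumes "prime q" "2 < q"
  shows "[Legendre a (int q) = a ^ ((q - 1) div 2)] (mod int q)"
  using euler_criterion[OF assms] .

lemma legendre_values: "Legendre a q \<in> {0, 1, -1}"
  by (auto simp: Legendre_def)

text \<open>
  Signs are determined by their residue, as \<open>q > 2\<close> separates 0, 1 and -1.
\<close>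
lemma sign_eqI:
  fixes s r :: int
  assumes "[s = r] (mod int q)" "2 < q" "s \<in> {0, 1, -1}" "r \<in> {0, 1, -1}"
  shows "s = r"
proof -
  have "int q dvd s - r" using assms(1) by (simp add: cong_iff_dvd_diff)
  moreover have "\<bar>s - r\<bar> < int q" using assms by auto
  ultimately show ?thesis by (metis dvd_imp_le_int eq_iff_diff_eq_0 linorder_not_less abs_of_nat)
qed

lemma legendre_eqI:
  assumes "prime q" "2 < q" "[a ^ ((q - 1) div 2) = r] (mod int q)" "r \<in> {0, 1, -1}"
  shows "Legendre a (int q) = r"
  using sign_eqI[OF cong_trans[OF legendre_euler[OF assms(1,2)] assms(3)]] assms legendre_values by blast

lemma legendre_mult:
  assumes "prime q" "2 < q"
  shows "Legendre (a * b) (int q) = Legendre a (int q) * Legendre b (int q)"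
proof (rule legendre_eqI[OF assms])
  show "[(a * b) ^ ((q - 1) div 2) = Legendre a (int q) * Legendre b (int q)] (mod int q)"
    unfolding power_mult_distrib
    by (intro cong_mult cong_sym[OF legendre_euler[OF assms]])
  show "Legendre a (int q) * Legendre b (int q) \<in> {0, 1, -1}"
    using legendre_values[of a "int q"] legendre_values[of b "int q"] by auto
qed

lemma legendre_eq_0_iff: "Legendre a q = 0 \<longleftrightarrow> q dvd a"
  by (auto simp: Legendre_def cong_0_iff)

lemma legendre_sq:
  assumes "prime q" "2 < q" "\<not> int q dvd a"
  shows "Legendre a (int q) * Legendre a (int q) = 1"
  using legendre_values[of a "int q"] assms legendre_eq_0_iff[of a "int q"] by auto

lemma legendre_cong:
  assumes "[a = b] (mod q)" shows "Legendre a q = Legendre b q"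
proof -
  have "[x = a] (mod q) \<longleftrightarrow> [x = b] (mod q)" for x
    using assms by (meson cong_sym cong_trans)
  then have "[a = 0] (mod q) \<longleftrightarrow> [b = 0] (mod q)" "QuadRes q a \<longleftrightarrow> QuadRes q b"
    unfolding QuadRes_def by (metis cong_sym)+
  then show ?thesis by (simp add: Legendre_def)
qed

lemma legendre_one: "q > 2 \<Longrightarrow> Legendre 1 (int q) = 1"
  by (auto simp: Legendre_def QuadRes_def cong_def intro!: exI[of _ 1])

lemma legendre_minus_one:
  assumes "prime q" "q mod 4 = 1"
  shows "Legendre (-1) (int q) = 1"
proof -
  have q: "2 < q" using assms prime_ge_2_nat[of q] by (cases "q = 2") auto
  have "even ((q - 1) div 2)" using assms(2) by presburger
  then have "(-1::int) ^ ((q - 1) div 2) = 1" by simp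
  then show ?thesis by (intro legendre_eqI[OF assms(1) q]) auto
qed

text \<open>
  With \<open>i\<^sup>2 = -1\<close> modulo \<open>q\<close> we have \<open>(1 + i)\<^sup>2 = 2 i\<close>.  So 2 and \<open>i\<close> have the same symbol, and
  Euler's criterion for \<open>i\<close> gives \<open>i\<close> to the power \<open>(q - 1) / 2\<close>, a power of -1.
\<close>
lemma legendre_two:
  assumes "prime q" "q mod 4 = 1"
  shows "Legendre 2 (int q) = (-1) ^ ((q - 1) div 4)"
proof -
  define m where "m = (q - 1) div 4"
  have qm: "q = 4 * m + 1" using assms(2) unfolding m_def by presburger
  have q: "2 < q" using assms prime_ge_2_nat[of q] by (cases "q = 2") auto
  have "QuadRes (int q) (-1)"
    using legendre_minus_one[OF assms] by (auto simp: Legendre_def split: if_splits)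
  then obtain i where i: "[i ^ 2 = -1] (mod int q)" unfolding QuadRes_def by blast
  have "\<not> int q dvd (1 + i)"
  proof
    assume "int q dvd 1 + i"
    then have "int q dvd (1 + i) * (1 - i)" by simp
    moreover have "int q dvd i ^ 2 + 1" using i by (simp add: cong_iff_dvd_diff)
    ultimately have "int q dvd (1 + i) * (1 - i) + (i ^ 2 + 1)" by (rule dvd_add)
    then have "int q dvd 2" by (simp add: algebra_simps power2_eq_square)
    then show False using q zdvd_imp_le[of "int q" 2] by simp
  qed
  then have "Legendre (1 + i) (int q) * Legendre (1 + i) (int q) = 1"
    by (rule legendre_sq[OF assms(1) q])
  then have "Legendre ((1 + i) ^ 2) (int q) = 1"
    by (simp add: power2_eq_square legendre_mult[OF assms(1) q])
  moreover have "[(1 + i) ^ 2 = 2 * i] (mod int q)"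
    using i by (auto simp: cong_iff_dvd_diff algebra_simps power2_eq_square)
  ultimately have "Legendre (2 * i) (int q) = 1" using legendre_cong by metis
  then have 1: "Legendre 2 (int q) * Legendre i (int q) = 1"
    by (simp add: legendre_mult[OF assms(1) q])
  have "Legendre i (int q) = (-1) ^ m"
  proof (rule legendre_eqI[OF assms(1) q])
    have "(q - 1) div 2 = 2 * m" using qm by simp
    then show "[i ^ ((q - 1) div 2) = (-1) ^ m] (mod int q)"
      using cong_pow[OF i, of m] by (simp add: power_mult)
    show "(-1::int) ^ m \<in> {0, 1, -1}" by (cases "even m") auto
  qed
  with 1 show ?thesis unfolding m_def[symmetric]
    by (cases "even m") auto
qed

lemma legendre_reciprocity:
  assumes "prime q" "q mod 4 = 1" "prime l" "2 < l" "l \<noteq> q"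
  shows "Legendre (int q) (int l) = Legendre (int l) (int q)"
proof -
  have q: "2 < q" using assms prime_ge_2_nat[of q] by (cases "q = 2") auto
  have "even ((q - 1) div 2)" using assms(2) by presburger
  then have "Legendre (int q) (int l) * Legendre (int l) (int q) = 1"
    using Quadratic_Reciprocity[OF assms(1) q assms(3,4)] assms(5) by simp
  then show ?thesis
    using legendre_values[of "int q" "int l"] legendre_values[of "int l" "int q"] by auto
qed

lemma legendre_prod:
  assumes "prime l" "2 < l"
  shows "Legendre (\<Prod>q\<in>S. f q) (int l) = (\<Prod>q\<in>S. Legendre (f q) (int l))"
  by (induction S rule: infinite_finite_induct)
     (auto simp: legendre_mult[OF assms] legendre_one[OF assms(2)])

text \<open>
  A completely multiplicative sign that is 1 at -1 and at all odd primes dividing \<open>x\<close> only sees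
  the power of 2 in \<open>x\<close>.  This is how reciprocity is exploited below, for the Jacobi symbol
  modulo \<open>D\<close> and for the product of the Hilbert symbols.
\<close>
lemma multiplicative_two_power:
  fixes f :: "int \<Rightarrow> int"
  assumes mult: "\<And>a b. a \<noteq> 0 \<Longrightarrow> b \<noteq> 0 \<Longrightarrow> f (a * b) = f a * f b"
    and one: "f 1 = 1" and minus: "f (-1) = 1"
    and odd_primes: "\<And>l. prime l \<Longrightarrow> l \<noteq> 2 \<Longrightarrow> l dvd x \<Longrightarrow> f l = 1"
    and "x \<noteq> 0"
  shows "f x = f 2 ^ multiplicity 2 x"
  using odd_primes \<open>x \<noteq> 0\<close>
proof (induction x rule: prime_divisors_induct)
  case zero then show ?case by simp
next
  case (unit x)
  then have "x = 1 \<or> x = -1" by (simp add: abs_if split: if_splits)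
  moreover from unit have "multiplicity 2 x = 0"
    by (simp add: multiplicity_unit_right)
  ultimately show ?case using one minus by auto
next
  case (factor p x)
  then have x: "x \<noteq> 0" by auto
  have IH: "f x = f 2 ^ multiplicity 2 x"
    using factor x by auto
  have p0: "p \<noteq> 0" using factor by auto
  have mu: "multiplicity 2 (p * x) = multiplicity 2 p + multiplicity 2 x"
    by (rule prime_elem_multiplicity_mult_distrib) (use p0 x in auto)
  show ?case
  proof (cases "p = 2")
    case True
    then show ?thesis using mult[OF p0 x] IH mu by (simp add: multiplicity_self)
  next
    case False
    then have "\<not> 2 dvd p" using factor(1) prime_ge_2_int[of p] prime_odd_int[of p] by simp
    then have "multiplicity 2 p = 0" by (rule not_dvd_imp_multiplicity_0)
    moreover have "f p = 1" using factor False by simp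
    ultimately show ?thesis using mult[OF p0 x] IH mu by simp
  qed
qed

text \<open>
  The Hilbert symbol \<open>(a, d)\<close> at a prime \<open>q\<close> congruent to 1 modulo 4 that divides \<open>d\<close> exactly once, see
  \<open>hilbert_symbol_eq_tame_symbol\<close>.  The general tame symbol has a further sign, which is trivial for such \<open>q\<close>.
\<close>
definition tame_symbol :: "nat \<Rightarrow> int \<Rightarrow> int \<Rightarrow> int" where
  "tame_symbol q a d =
     Legendre (a div int q ^ multiplicity (int q) a) (int q) *
     Legendre (d div int q) (int q) ^ multiplicity (int q) a"

text \<open>
  Unlike for the Hilbert symbol itself, multiplicativity is immediate from the formula.
\<close>
lemma tame_symbol_mult:
  assumes "prime q" "2 < q" "a \<noteq> 0" "b \<noteq> 0"
  shows "tame_symbol q (a * b) d = tame_symbol q a d * tame_symbol q b d"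
proof -
  let ?k = "multiplicity (int q) a" and ?l = "multiplicity (int q) b"
  have mu: "multiplicity (int q) (a * b) = ?k + ?l"
    by (rule prime_elem_multiplicity_mult_distrib) (use assms in auto)
  have "(a * b) div int q ^ (?k + ?l) = (a div int q ^ ?k) * (b div int q ^ ?l)"
    by (simp add: power_add div_mult_div_if_dvd multiplicity_dvd)
  then show ?thesis
    unfolding tame_symbol_def mu by (simp add: legendre_mult[OF assms(1,2)] power_add)
qed

lemma tame_symbol_unit: "\<not> int q dvd a \<Longrightarrow> tame_symbol q a d = Legendre a (int q)"
  by (simp add: tame_symbol_def not_dvd_imp_multiplicity_0)

lemma tame_symbol_self:
  assumes "prime q" "2 < q"
  shows "tame_symbol q (int q) d = Legendre (d div int q) (int q)"
proof -
  have "multiplicity (int q) (int q) = 1"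
    using assms by (intro multiplicity_self) auto
  then show ?thesis using assms by (simp add: tame_symbol_def legendre_one)
qed

lemma quartic_symbol_primeI:
  assumes "2 < q" "[s = a ^ ((q - 1) div 4)] (mod int q)" "s \<in> {1, -1}"
  shows "quartic_symbol_prime a q = s"
  unfolding quartic_symbol_prime_def
proof (rule the_equality)
  fix r :: int assume "r \<in> {1, -1} \<and> [r = a ^ ((q - 1) div 4)] (mod int q)"
  then show "r = s" using sign_eqI[of r s q] assms by (auto intro: cong_trans cong_sym)
qed (use assms in auto)

text \<open>
  Raise the congruence to the power \<open>(q - 1) / 4\<close>: the squares of \<open>w\<close> and \<open>n\<close> become Legendre symbols by Euler's
  criterion, and the power of -1 becomes the symbol of 2.
\<close>
lemma quartic_symbol_prime_norm:
  assumes "prime q" "q mod 4 = 1" and eq: "[e * w ^ 2 = - (n ^ 2)] (mod int q)"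
    and "\<not> int q dvd w" "\<not> int q dvd n"
  shows "quartic_symbol_prime e q = Legendre 2 (int q) * Legendre n (int q) * Legendre w (int q)"
proof -
  define m where "m = (q - 1) div 4"
  have q: "2 < q" using assms prime_ge_2_nat[of q] by (cases "q = 2") auto
  have m2: "(q - 1) div 2 = 2 * m" using assms(2) unfolding m_def by presburger
  have sw: "Legendre w (int q) \<in> {1, -1}" and sn: "Legendre n (int q) \<in> {1, -1}"
    using legendre_values[of w "int q"] legendre_values[of n "int q"] assms(4,5)
      legendre_eq_0_iff[of w "int q"] legendre_eq_0_iff[of n "int q"] by auto
  have L2: "Legendre 2 (int q) = (-1) ^ m" using legendre_two[OF assms(1,2)] by (simp add: m_def)
  have "[e ^ m * w ^ (2 * m) = (-1) ^ m * n ^ (2 * m)] (mod int q)"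
    using cong_pow[OF eq, of m] by (simp add: power_mult_distrib power_mult power_minus')
  moreover have "[w ^ (2 * m) = Legendre w (int q)] (mod int q)" "[n ^ (2 * m) = Legendre n (int q)] (mod int q)"
    using legendre_euler[OF assms(1) q] m2 cong_sym by metis+
  ultimately have "[e ^ m * Legendre w (int q) = (-1) ^ m * Legendre n (int q)] (mod int q)"
    by (meson cong_scalar_left cong_sym cong_trans)
  then have "[e ^ m * Legendre w (int q) * Legendre w (int q)
      = (-1) ^ m * Legendre n (int q) * Legendre w (int q)] (mod int q)"
    by (rule cong_scalar_right)
  then have "[e ^ m = (-1) ^ m * Legendre n (int q) * Legendre w (int q)] (mod int q)"
    using sw by auto
  moreover have "(-1) ^ m * Legendre n (int q) * Legendre w (int q) \<in> {1, -1}"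
    using sw sn by (cases "even m") auto
  ultimately show ?thesis unfolding L2
    by (intro quartic_symbol_primeI[OF q]) (simp only: m_def[symmetric] cong_sym_eq, assumption)
qed

text \<open>
  The second supplement for the Jacobi symbol modulo a product of primes congruent to 1 modulo 4.
  The congruence for the product is carried along because the induction needs it.
\<close>
lemma jacobi_two_eq_one_iff:
  assumes "finite S" "\<And>q. q \<in> S \<Longrightarrow> prime q \<and> q mod 4 = 1"
  shows "(\<Prod>S) mod 4 = 1 \<and> (\<Prod>q\<in>S. Legendre 2 (int q)) = (-1) ^ ((\<Prod>S - 1) div 4)"
  using assms
proof (induction S rule: finite_induct)
  case empty then show ?case by simp
next
  case (insert q S)
  obtain m where m: "q = 4 * m + 1" using insert.prems[of q] by (metis insertI1 mod_div_decomp mult.commute)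
  obtain k where k: "\<Prod>S = 4 * k + 1" using insert by (metis insertCI mod_div_decomp mult.commute)
  define j where "j = 4 * m * k + m + k"
  have e: "\<Prod>(insert q S) = 4 * j + 1"
    using insert(1,2) m k by (simp add: algebra_simps j_def)
  have "Legendre 2 (int q) = (-1) ^ m" using legendre_two[of q] insert.prems[of q] m by simp
  moreover have "(\<Prod>q\<in>S. Legendre 2 (int q)) = (-1) ^ k" using insert k by simp
  ultimately have "(\<Prod>q\<in>insert q S. Legendre 2 (int q)) = (-1) ^ j"
    using insert(1,2) by (simp add: power_add power_mult j_def)
  then show ?case using e by simp
qed

section \<open>The symbol identity for a primitive solution of the norm equation\<close>

text \<open>
  The hypothesis makes the product of \<open>S\<close> a square modulo \<open>l\<close>; reciprocity has no sign because the
  members of \<open>S\<close> are 1 modulo 4.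
\<close>
lemma jacobi_eq_one_if_residue:
  assumes S: "finite S" "\<And>q. q \<in> S \<Longrightarrow> prime q \<and> q mod 4 = 1"
    and l: "prime l" "2 < l" "l \<notin> S"
    and res: "[int (\<Prod>S) * x ^ 2 = y ^ 2] (mod int l)" "\<not> int l dvd y"
  shows "(\<Prod>q\<in>S. Legendre (int l) (int q)) = 1"
proof -
  have "(\<Prod>q\<in>S. Legendre (int l) (int q)) = (\<Prod>q\<in>S. Legendre (int q) (int l))"
    using S l by (intro prod.cong refl legendre_reciprocity[symmetric]) auto
  also have "\<dots> = Legendre (int (\<Prod>S)) (int l)"
    using legendre_prod[OF l(1,2), of int S] by (simp add: prod_int_eq of_nat_prod)
  also have "\<dots> = 1"
  proof -
    have "Legendre (int (\<Prod>S) * (x * x)) (int l) = Legendre (y * y) (int l)"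
      using legendre_cong[OF res(1)] by (simp add: power2_eq_square)
    then have *: "Legendre (int (\<Prod>S)) (int l) * (Legendre x (int l) * Legendre x (int l)) = 1"
      using legendre_sq[OF l(1,2) res(2)] by (simp add: legendre_mult[OF l(1,2)])
    then have "Legendre x (int l) \<noteq> 0" by auto
    then have "Legendre x (int l) * Legendre x (int l) = 1"
      using legendre_values[of x "int l"] by auto
    with * show ?thesis by simp
  qed
  finally show ?thesis .
qed

text \<open>
  The arithmetic heart of the proof.  Both sides become Legendre symbols of \<open>2\<close>,
  \<open>n = 2 a / g\<close>, \<open>g\<close> and \<open>w / g\<close>, where \<open>g\<close> is the common divisor of \<open>2 a, u, w\<close>, and the odd
  primes of \<open>g\<close> and \<open>w / g\<close> drop out by reciprocity.  The last hypothesis expresses that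
  a prime dividing \<open>a\<close> and the quadratic integer \<open>(D u + w \<surd>d) / 2\<close> is ramified; for \<open>l = 2\<close> the
  condition on \<open>u - w\<close> is what divisibility by 2 in the ring of integers means.
\<close>
lemma prod_tame_symbol_eq_quartic_symbol:
  fixes S :: "nat set" and d e a u w :: int
  assumes S: "finite S" "\<And>q. q \<in> S \<Longrightarrow> prime q \<and> q mod 4 = 1"
    and d: "d = int (\<Prod>S) * e" "squarefree d" "d mod 4 = 1"
    and a: "a > 0" and eq: "4 * a ^ 2 = int (\<Prod>S) * u ^ 2 - e * w ^ 2"
    and primitive: "\<And>l. prime l \<Longrightarrow> l dvd a \<Longrightarrow> l dvd u \<Longrightarrow> l dvd w \<Longrightarrow> 2 * l dvd u - w \<Longrightarrow> l dvd d"
  shows "(\<Prod>q\<in>S. tame_symbol q a d) = (\<Prod>q\<in>S. quartic_symbol_prime e q)"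
proof (cases "S = {}")
  case True then show ?thesis by simp
next
  case False
  define D where "D = int (\<Prod>S)"
  define J where "J x = (\<Prod>q\<in>S. Legendre x (int q))" for x
  define X where "X x = (\<Prod>q\<in>S. tame_symbol q x d)" for x
  define g where "g = gcd (2 * a) (gcd u w)"
  have gt2: "2 < q" if "q \<in> S" for q
    using S(2)[OF that] prime_ge_2_nat[of q] by (cases "q = 2") auto
  have g0: "g > 0" using a by (simp add: g_def gcd_pos_int)
  obtain n where n: "2 * a = g * n" unfolding g_def by (meson dvdE gcd_dvd1)
  obtain u1 where u1: "u = g * u1" unfolding g_def by (meson dvdE dvd_trans gcd_dvd1 gcd_dvd2)
  obtain w1 where w1: "w = g * w1" unfolding g_def by (meson dvdE dvd_trans gcd_dvd2)
  have n0: "n \<noteq> 0" using n a by auto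
  have nocommon: False if "prime l" "l dvd n" "l dvd u1" "l dvd w1" for l
  proof -
    have "g * l dvd 2 * a" "g * l dvd u" "g * l dvd w" using that n u1 w1 by auto
    then have "g * l dvd g * 1" unfolding g_def by (simp add: g_def)
    then show False using that(1) g0 by (simp only: dvd_mult_cancel_left) auto
  qed
  have eq1: "n ^ 2 = D * u1 ^ 2 - e * w1 ^ 2"
  proof -
    have "(g * n) ^ 2 = D * (g * u1) ^ 2 - e * (g * w1) ^ 2"
      unfolding n[symmetric] u1[symmetric] w1[symmetric] D_def using eq by simp
    then have "g ^ 2 * n ^ 2 = g ^ 2 * (D * u1 ^ 2 - e * w1 ^ 2)"
      by (simp add: power_mult_distrib right_diff_distrib mult.left_commute)
    then show ?thesis using g0 by simp
  qed
  note J2 = jacobi_two_eq_one_iff[OF S]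
  have D4: "D mod 4 = 1" using J2 unfolding D_def by (metis of_nat_mod of_nat_1 of_nat_numeral)
  have oddD: "odd D" using D4 by presburger
  have e4: "e mod 4 = 1"
  proof -
    have "(D mod 4) * (e mod 4) mod 4 = 1" using d(1,3) unfolding D_def[symmetric] by (simp add: mod_mult_eq)
    then show ?thesis using D4 by simp
  qed
  have odde: "odd e" using e4 by presburger
  have nosq: "\<not> l ^ 2 dvd d" if "prime l" for l
    using d(2) that unfolding squarefree_def by (meson not_prime_unit)
  \<comment> \<open>The entries of the reduced equation are units at every prime of \<open>D\<close>, because \<open>d\<close> is squarefree.\<close>
  have S_e: "\<not> int q dvd e" if "q \<in> S" for q
  proof
    assume "int q dvd e"
    moreover have "int q dvd int (\<Prod>S)" using that S(1) by (simp add: dvd_prodI)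
    ultimately have "int q ^ 2 dvd d" unfolding d(1) power2_eq_square by (rule mult_dvd_mono[rotated])
    then show False using nosq[of "int q"] S(2)[OF that] by simp
  qed
  have pS: "prime (int q)" if "q \<in> S" for q using S(2)[OF that] by simp
  have Sw: "\<not> int q dvd w1" if "q \<in> S" for q
  proof
    assume qw: "int q dvd w1"
    define D' where "D' = int (\<Prod>(S - {q}))"
    have D': "D = int q * D'" unfolding D_def D'_def using S(1) that by (simp add: prod.remove)
    then have "int q dvd n ^ 2" unfolding eq1 using qw by (simp add: power2_eq_square)
    then have quad: "int q dvd n" using pS[OF that] prime_dvd_power by blast
    have "int q * int q dvd n ^ 2 + e * w1 ^ 2" 
      unfolding power2_eq_square using quad qw by (intro dvd_add dvd_mult[of _ _ e] mult_dvd_mono)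
    then have "int q * int q dvd int q * (D' * u1 ^ 2)" using eq1 D' by (simp add: algebra_simps)
    moreover have "int q \<noteq> 0" using pS[OF that] by auto
    ultimately have "int q dvd D' * u1 ^ 2" by (simp only: dvd_mult_cancel_left) auto
    moreover have "\<not> int q dvd D'"
    proof
      assume "int q dvd D'"
      then have "int q ^ 2 dvd d" unfolding d(1) D_def[symmetric] D' power2_eq_square by (simp add: mult_dvd_mono)
      then show False using nosq pS[OF that] by blast
    qed
    ultimately have "int q dvd u1" using pS[OF that] prime_dvd_mult_iff prime_dvd_power by blast
    then show False using nocommon[OF pS[OF that] quad _ qw] by blast
  qed
  have Sn: "\<not> int q dvd n" if "q \<in> S" for q
  proof
    assume quad: "int q dvd n"
    have "int q dvd D" unfolding D_def using that S(1) by (simp add: dvd_prodI)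
    then have "int q dvd D * u1 ^ 2 - n ^ 2" using quad by (simp add: power2_eq_square)
    then have "int q dvd e * w1 ^ 2" using eq1 by (simp add: algebra_simps)
    then show False using S_e[OF that] Sw[OF that] pS[OF that] prime_dvd_mult_iff prime_dvd_power by blast
  qed
  have w10: "w1 \<noteq> 0" using False Sw by auto
  have congq: "[e * w1 ^ 2 = - (n ^ 2)] (mod int q)" if "q \<in> S" for q
  proof -
    have "int q dvd D" unfolding D_def using that S(1) by (simp add: dvd_prodI)
    moreover have "e * w1 ^ 2 - (- (n ^ 2)) = D * u1 ^ 2" using eq1 by simp
    ultimately show ?thesis unfolding cong_iff_dvd_diff by simp
  qed
  have rhs: "(\<Prod>q\<in>S. quartic_symbol_prime e q) = J 2 * J n * J w1"
    unfolding J_def prod.distrib[symmetric]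
    using S(2) congq Sw Sn by (intro prod.cong refl quartic_symbol_prime_norm) auto
  have Jmult: "J (x * y) = J x * J y" for x y
    unfolding J_def prod.distrib[symmetric] using S(2) gt2 by (intro prod.cong refl legendre_mult) auto
  have Xmult: "X (x * y) = X x * X y" if "x \<noteq> 0" "y \<noteq> 0" for x y
    unfolding X_def prod.distrib[symmetric] using S(2) gt2 that by (intro prod.cong refl tame_symbol_mult) auto
  have XJ: "X x = J x" if "\<And>q. q \<in> S \<Longrightarrow> \<not> int q dvd x" for x
    unfolding X_def J_def using that by (intro prod.cong refl tame_symbol_unit) auto
  have J1: "J 1 = 1" and Jm: "J (-1) = 1"
    unfolding J_def using gt2 S(2) by (auto intro!: prod.neutral legendre_one legendre_minus_one)
  have nd2: "\<not> int q dvd 2" if "q \<in> S" for q using gt2[OF that] zdvd_imp_le[of "int q" 2] by auto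
  have nd1: "\<not> int q dvd 1" if "q \<in> S" for q using gt2[OF that] by simp
  have X1: "X 1 = 1" and Xm: "X (-1) = 1" and X2: "X 2 = J 2" and Xn: "X n = J n"
    using XJ[of 1] XJ[of "-1"] XJ[of 2] XJ[of n] J1 Jm nd1 nd2 Sn by auto
  have even_uw: "even (u - w)"
  proof -
    have "even (D * u ^ 2 - e * w ^ 2)" using eq unfolding D_def[symmetric] by (metis dvd_mult2 even_numeral)
    then show ?thesis using oddD odde by simp
  qed
  \<comment> \<open>The congruence also shows that \<open>e\<close> is a square modulo \<open>q\<close>, which is needed when \<open>q\<close> divides \<open>g\<close>.\<close>
  have Je: "Legendre e (int q) = 1" if "q \<in> S" for q
  proof -
    note q = conjunct1[OF S(2)[OF that]] gt2[OF that]
    have "Legendre (e * (w1 * w1)) (int q) = Legendre (- 1 * (n * n)) (int q)"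
      using legendre_cong[OF congq[OF that]] by (simp add: power2_eq_square)
    then have "Legendre e (int q) * (Legendre w1 (int q) * Legendre w1 (int q))
        = Legendre (- 1) (int q) * (Legendre n (int q) * Legendre n (int q))"
      unfolding legendre_mult[OF q] .
    then show ?thesis
      using legendre_sq[OF q Sw[OF that]] legendre_sq[OF q Sn[OF that]] legendre_minus_one[of q] S(2)[OF that]
      by simp
  qed
  have Jres: "J l = 1" if l: "prime l" "l \<noteq> 2" "l \<notin> int ` S" and "l dvd D * u1 ^ 2 - n ^ 2" "\<not> l dvd n" for l
  proof -
    obtain l' where l': "l = int l'" using l(1) prime_ge_0_int zero_le_imp_eq_int by blast
    have "2 < l'" using l l' prime_ge_2_int[of l] by auto
    then show ?thesis unfolding J_def l'
      using l that l' by (intro jacobi_eq_one_if_residue[OF S]) (auto simp: cong_iff_dvd_diff D_def)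
  qed
  \<comment> \<open>An odd prime dividing \<open>g\<close> is ramified, so it divides \<open>D\<close> or \<open>e\<close>.  In the first case its symbols at
    the other primes of \<open>D\<close> cancel, by reciprocity, against the symbol of \<open>d / l\<close> at \<open>l\<close>.\<close>
  have Xg: "X l = 1" if l: "prime l" "l \<noteq> 2" "l dvd g" for l
  proof -
    have lodd: "\<not> l dvd 2" using l prime_ge_2_int[of l] zdvd_imp_le[of l 2] by auto
    have "l dvd 2 * a" "l dvd u" "l dvd w" using l(3) n u1 w1 by auto
    then have "l dvd a" using lodd l(1) prime_dvd_mult_iff by blast
    have "coprime 2 l" using l prime_ge_2_int[of l] prime_odd_int[of l] by auto
    then have "2 * l dvd u - w" using even_uw \<open>l dvd u\<close> \<open>l dvd w\<close> by (intro divides_mult) auto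
    then have ld: "l dvd d" using primitive l(1) \<open>l dvd a\<close> \<open>l dvd u\<close> \<open>l dvd w\<close> by blast
    show ?thesis
    proof (cases "l \<in> int ` S")
      case True
      then obtain q where q: "q \<in> S" "l = int q" by auto
      note qq = conjunct1[OF S(2)[OF q(1)]] gt2[OF q(1)]
      have "d div int q = int (\<Prod>(S - {q})) * e"
        unfolding d(1) using S(1) q(1) qq by (simp add: prod.remove)
      then have "tame_symbol q (int q) d = (\<Prod>r\<in>S - {q}. Legendre (int r) (int q))"
        using tame_symbol_self[OF qq] Je[OF q(1)] legendre_prod[OF qq, of int "S - {q}"]
        by (simp add: legendre_mult[OF qq])
      moreover have "X l = tame_symbol q (int q) d * (\<Prod>r\<in>S - {q}. tame_symbol r (int q) d)"
        unfolding X_def q(2) using S(1) q(1) by (simp add: prod.remove)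
      moreover have "Legendre (int r) (int q) * tame_symbol r (int q) d = 1" if r: "r \<in> S - {q}" for r
      proof -
        have nr: "\<not> int r dvd int q" "\<not> int q dvd int r"
          using S(2)[of r] S(2)[OF q(1)] r primes_dvd_imp_eq by auto
        show ?thesis
          using legendre_reciprocity[of r q] legendre_sq[of r "int q"] tame_symbol_unit[OF nr(1)] gt2[of r] qq
            S(2)[of r] r nr by auto
      qed
      ultimately show ?thesis by (simp add: prod.distrib[symmetric])
    next
      case False
      have "\<not> l dvd D"
      proof
        assume "l dvd D"
        then obtain q where "q \<in> S" "l dvd int q"
          unfolding D_def using l(1) S(1) by (auto simp: prime_dvd_prod_iff)
        then show False using pS[of q] l(1) False primes_dvd_imp_eq by blast
      qed
      then have le: "l dvd e" using ld l(1) unfolding d(1) D_def[symmetric] by (simp add: prime_dvd_mult_iff)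
      have 1: "D * u1 ^ 2 - n ^ 2 = e * w1 ^ 2" using eq1 by simp
      have ln: "\<not> l dvd n"
      proof
        assume ln: "l dvd n"
        have "l dvd n ^ 2 + e * w1 ^ 2" using ln le by (simp add: power2_eq_square)
        then have "l dvd D * u1 ^ 2" using eq1 by simp
        then have lu: "l dvd u1" using \<open>\<not> l dvd D\<close> l(1) prime_dvd_mult_iff prime_dvd_power by blast
        obtain e' where e': "e = l * e'" using le by blast
        have "l * l dvd D * u1 ^ 2 - n ^ 2" 
          unfolding power2_eq_square using ln lu by (intro dvd_diff dvd_mult[of _ _ D] mult_dvd_mono)
        then have "l * l dvd l * (e' * w1 ^ 2)" using 1 e' by (simp add: algebra_simps)
        moreover have "l \<noteq> 0" using l(1) by auto
        ultimately have "l dvd e' * w1 ^ 2" by (simp only: dvd_mult_cancel_left) auto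
        moreover have "\<not> l dvd e'"
        proof
          assume "l dvd e'"
          then have "l ^ 2 dvd d" unfolding d(1) e' power2_eq_square by (simp add: dvd_mult mult_dvd_mono)
          then show False using nosq l(1) by blast
        qed
        ultimately have "l dvd w1" using l(1) prime_dvd_mult_iff prime_dvd_power by blast
        then show False using nocommon[OF l(1) ln lu] by blast
      qed
      have "J l = 1" using Jres[OF l(1,2) False] 1 le ln by simp
      moreover have "X l = J l"
      proof (rule XJ)
        fix q assume "q \<in> S"
        then show "\<not> int q dvd l" using False pS[of q] l(1) primes_dvd_imp_eq by blast
      qed
      ultimately show ?thesis by simp
    qed
  qed
  \<comment> \<open>Modulo an odd prime dividing \<open>w\<^sub>1\<close> the equation reads \<open>n\<^sup>2 = D u\<^sub>1\<^sup>2\<close>.\<close>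
  have Jw: "J l = 1" if l: "prime l" "l \<noteq> 2" "l dvd w1" for l
  proof -
    have lS: "l \<notin> int ` S" using Sw l(3) by auto
    have 1: "D * u1 ^ 2 - n ^ 2 = e * w1 ^ 2" using eq1 by simp
    have "\<not> l dvd n"
    proof
      assume ln: "l dvd n"
      have "l dvd n ^ 2 + e * w1 ^ 2" using ln l(3) by (simp add: power2_eq_square)
      then have "l dvd D * u1 ^ 2" using eq1 by simp
      moreover have "\<not> l dvd D"
      proof
        assume "l dvd D"
        then obtain q where "q \<in> S" "l dvd int q"
          unfolding D_def using l(1) S(1) by (auto simp: prime_dvd_prod_iff)
        then show False using pS[of q] l(1) lS primes_dvd_imp_eq by blast
      qed
      ultimately have "l dvd u1" using l(1) prime_dvd_mult_iff prime_dvd_power by blast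
      then show False using nocommon[OF l(1) ln _ l(3)] by blast
    qed
    then show ?thesis using Jres[OF l(1,2) lS] 1 l(3) by (simp add: power2_eq_square)
  qed
  have Xg2: "X g = J 2 ^ multiplicity 2 g"
    using multiplicative_two_power[of X g] Xmult X1 Xm Xg g0 X2 by simp
  have Jw2: "J w1 = J 2 ^ multiplicity 2 w1"
    using multiplicative_two_power[of J w1] Jmult J1 Jm Jw w10 by simp
  have J22: "J 2 * J 2 = 1"
    unfolding J_def prod.distrib[symmetric] using nd2 gt2 S(2) by (intro prod.neutral ballI legendre_sq) auto
  have "X 2 * X a = X g * X n" using Xmult[of 2 a] Xmult[of g n] n g0 n0 a by simp
  then have "J 2 * J 2 * X a = J 2 * X g * J n" using X2 Xn by (metis mult.assoc)
  then have Xa: "X a = J 2 * J 2 ^ multiplicity 2 g * J n" using J22 Xg2 by simp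
  \<comment> \<open>It remains to compare the powers of 2.  If \<open>u\<close> is odd, both are trivial; if \<open>u\<close> is even, both
    sides equal the symbol of 2.\<close>
  have "J 2 ^ multiplicity 2 g = J 2 ^ multiplicity 2 w1"
  proof (cases "even u")
    case False
    then have "odd g" "odd w1" using even_uw u1 w1 by auto
    then show ?thesis by (simp add: not_dvd_imp_multiplicity_0)
  next
    case True
    have "even w" using True even_uw by simp
    then have "even g" unfolding g_def using True by simp
    \<comment> \<open>Otherwise 2 would divide \<open>a\<close> and \<open>(D u + w \<surd>d) / 2\<close>, but 2 is unramified.\<close>
    have no2: "\<not> (even a \<and> 4 dvd u - w)"
    proof
      assume "even a \<and> 4 dvd u - w"
      then have "2 dvd d" using primitive[of 2] True \<open>even w\<close> by simp
      then show False using d(3) by presburger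
    qed
    have "even w1"
    proof (rule ccontr)
      assume ow: "odd w1"
      obtain w2 where w2: "w1 = 2 * w2 + 1" using ow by (elim oddE)
      obtain D2 where D2: "D = 4 * D2 + 1" using D4 by (metis mod_div_decomp mult.commute)
      obtain e2 where e2: "e = 4 * e2 + 1" using e4 by (metis mod_div_decomp mult.commute)
      have nu: "even n \<and> odd u1"
      proof -
        have "even n \<longleftrightarrow> odd u1"
        proof -
          have "even (n ^ 2) \<longleftrightarrow> even (D * u1 ^ 2 - e * w1 ^ 2)" using eq1 by simp
          then show ?thesis using oddD odde ow by simp
        qed
        moreover have "\<not> (odd n \<and> even u1)"
        proof
          assume "odd n \<and> even u1"
          then obtain n2 u2 where "n = 2 * n2 + 1" "u1 = 2 * u2" by (meson evenE oddE)
          then have "4 * (n2 ^ 2 + n2) + 1 = 4 * (D * u2 ^ 2) - (4 * e2 + 1) * (4 * (w2 ^ 2 + w2) + 1)"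
            using eq1 w2 e2 by (simp add: algebra_simps power2_eq_square)
          then have "4 * (n2 ^ 2 + n2 - D * u2 ^ 2 + e2 * (4 * (w2 ^ 2 + w2) + 1) + (w2 ^ 2 + w2)) = - 2"
            by (simp add: algebra_simps)
          then show False by presburger
        qed
        ultimately show ?thesis by blast
      qed
      then obtain n' where "n = 2 * n'" by blast
      then have "a = g * n'" using n by simp
      then have "even a" using \<open>even g\<close> by simp
      moreover have "even (u1 - w1)" using nu ow by simp
      then have "2 * 2 dvd g * (u1 - w1)" using \<open>even g\<close> by (rule mult_dvd_mono[rotated])
      then have "4 dvd u - w" using u1 w1 by (simp add: algebra_simps)
      ultimately show False using no2 by blast
    qed
    then obtain w2 where w2: "w1 = 2 * w2" by blast
    obtain g' where g': "g = 2 * g'" using \<open>even g\<close> by blast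
    have "odd g'"
    proof
      assume "even g'"
      then obtain g'' where "g' = 2 * g''" by blast
      then have "a = 2 * (g'' * n)" "u - w = 4 * (g'' * (u1 - w1))" using n u1 w1 g' by (auto simp: algebra_simps)
      then show False using no2 by (metis dvd_triv_left)
    qed
    then have "multiplicity 2 (2 * g') = multiplicity 2 (2::int) + 0"
      using g0 g' by (subst prime_elem_multiplicity_mult_distrib) (auto simp: not_dvd_imp_multiplicity_0)
    then have mg: "J 2 ^ multiplicity 2 g = J 2" using g' by (simp add: multiplicity_self)
    show ?thesis
    proof (cases "even w2")
      case False
      then have "multiplicity 2 (2 * w2) = multiplicity 2 (2::int) + 0"
        using w10 w2 by (subst prime_elem_multiplicity_mult_distrib) (auto simp: not_dvd_imp_multiplicity_0)
      then have "multiplicity 2 w1 = 1" using w2 by (simp add: multiplicity_self)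
      then show ?thesis using mg by simp
    next
      case True
      \<comment> \<open>Now 16 divides \<open>e w\<^sub>1\<^sup>2\<close> while \<open>n\<close> and \<open>u\<^sub>1\<close> are odd, so \<open>D\<close> is 1 modulo 8
        and the symbol of 2 is trivial.\<close>
      then obtain w3 where w3: "w2 = 2 * w3" by blast
      have "odd u1"
      proof
        assume "even u1"
        moreover from this have "even (n ^ 2)" unfolding eq1 using w2 by simp
        ultimately show False using nocommon[of 2] w2 by simp
      qed
      moreover from this have "odd (n ^ 2)" unfolding eq1 using w2 oddD by simp
      ultimately obtain n2 u2 where nu: "n = 2 * n2 + 1" "u1 = 2 * u2 + 1" by (auto elim!: oddE)
      obtain D2 where D2: "D = 4 * D2 + 1" using D4 by (metis mod_div_decomp mult.commute)
      have "n ^ 2 = D * u1 ^ 2 - 16 * (e * w3 ^ 2)" using eq1 w2 w3 by (simp add: power2_eq_square)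
      then have *: "n2 * (n2 + 1) = D2 + D * (u2 * (u2 + 1)) - 4 * (e * w3 ^ 2)"
        unfolding nu D2 by (simp add: power2_eq_square algebra_simps)
      have "even (n2 * (n2 + 1))" "even (u2 * (u2 + 1))" by auto
      moreover have "D2 = n2 * (n2 + 1) - D * (u2 * (u2 + 1)) + 4 * (e * w3 ^ 2)" using * by simp
      ultimately have "even D2" by (metis dvd_add dvd_diff dvd_mult dvd_mult2 even_numeral)
      have "int ((\<Prod>S - 1) div 4) = D2"
      proof -
        have "int (\<Prod>S) = 4 * D2 + 1" using D2 D_def by simp
        then show ?thesis by presburger
      qed
      then have "even ((\<Prod>S - 1) div 4)" using \<open>even D2\<close> by presburger
      then have "J 2 = 1" using J2 unfolding J_def by simp
      then show ?thesis by simp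
    qed
  qed
  then show ?thesis unfolding rhs Jw2 using Xa by (simp add: X_def mult_ac)
qed

section \<open>The Hilbert symbol at an odd prime dividing one argument exactly once\<close>

context
  fixes p :: nat
  assumes p: "prime p"
begin

lemma prime_int_p: "prime (int p)" and p_gt_1: "real p > 1"
  using p prime_gt_1_nat by auto

lemma padic_abs_divide:
  assumes "a \<noteq> 0" "b \<noteq> 0"
  shows "padic_abs p (of_int a / of_int b) =
    real p powi (int (multiplicity (int p) b) - int (multiplicity (int p) a))"
proof -
  obtain n m where nm: "quotient_of (of_int a / of_int b) = (n, m)" by fastforce
  have m: "m > 0" and q: "of_int a / of_int b = (of_int n / of_int m :: rat)"
    using quotient_of_denom_pos[OF nm] quotient_of_div[OF nm] by auto
  have "(of_int (a * m) :: rat) = of_int (n * b)"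
    using q m assms by (simp add: field_simps)
  then have eq: "a * m = n * b" by linarith
  then have n: "n \<noteq> 0" using assms m by auto
  have "multiplicity (int p) a + multiplicity (int p) m = multiplicity (int p) n + multiplicity (int p) b"
    using eq prime_elem_multiplicity_mult_distrib[of "int p"] prime_int_p assms m n
    by (metis less_irrefl prime_imp_prime_elem)
  then have "int (multiplicity (int p) m) - int (multiplicity (int p) n) =
      int (multiplicity (int p) b) - int (multiplicity (int p) a)"
    by linarith
  then show ?thesis using assms by (simp add: padic_abs_def nm)
qed

lemma padic_abs_of_int:
  assumes "a \<noteq> 0"
  shows "padic_abs p (of_int a) = 1 / real p ^ multiplicity (int p) a"
  using padic_abs_divide[OF assms, of 1] by (simp add: power_int_minus field_simps)

lemma padic_abs_0 [simp]: "padic_abs p 0 = 0"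
  by (simp add: padic_abs_def)

lemma padic_abs_pos: "x \<noteq> 0 \<Longrightarrow> padic_abs p x > 0"
  using p_gt_1 by (simp add: padic_abs_def)

lemma padic_abs_nonneg: "padic_abs p x \<ge> 0"
  using padic_abs_pos[of x] by (cases "x = 0") auto

lemma rat_fraction: obtains a b :: int where "x = (of_int a / of_int b :: rat)" "b \<noteq> 0"
  by (metis quotient_of_div quotient_of_denom_pos less_irrefl surj_pair)

lemma padic_abs_mult: "padic_abs p (x * y) = padic_abs p x * padic_abs p y"
proof (cases "x = 0 \<or> y = 0")
  case False
  obtain a b where x: "x = of_int a / of_int b" "b \<noteq> 0" by (rule rat_fraction)
  obtain c d where y: "y = of_int c / of_int d" "d \<noteq> 0" by (rule rat_fraction)
  have nz: "a \<noteq> 0" "c \<noteq> 0" using False x y by auto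
  have "x * y = of_int (a * c) / of_int (b * d)" using x y by simp
  moreover have "multiplicity (int p) (a * c) = multiplicity (int p) a + multiplicity (int p) c"
    "multiplicity (int p) (b * d) = multiplicity (int p) b + multiplicity (int p) d"
    using prime_elem_multiplicity_mult_distrib[of "int p"] prime_int_p nz x y by auto
  ultimately have "padic_abs p (x * y) = real p powi
      ((int (multiplicity (int p) b) - int (multiplicity (int p) a)) +
       (int (multiplicity (int p) d) - int (multiplicity (int p) c)))"
    using nz x y padic_abs_divide[of "a * c" "b * d"] by (simp add: algebra_simps)
  then show ?thesis
    using nz x y p_gt_1 by (simp add: padic_abs_divide power_int_add)
qed auto

lemma padic_abs_minus [simp]: "padic_abs p (- x) = padic_abs p x"
proof -
  have "padic_abs p (-1) = 1" using padic_abs_of_int[of "-1"] by simp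
  then show ?thesis using padic_abs_mult[of "-1" x] by simp
qed

lemma padic_abs_of_int_le_iff:
  "padic_abs p (of_int a) \<le> 1 / real p ^ k \<longleftrightarrow> int p ^ k dvd a"
proof (cases "a = 0")
  case False
  have "int p ^ k dvd a \<longleftrightarrow> k \<le> multiplicity (int p) a"
    using False prime_int_p by (intro power_dvd_iff_le_multiplicity) auto
  then show ?thesis using False p_gt_1
    by (simp add: padic_abs_of_int divide_simps)
qed (use p_gt_1 in auto)

lemma padic_abs_of_int_le_1: "padic_abs p (of_int a) \<le> 1"
  using padic_abs_of_int_le_iff[of a 0] by simp

lemma padic_abs_add: "padic_abs p (x + y) \<le> max (padic_abs p x) (padic_abs p y)"
proof (cases "x = 0 \<or> y = 0")
  case False
  obtain a b where x: "x = of_int a / of_int b" "b \<noteq> 0" by (rule rat_fraction)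
  obtain c d where y: "y = of_int c / of_int d" "d \<noteq> 0" by (rule rat_fraction)
  have nz: "a \<noteq> 0" "c \<noteq> 0" using False x y by auto
  let ?B = "padic_abs p (1 / of_int (b * d))"
  have s: "x = of_int (a * d) * (1 / of_int (b * d))" "y = of_int (c * b) * (1 / of_int (b * d))"
    "x + y = of_int (a * d + c * b) * (1 / of_int (b * d))"
    using x y by (auto simp: field_simps)
  have "padic_abs p (of_int (a * d + c * b)) \<le> max (padic_abs p (of_int (a * d))) (padic_abs p (of_int (c * b)))"
  proof -
    define k where "k = min (multiplicity (int p) (a * d)) (multiplicity (int p) (c * b))"
    have "int p ^ k dvd a * d + c * b" unfolding k_def by (intro dvd_add multiplicity_dvd') auto
    then have "padic_abs p (of_int (a * d + c * b)) \<le> 1 / real p ^ k" using padic_abs_of_int_le_iff by blast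
    also have "\<dots> \<le> max (padic_abs p (of_int (a * d))) (padic_abs p (of_int (c * b)))"
      using nz x y padic_abs_of_int[of "a * d"] padic_abs_of_int[of "c * b"]
      by (auto simp: k_def min_def le_max_iff_disj simp del: of_int_mult)
    finally show ?thesis .
  qed
  then have "padic_abs p (of_int (a * d + c * b)) * ?B \<le>
     max (padic_abs p (of_int (a * d)) * ?B) (padic_abs p (of_int (c * b)) * ?B)"
    unfolding le_max_iff_disj by (blast intro: mult_right_mono padic_abs_nonneg)
  then show ?thesis unfolding s(3) unfolding s(1,2) padic_abs_mult .
qed (use padic_abs_nonneg in \<open>auto simp: max_def\<close>)

lemma padic_abs_add_less: "padic_abs p x < e \<Longrightarrow> padic_abs p y < e \<Longrightarrow> padic_abs p (x + y) < e"
  using padic_abs_add[of x y] by linarith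

lemma padic_abs_diff_less: "padic_abs p x < e \<Longrightarrow> padic_abs p y < e \<Longrightarrow> padic_abs p (x - y) < e"
  using padic_abs_add_less[of x e "- y"] by simp

lemma padic_cauchyD:
  "padic_cauchy p x \<Longrightarrow> e > 0 \<Longrightarrow> \<exists>M. \<forall>m\<ge>M. \<forall>n\<ge>M. padic_abs p (x m - x n) < e"
  by (auto simp: padic_cauchy_def)

lemma padic_null_iff: "x \<in> padic_null p \<longleftrightarrow> (\<forall>e>0. \<exists>M. \<forall>n\<ge>M. padic_abs p (x n) < e)"
  using padic_abs_nonneg by (simp add: padic_null_def LIMSEQ_iff abs_of_nonneg)

lemma padic_nullD: "x \<in> padic_null p \<Longrightarrow> e > 0 \<Longrightarrow> \<exists>M. \<forall>n\<ge>M. padic_abs p (x n) < e"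
  by (simp add: padic_null_iff)

lemma padic_cauchy_const: "padic_cauchy p (\<lambda>n. a)"
  by (simp add: padic_cauchy_def)

lemma padic_null_const_iff: "(\<lambda>n. a) \<in> padic_null p \<longleftrightarrow> a = 0"
  using padic_abs_pos[of a] by (auto simp: padic_null_iff)

lemma padic_null_cauchy:
  assumes "x \<in> padic_null p" shows "padic_cauchy p x"
  unfolding padic_cauchy_def
proof (intro allI impI)
  fix e :: real assume "e > 0"
  then obtain M where "\<forall>n\<ge>M. padic_abs p (x n) < e" using padic_nullD[OF assms] by blast
  then show "\<exists>M. \<forall>m\<ge>M. \<forall>n\<ge>M. padic_abs p (x m - x n) < e"
    by (intro exI[of _ M]) (simp add: padic_abs_diff_less)
qed

lemma padic_cauchy_add:
  assumes "padic_cauchy p x" "padic_cauchy p y"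
  shows "padic_cauchy p (\<lambda>n. x n + y n)"
  unfolding padic_cauchy_def
proof (intro allI impI)
  fix e :: real assume e: "e > 0"
  obtain M where M: "\<forall>m\<ge>M. \<forall>n\<ge>M. padic_abs p (x m - x n) < e" using padic_cauchyD[OF assms(1) e] by blast
  obtain N where N: "\<forall>m\<ge>N. \<forall>n\<ge>N. padic_abs p (y m - y n) < e" using padic_cauchyD[OF assms(2) e] by blast
  show "\<exists>M. \<forall>m\<ge>M. \<forall>n\<ge>M. padic_abs p (x m + y m - (x n + y n)) < e"
  proof (intro exI[of _ "max M N"] allI impI)
    fix m n assume "max M N \<le> m" "max M N \<le> n"
    then show "padic_abs p (x m + y m - (x n + y n)) < e"
      using padic_abs_add_less[of "x m - x n" e "y m - y n"] M N by (simp add: add_diff_add)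
  qed
qed

lemma padic_cauchy_bounded:
  assumes "padic_cauchy p x"
  shows "\<exists>B>0. \<exists>M. \<forall>n\<ge>M. padic_abs p (x n) < B"
proof -
  obtain M where M: "\<forall>m\<ge>M. \<forall>n\<ge>M. padic_abs p (x m - x n) < 1" using padic_cauchyD[OF assms, of 1] by auto
  have "padic_abs p (x n) < padic_abs p (x M) + 1" if "n \<ge> M" for n
  proof -
    have "padic_abs p (x n) \<le> max (padic_abs p (x n - x M)) (padic_abs p (x M))"
      using padic_abs_add[of "x n - x M" "x M"] by simp
    moreover have "padic_abs p (x n - x M) < 1" using M that by simp
    ultimately show ?thesis using padic_abs_nonneg[of "x M"] by linarith
  qed
  then show ?thesis using padic_abs_nonneg[of "x M"] by (intro exI[of _ "padic_abs p (x M) + 1"]) auto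
qed

lemma padic_null_mult:
  assumes "x \<in> padic_null p" "padic_cauchy p y"
  shows "(\<lambda>n. x n * y n) \<in> padic_null p"
  unfolding padic_null_iff
proof (intro allI impI)
  fix e :: real assume e: "e > 0"
  obtain B M where B: "B > 0" "\<forall>n\<ge>M. padic_abs p (y n) < B" using padic_cauchy_bounded[OF assms(2)] by blast
  obtain N where N: "\<forall>n\<ge>N. padic_abs p (x n) < e / B" using padic_nullD[OF assms(1), of "e / B"] e B by auto
  show "\<exists>M. \<forall>n\<ge>M. padic_abs p (x n * y n) < e"
  proof (intro exI[of _ "max M N"] allI impI)
    fix n assume "max M N \<le> n"
    then have "padic_abs p (x n) * padic_abs p (y n) < e / B * B"
      using B N padic_abs_nonneg by (intro mult_strict_mono') auto
    then show "padic_abs p (x n * y n) < e" using B by (simp add: padic_abs_mult)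
  qed
qed

lemma padic_null_add:
  assumes "x \<in> padic_null p" "y \<in> padic_null p"
  shows "(\<lambda>n. x n + y n) \<in> padic_null p"
  unfolding padic_null_iff
proof (intro allI impI)
  fix e :: real assume e: "e > 0"
  obtain M where M: "\<forall>n\<ge>M. padic_abs p (x n) < e" using padic_nullD[OF assms(1) e] by blast
  obtain N where N: "\<forall>n\<ge>N. padic_abs p (y n) < e" using padic_nullD[OF assms(2) e] by blast
  show "\<exists>M. \<forall>n\<ge>M. padic_abs p (x n + y n) < e"
    using M N by (intro exI[of _ "max M N"]) (auto intro: padic_abs_add_less)
qed

lemma padic_null_minus: "x \<in> padic_null p \<Longrightarrow> (\<lambda>n. - x n) \<in> padic_null p"
  by (simp add: padic_null_iff)

lemma padic_cauchy_minus: "padic_cauchy p x \<Longrightarrow> padic_cauchy p (\<lambda>n. - x n)"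
  unfolding padic_cauchy_def
  by (metis (no_types, lifting) padic_abs_minus minus_diff_minus)

lemma padic_cauchy_mult:
  assumes "padic_cauchy p x" "padic_cauchy p y"
  shows "padic_cauchy p (\<lambda>n. x n * y n)"
  unfolding padic_cauchy_def
proof (intro allI impI)
  fix e :: real assume e: "e > 0"
  obtain B M where B: "B > 0" "\<forall>n\<ge>M. padic_abs p (y n) < B" using padic_cauchy_bounded[OF assms(2)] by blast
  obtain C N where C: "C > 0" "\<forall>n\<ge>N. padic_abs p (x n) < C" using padic_cauchy_bounded[OF assms(1)] by blast
  obtain K where K: "\<forall>m\<ge>K. \<forall>n\<ge>K. padic_abs p (x m - x n) < e / B"
    using padic_cauchyD[OF assms(1), of "e / B"] e B by auto
  obtain L where L: "\<forall>m\<ge>L. \<forall>n\<ge>L. padic_abs p (y m - y n) < e / C"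
    using padic_cauchyD[OF assms(2), of "e / C"] e C by auto
  show "\<exists>M. \<forall>m\<ge>M. \<forall>n\<ge>M. padic_abs p (x m * y m - x n * y n) < e"
  proof (intro exI[of _ "max (max M N) (max K L)"] allI impI)
    fix m n assume mn: "max (max M N) (max K L) \<le> m" "max (max M N) (max K L) \<le> n"
    have "padic_abs p (x m - x n) * padic_abs p (y m) < e / B * B"
      using mn B K padic_abs_nonneg by (intro mult_strict_mono') auto
    moreover have "padic_abs p (x n) * padic_abs p (y m - y n) < C * (e / C)"
      using mn C L padic_abs_nonneg by (intro mult_strict_mono') auto
    moreover have "x m * y m - x n * y n = (x m - x n) * y m + x n * (y m - y n)" by (simp add: algebra_simps)
    ultimately show "padic_abs p (x m * y m - x n * y n) < e"
      using B C padic_abs_add_less[of "(x m - x n) * y m" e "x n * (y m - y n)"]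
      by (simp add: padic_abs_mult)
  qed
qed

text \<open>
  Once the terms are closer to each other than \<open>e\<close> and one of them has size at least \<open>e\<close>, all later ones do.
\<close>
lemma padic_cauchy_bounded_below:
  assumes "padic_cauchy p x" "x \<notin> padic_null p"
  shows "\<exists>e>0. \<exists>M. \<forall>n\<ge>M. padic_abs p (x n) \<ge> e"
proof -
  obtain e where e: "e > 0" "\<And>M. \<exists>n\<ge>M. padic_abs p (x n) \<ge> e"
    using assms(2) unfolding padic_null_iff by (meson not_less)
  obtain M where M: "\<forall>m\<ge>M. \<forall>n\<ge>M. padic_abs p (x m - x n) < e" using padic_cauchyD[OF assms(1) e(1)] by blast
  obtain n where n: "n \<ge> M" "padic_abs p (x n) \<ge> e" using e(2) by blast
  have "padic_abs p (x m) \<ge> e" if "m \<ge> M" for m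
  proof (rule ccontr)
    assume "\<not> e \<le> padic_abs p (x m)"
    then have "padic_abs p (x m + (x n - x m)) < e"
      using M n that by (intro padic_abs_add_less) auto
    then show False using n by simp
  qed
  then show ?thesis using e(1) by blast
qed

private abbreviation (input) "R \<equiv> padic_cauchy_ring p"

lemma padic_cauchy_ring_simps:
  "carrier R = {x. padic_cauchy p x}" "x \<otimes>\<^bsub>R\<^esub> y = (\<lambda>n. x n * y n)" "\<one>\<^bsub>R\<^esub> = (\<lambda>n. 1)"
  "\<zero>\<^bsub>R\<^esub> = (\<lambda>n. 0)" "x \<oplus>\<^bsub>R\<^esub> y = (\<lambda>n. x n + y n)"
  by (simp_all add: padic_cauchy_ring_def)

lemma padic_cauchy_ring_is_ring: "ring R"
proof (rule ringI)
  show "abelian_group R"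
  proof (rule abelian_groupI)
    fix x assume "x \<in> carrier R"
    then show "\<exists>y\<in>carrier R. y \<oplus>\<^bsub>R\<^esub> x = \<zero>\<^bsub>R\<^esub>"
      by (auto simp: padic_cauchy_ring_simps intro!: exI[of _ "\<lambda>n. - x n"] padic_cauchy_minus)
  qed (auto simp: padic_cauchy_ring_simps padic_cauchy_add padic_cauchy_const algebra_simps)
  show "Group.monoid R"
    by (rule monoidI) (auto simp: padic_cauchy_ring_simps padic_cauchy_mult padic_cauchy_const algebra_simps)
qed (auto simp: padic_cauchy_ring_simps algebra_simps)

lemma padic_null_ideal: "ideal (padic_null p) R"
proof (rule idealI[OF padic_cauchy_ring_is_ring])
  interpret ring R by (rule padic_cauchy_ring_is_ring)
  show "subgroup (padic_null p) (add_monoid R)"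
  proof
    fix x assume x: "x \<in> padic_null p"
    have "\<ominus>\<^bsub>R\<^esub> x = (\<lambda>n. - x n)"
      using padic_null_cauchy[OF x] padic_cauchy_minus
      by (intro minus_equality) (auto simp: padic_cauchy_ring_simps)
    then show "inv\<^bsub>add_monoid R\<^esub> x \<in> padic_null p"
      using padic_null_minus[OF x] by (simp add: a_inv_def)
  qed (auto simp: padic_cauchy_ring_simps padic_null_add padic_null_cauchy padic_null_const_iff)
next
  fix x y assume *: "x \<in> padic_null p" "y \<in> carrier R"
  then show "y \<otimes>\<^bsub>R\<^esub> x \<in> padic_null p" "x \<otimes>\<^bsub>R\<^esub> y \<in> padic_null p"
    using padic_null_mult[of x y] by (auto simp: padic_cauchy_ring_simps mult.commute)
qed

lemma padic_coset_eq_iff: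
  "padic_null p +>\<^bsub>R\<^esub> x = padic_null p +>\<^bsub>R\<^esub> y \<longleftrightarrow> (\<lambda>n. x n - y n) \<in> padic_null p"
proof
  assume eq: "padic_null p +>\<^bsub>R\<^esub> x = padic_null p +>\<^bsub>R\<^esub> y"
  have "x \<in> padic_null p +>\<^bsub>R\<^esub> x"
    using padic_null_const_iff[of 0] by (force simp: a_r_coset_def' padic_cauchy_ring_simps)
  then obtain h where "h \<in> padic_null p" "x = (\<lambda>n. h n + y n)"
    unfolding eq by (auto simp: a_r_coset_def' padic_cauchy_ring_simps)
  then show "(\<lambda>n. x n - y n) \<in> padic_null p" by simp
next
  have sub: "padic_null p +>\<^bsub>R\<^esub> x \<subseteq> padic_null p +>\<^bsub>R\<^esub> y"
    if "(\<lambda>n. x n - y n) \<in> padic_null p" for x y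
  proof
    fix z assume "z \<in> padic_null p +>\<^bsub>R\<^esub> x"
    then obtain h where h: "h \<in> padic_null p" "z = (\<lambda>n. h n + x n)"
      by (auto simp: a_r_coset_def' padic_cauchy_ring_simps)
    then have "z = (\<lambda>n. (h n + (x n - y n)) + y n)" by simp
    then show "z \<in> padic_null p +>\<^bsub>R\<^esub> y"
      using padic_null_add[OF h(1) that] unfolding a_r_coset_def' padic_cauchy_ring_simps by blast
  qed
  assume "(\<lambda>n. x n - y n) \<in> padic_null p"
  moreover from padic_null_minus[OF this] have "(\<lambda>n. y n - x n) \<in> padic_null p" by simp
  ultimately show "padic_null p +>\<^bsub>R\<^esub> x = padic_null p +>\<^bsub>R\<^esub> y" using sub by blast
qed

text \<open>
  Solvability in the quotient field, spelled out on Cauchy sequences.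
\<close>
lemma hilbert_symbol_eq_1_iff:
  "hilbert_symbol p a b = 1 \<longleftrightarrow>
    (\<exists>x y z. padic_cauchy p x \<and> padic_cauchy p y \<and> padic_cauchy p z \<and>
       \<not> (x \<in> padic_null p \<and> y \<in> padic_null p \<and> z \<in> padic_null p) \<and>
       (\<lambda>n. z n * z n - (a * (x n * x n) + b * (y n * y n))) \<in> padic_null p)"
proof -
  interpret I: ideal "padic_null p" R by (rule padic_null_ideal)
  let ?c = "\<lambda>x. padic_null p +>\<^bsub>R\<^esub> x"
  define K where "K = padic_field p"
  have carr: "carrier K = ?c ` {x. padic_cauchy p x}"
    by (auto simp: K_def padic_field_def FactRing_def A_RCOSETS_def' padic_cauchy_ring_simps)
  have zero: "?c x = \<zero>\<^bsub>K\<^esub> \<longleftrightarrow> x \<in> padic_null p" for x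
  proof -
    have "\<zero>\<^bsub>K\<^esub> = ?c (\<lambda>n. 0)"
      by (auto simp: K_def padic_field_def FactRing_def a_r_coset_def' padic_cauchy_ring_simps)
    then show ?thesis using padic_coset_eq_iff[of x "\<lambda>n. 0"] by simp
  qed
  have mult: "?c x \<otimes>\<^bsub>K\<^esub> ?c y = ?c (\<lambda>n. x n * y n)" if "padic_cauchy p x" "padic_cauchy p y" for x y
    using I.rcoset_mult_add[of x y] that
    by (simp add: K_def padic_field_def FactRing_def padic_cauchy_ring_simps)
  have add: "?c x \<oplus>\<^bsub>K\<^esub> ?c y = ?c (\<lambda>n. x n + y n)" if "padic_cauchy p x" "padic_cauchy p y" for x y
    using I.a_rcos_sum[of x y] that
    by (simp add: K_def padic_field_def FactRing_def padic_cauchy_ring_simps)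
  have eq: "?c z \<otimes>\<^bsub>K\<^esub> ?c z = (padic_of_rat p a \<otimes>\<^bsub>K\<^esub> (?c x \<otimes>\<^bsub>K\<^esub> ?c x)) \<oplus>\<^bsub>K\<^esub> (padic_of_rat p b \<otimes>\<^bsub>K\<^esub> (?c y \<otimes>\<^bsub>K\<^esub> ?c y))
     \<longleftrightarrow> (\<lambda>n. z n * z n - (a * (x n * x n) + b * (y n * y n))) \<in> padic_null p"
    if "padic_cauchy p x" "padic_cauchy p y" "padic_cauchy p z" for x y z
    using that by (simp add: padic_of_rat_def mult add padic_cauchy_mult padic_cauchy_const padic_coset_eq_iff)
  have bexK: "(\<exists>x\<in>carrier K. P x) \<longleftrightarrow> (\<exists>x. padic_cauchy p x \<and> P (?c x))" for P
    by (auto simp: carr)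
  have "hilbert_symbol p a b = 1 \<longleftrightarrow>
     (\<exists>x\<in>carrier K. \<exists>y\<in>carrier K. \<exists>z\<in>carrier K.
           \<not> (x = \<zero>\<^bsub>K\<^esub> \<and> y = \<zero>\<^bsub>K\<^esub> \<and> z = \<zero>\<^bsub>K\<^esub>) \<and>
           z \<otimes>\<^bsub>K\<^esub> z = (padic_of_rat p a \<otimes>\<^bsub>K\<^esub> (x \<otimes>\<^bsub>K\<^esub> x)) \<oplus>\<^bsub>K\<^esub>
                      (padic_of_rat p b \<otimes>\<^bsub>K\<^esub> (y \<otimes>\<^bsub>K\<^esub> y)))"
    by (simp add: hilbert_symbol_def Let_def K_def)
  also have "\<dots> \<longleftrightarrow> (\<exists>x. padic_cauchy p x \<and> (\<exists>y. padic_cauchy p y \<and> (\<exists>z. padic_cauchy p z \<and>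
       \<not> (x \<in> padic_null p \<and> y \<in> padic_null p \<and> z \<in> padic_null p) \<and>
       (\<lambda>n. z n * z n - (a * (x n * x n) + b * (y n * y n))) \<in> padic_null p)))"
    unfolding bexK by (simp only: zero eq cong: conj_cong)
  finally show ?thesis by blast
qed

lemma hilbert_symbol_values: "hilbert_symbol p a b \<in> {1, -1}"
  by (simp add: hilbert_symbol_def Let_def)

text \<open>
  Hensel's lemma for \<open>x\<^sup>2 - a\<close>: a root modulo \<open>p\<^sup>n\<close> is refined by a Newton step, and the successive approximations
  form a Cauchy sequence.
\<close>
lemma padic_sqrt_exists:
  assumes "2 < p" "\<not> int p dvd a" "Legendre a (int p) = 1"
  obtains s where "padic_cauchy p s" "(\<lambda>n. s n * s n - of_int a) \<in> padic_null p"
proof -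
  have "QuadRes (int p) a" using assms(3) by (auto simp: Legendre_def split: if_splits)
  then obtain y where "[y ^ 2 = a] (mod int p)" unfolding QuadRes_def by blast
  then have y: "int p ^ Suc 0 dvd y ^ 2 - a" by (simp add: cong_iff_dvd_diff)
  have "\<exists>t. \<forall>n. int p ^ Suc n dvd (t n) ^ 2 - a \<and> int p ^ Suc n dvd t (Suc n) - t n"
  proof (rule dependent_nat_choice)
    show "\<exists>x. int p ^ Suc 0 dvd x ^ 2 - a" using y by blast
  next
    fix x n assume x: "int p ^ Suc n dvd x ^ 2 - a"
    then obtain k where k: "x ^ 2 - a = int p ^ Suc n * k" by blast
    have "int p dvd x ^ 2 - a" using x by (meson dvd_power dvd_trans zero_less_Suc dvd_triv_left power_Suc)
    have "\<not> int p dvd x"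
    proof
      assume "int p dvd x"
      then have "int p dvd x ^ 2" by (simp add: power2_eq_square)
      from dvd_diff[OF this \<open>int p dvd x ^ 2 - a\<close>] show False using assms(2) by simp
    qed
    moreover have "\<not> int p dvd 2" using assms(1) zdvd_imp_le[of "int p" 2] by auto
    ultimately have "\<not> int p dvd 2 * x" using prime_int_p by (simp add: prime_dvd_mult_iff)
    then have "coprime (2 * x) (int p)" using prime_imp_coprime[OF prime_int_p] coprime_commute by blast
    then obtain v where v: "[2 * x * v = 1] (mod int p)" using cong_solve_coprime_int by blast
    \<comment> \<open>A Newton step, with the inverse \<open>v\<close> of the derivative \<open>2 x\<close> modulo \<open>p\<close>.\<close>
    define x' where "x' = x - int p ^ Suc n * (k * v)"
    have "x' ^ 2 - a = int p ^ Suc n * (k * (1 - 2 * x * v)) + int p ^ Suc n * int p ^ Suc n * (k * v) ^ 2"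
      using k unfolding x'_def by (simp add: power2_eq_square algebra_simps)
    moreover have "int p dvd 1 - 2 * x * v" using v by (simp add: cong_iff_dvd_diff dvd_diff_commute)
    then have "int p ^ Suc (Suc n) dvd int p ^ Suc n * (k * (1 - 2 * x * v))"
      by (simp add: mult_dvd_mono dvd_mult mult.commute[of "int p"])
    moreover have "int p ^ Suc (Suc n) dvd int p ^ Suc n * int p ^ Suc n * (k * v) ^ 2"
      by (simp add: mult_dvd_mono dvd_mult2 mult.assoc)
    ultimately have "int p ^ Suc (Suc n) dvd x' ^ 2 - a" by (metis dvd_add)
    moreover have "int p ^ Suc n dvd x' - x" unfolding x'_def by simp
    ultimately show "\<exists>x'. int p ^ Suc (Suc n) dvd x' ^ 2 - a \<and> int p ^ Suc n dvd x' - x" by blast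
  qed
  then obtain t where t: "\<And>n. int p ^ Suc n dvd (t n) ^ 2 - a" "\<And>n. int p ^ Suc n dvd t (Suc n) - t n" by blast
  have t2: "int p ^ Suc M dvd t (M + k) - t M" for M k
  proof (induction k)
    case (Suc k)
    have "int p ^ Suc M dvd t (Suc (M + k)) - t (M + k)"
      using t(2)[of "M + k"] by (rule power_le_dvd) simp
    then have "int p ^ Suc M dvd (t (Suc (M + k)) - t (M + k)) + (t (M + k) - t M)" using Suc by (rule dvd_add)
    then show ?case by simp
  qed simp
  have t3: "int p ^ Suc M dvd t m - t n" if "m \<ge> M" "n \<ge> M" for m n M
    using dvd_diff[OF t2[of M "m - M"] t2[of M "n - M"]] that by simp
  have small: "\<exists>M. 1 / real p ^ Suc M < e" if e: "e > 0" for e :: real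
  proof -
    obtain M where "(1 / real p) ^ M < e" using real_arch_pow_inv[OF e, of "1 / real p"] p_gt_1 by auto
    moreover have "1 / real p ^ Suc M \<le> (1 / real p) ^ M" using p_gt_1 by (simp add: power_one_over divide_simps)
    ultimately show ?thesis by (meson order.strict_trans1)
  qed
  show ?thesis
  proof
    show "padic_cauchy p (\<lambda>n. of_int (t n))"
      unfolding padic_cauchy_def
    proof (intro allI impI)
      fix e :: real assume "e > 0"
      then obtain M where "1 / real p ^ Suc M < e" using small by blast
      then show "\<exists>M. \<forall>m\<ge>M. \<forall>n\<ge>M. padic_abs p (of_int (t m) - of_int (t n)) < e"
        using t3 padic_abs_of_int_le_iff[of "t m - t n" "Suc M" for m n]
        by (intro exI[of _ M] allI impI) (metis of_int_diff order.strict_trans1)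
    qed
    show "(\<lambda>n. of_int (t n) * of_int (t n) - of_int a) \<in> padic_null p"
      unfolding padic_null_iff
    proof (intro allI impI)
      fix e :: real assume "e > 0"
      then obtain M where M: "1 / real p ^ Suc M < e" using small by blast
      show "\<exists>M. \<forall>n\<ge>M. padic_abs p (of_int (t n) * of_int (t n) - of_int a) < e"
      proof (intro exI[of _ M] allI impI)
        fix n assume "M \<le> n"
        then have "int p ^ Suc M dvd (t n) ^ 2 - a" using t(1)[of n] by (meson Suc_le_mono power_le_dvd)
        then have "padic_abs p (of_int ((t n) ^ 2 - a)) < e" using padic_abs_of_int_le_iff M order.strict_trans1 by blast
        then show "padic_abs p (of_int (t n) * of_int (t n) - of_int a) < e" by (simp add: power2_eq_square)
      qed
    qed
  qed
qed

lemma primitive_triple: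
  fixes x y z :: rat
  assumes "\<not> (x = 0 \<and> y = 0 \<and> z = 0)"
  obtains r X Y Z where "r \<noteq> 0" "of_int X = r * x" "of_int Y = r * y" "of_int Z = r * z"
    "\<not> (int p dvd X \<and> int p dvd Y \<and> int p dvd Z)"
proof -
  obtain a b where x: "x = of_int a / of_int b" "b \<noteq> 0" by (rule rat_fraction)
  obtain c d where y: "y = of_int c / of_int d" "d \<noteq> 0" by (rule rat_fraction)
  obtain e f where z: "z = of_int e / of_int f" "f \<noteq> 0" by (rule rat_fraction)
  define X0 Y0 Z0 where "X0 = a * d * f" and "Y0 = c * b * f" and "Z0 = e * b * d"
  define g where "g = gcd X0 (gcd Y0 Z0)"
  have nz: "\<not> (X0 = 0 \<and> Y0 = 0 \<and> Z0 = 0)" using assms x y z by (auto simp: X0_def Y0_def Z0_def)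
  then have g: "g \<noteq> 0" by (auto simp: g_def)
  obtain X where X: "X0 = g * X" unfolding g_def by (meson dvdE gcd_dvd1)
  obtain Y where Y: "Y0 = g * Y" unfolding g_def by (meson dvdE dvd_trans gcd_dvd1 gcd_dvd2)
  obtain Z where Z: "Z0 = g * Z" unfolding g_def by (meson dvdE dvd_trans gcd_dvd2)
  define r where "r = (of_int (b * d * f) / of_int g :: rat)"
  show ?thesis
  proof
    show "r \<noteq> 0" using x y z g by (simp add: r_def)
    have "r * x = of_int X0 / of_int g" "r * y = of_int Y0 / of_int g" "r * z = of_int Z0 / of_int g"
      using x y z by (simp_all add: r_def X0_def Y0_def Z0_def)
    then show "of_int X = r * x" "of_int Y = r * y" "of_int Z = r * z" using g by (simp_all add: X Y Z)
    show "\<not> (int p dvd X \<and> int p dvd Y \<and> int p dvd Z)"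
    proof
      assume "int p dvd X \<and> int p dvd Y \<and> int p dvd Z"
      then have "g * int p dvd X0" "g * int p dvd Y0" "g * int p dvd Z0" using X Y Z by auto
      then have "g * int p dvd g * 1" by (simp add: g_def)
      then show False using g prime_int_p by (simp only: dvd_mult_cancel_left) auto
    qed
  qed
qed

text \<open>
  Approximate a nontrivial solution by rationals and rescale so that the largest entry is a unit.  The largest entry of the solution is
  eventually bounded below by some \<open>e\<close>, so the rescaling enlarges the error by at most \<open>1 / e\<^sup>2\<close>, which the
  quality of the approximation absorbs.  The factor \<open>c\<^sup>2\<close> is moved into the first variable.
\<close>
lemma hilbert_symbol_primitive_solution:
  assumes "hilbert_symbol p (c ^ 2 * of_int a) (of_int b) = 1" "c \<noteq> 0"
  obtains X Y Z where "\<not> (int p dvd X \<and> int p dvd Y \<and> int p dvd Z)"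
    "int p ^ k dvd Z ^ 2 - (a * X ^ 2 + b * Y ^ 2)"
proof -
  obtain x y z where c: "padic_cauchy p x" "padic_cauchy p y" "padic_cauchy p z"
    and nz: "\<not> (x \<in> padic_null p \<and> y \<in> padic_null p \<and> z \<in> padic_null p)"
    and eq: "(\<lambda>n. z n * z n - (c ^ 2 * of_int a * (x n * x n) + of_int b * (y n * y n))) \<in> padic_null p"
    using assms(1) unfolding hilbert_symbol_eq_1_iff by blast
  define m where "m n = max (padic_abs p (c * x n)) (max (padic_abs p (y n)) (padic_abs p (z n)))" for n
  have "\<exists>e>0. \<exists>M. \<forall>n\<ge>M. m n \<ge> e"
  proof -
    consider "x \<notin> padic_null p" | "y \<notin> padic_null p" | "z \<notin> padic_null p" using nz by blast
    then show ?thesis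
    proof cases
      case 1
      obtain e M where e: "e > 0" "\<forall>n\<ge>M. padic_abs p (x n) \<ge> e" using padic_cauchy_bounded_below[OF c(1) 1] by blast
      have "\<forall>n\<ge>M. m n \<ge> padic_abs p c * e"
        using e padic_abs_nonneg[of c] unfolding m_def padic_abs_mult by (meson max.coboundedI1 mult_left_mono)
      then show ?thesis using e(1) padic_abs_pos[OF assms(2)] by (intro exI[of _ "padic_abs p c * e"]) auto
    next
      case 2 then show ?thesis using padic_cauchy_bounded_below[OF c(2)] unfolding m_def by (meson max.coboundedI1 max.coboundedI2)
    next
      case 3 then show ?thesis using padic_cauchy_bounded_below[OF c(3)] unfolding m_def by (meson max.coboundedI1 max.coboundedI2)
    qed
  qed
  then obtain e M where e: "e > 0" "\<And>n. n \<ge> M \<Longrightarrow> m n \<ge> e" by blast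
  have "e ^ 2 / real p ^ k > 0" using e p_gt_1 by simp
  from padic_nullD[OF eq this] obtain N where
    N: "\<And>n. n \<ge> N \<Longrightarrow> padic_abs p (z n * z n - (c ^ 2 * of_int a * (x n * x n) + of_int b * (y n * y n))) < e ^ 2 / real p ^ k" by blast
  define n where "n = max M N"
  have mn: "m n \<ge> e" using e(2) by (simp add: n_def)
  have "\<not> (c * x n = 0 \<and> y n = 0 \<and> z n = 0)"
  proof
    assume "c * x n = 0 \<and> y n = 0 \<and> z n = 0"
    then have "m n = 0" unfolding m_def by (simp only: padic_abs_0 max.idem)
    then show False using mn e(1) by simp
  qed
  then obtain r X Y Z where r: "r \<noteq> 0" "of_int X = r * (c * x n)" "of_int Y = r * y n" "of_int Z = r * z n"
    and nd: "\<not> (int p dvd X \<and> int p dvd Y \<and> int p dvd Z)" by (rule primitive_triple)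
  show ?thesis
  proof (rule that[OF nd])
    have "padic_abs p r * e \<le> padic_abs p r * m n" using mn padic_abs_nonneg by (intro mult_left_mono) auto
    also have "\<dots> \<le> 1"
      using padic_abs_of_int_le_1[of X] padic_abs_of_int_le_1[of Y] padic_abs_of_int_le_1[of Z]
      unfolding r(2-4) m_def padic_abs_mult[of r] by (auto simp: max_def)
    finally have re: "padic_abs p r * e \<le> 1" .
    have "padic_abs p (of_int (Z ^ 2 - (a * X ^ 2 + b * Y ^ 2)))
       = padic_abs p (r ^ 2 * (z n * z n - (c ^ 2 * of_int a * (x n * x n) + of_int b * (y n * y n))))"
      by (simp add: r(2-4) power2_eq_square algebra_simps)
    also have "\<dots> = padic_abs p r ^ 2 * padic_abs p (z n * z n - (c ^ 2 * of_int a * (x n * x n) + of_int b * (y n * y n)))"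
      by (simp add: padic_abs_mult power2_eq_square)
    also have "\<dots> \<le> padic_abs p r ^ 2 * (e ^ 2 / real p ^ k)"
      using N[of n] by (intro mult_left_mono) (auto simp: n_def)
    also have "\<dots> = (padic_abs p r * e) ^ 2 / real p ^ k" by (simp add: power_mult_distrib)
    also have "\<dots> \<le> 1 / real p ^ k"
      using re e(1) padic_abs_nonneg[of r] p_gt_1 by (intro divide_right_mono power_le_one) auto
    finally show "int p ^ k dvd Z ^ 2 - (a * X ^ 2 + b * Y ^ 2)" by (simp only: padic_abs_of_int_le_iff)
  qed
qed

lemma legendre_eq_1_iff: "Legendre a (int p) = 1 \<longleftrightarrow> \<not> int p dvd a \<and> (\<exists>y. int p dvd y ^ 2 - a)"
  by (auto simp: Legendre_def QuadRes_def cong_iff_dvd_diff)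

lemma legendre_eq_1I:
  assumes "int p dvd y ^ 2 - a * x ^ 2" "\<not> int p dvd x" "\<not> int p dvd a"
  shows "Legendre a (int p) = 1"
proof -
  have "coprime x (int p)" using assms(2) prime_imp_coprime[OF prime_int_p] coprime_commute by blast
  then obtain v where v: "int p dvd x * v - 1" using cong_solve_coprime_int by (metis cong_iff_dvd_diff)
  have "(y * v) ^ 2 - a = v ^ 2 * (y ^ 2 - a * x ^ 2) + a * (x * v + 1) * (x * v - 1)"
    by (simp add: power2_eq_square algebra_simps)
  also have "int p dvd \<dots>" using assms(1) v by (intro dvd_add dvd_mult)
  finally show ?thesis using assms(3) unfolding legendre_eq_1_iff by blast
qed

lemma prime_dvd_square: "int p dvd x ^ 2 \<longleftrightarrow> int p dvd x"
  using prime_int_p by (simp add: prime_dvd_power_iff)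

lemma sign_eq_iff: "s \<in> {1, -1} \<Longrightarrow> r \<in> {1, -1} \<Longrightarrow> s = r \<longleftrightarrow> (s = 1 \<longleftrightarrow> r = (1::int))"
  by auto

text \<open>
  Modulo \<open>p\<close> a solution reads \<open>z\<^sup>2 = a x\<^sup>2\<close>; if \<open>p\<close> divided \<open>x\<close>, it would divide \<open>z\<close> and,
  by the congruence modulo \<open>p\<^sup>2\<close>, also \<open>y\<close>.  Conversely \<open>x = 1 / c, y = 0, z = \<surd>a\<close> is a solution.
\<close>
lemma hilbert_symbol_unit:
  assumes "2 < p" "\<not> int p dvd a" "\<not> int p dvd b" "c \<noteq> 0"
  shows "hilbert_symbol p (c ^ 2 * of_int a) (of_int (int p * b)) = Legendre a (int p)"
proof -
  have "hilbert_symbol p (c ^ 2 * of_int a) (of_int (int p * b)) = 1 \<longleftrightarrow> Legendre a (int p) = 1"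
  proof
    assume "hilbert_symbol p (c ^ 2 * of_int a) (of_int (int p * b)) = 1"
    from hilbert_symbol_primitive_solution[OF this assms(4), of 2] obtain X Y Z where
      nd: "\<not> (int p dvd X \<and> int p dvd Y \<and> int p dvd Z)"
      and eq: "int p ^ 2 dvd Z ^ 2 - (a * X ^ 2 + int p * b * Y ^ 2)" by blast
    have "int p dvd Z ^ 2 - (a * X ^ 2 + int p * b * Y ^ 2)" using eq by (meson dvd_trans dvd_power pos2)
    then have "int p dvd Z ^ 2 - (a * X ^ 2 + int p * b * Y ^ 2) + int p * (b * Y ^ 2)" by (intro dvd_add) auto
    then have eq1: "int p dvd Z ^ 2 - a * X ^ 2" by (simp add: algebra_simps)
    have "\<not> int p dvd X"
    proof
      assume X: "int p dvd X"
      then have "int p dvd Z ^ 2 - a * X ^ 2 + a * X ^ 2" using eq1 by (intro dvd_add) (simp_all add: power2_eq_square)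
      then have Z: "int p dvd Z" by (simp add: prime_dvd_square)
      have "int p ^ 2 dvd Z ^ 2 - a * X ^ 2"
        using X Z by (intro dvd_diff dvd_mult dvd_power_same)
      from dvd_diff[OF this eq] have "int p * int p dvd int p * (b * Y ^ 2)" by (simp add: power2_eq_square algebra_simps)
      moreover have "int p \<noteq> 0" using prime_int_p by auto
      ultimately have "int p dvd b * Y ^ 2" by (simp only: dvd_mult_cancel_left) auto
      then have "int p dvd Y" using assms(3) prime_int_p prime_dvd_mult_iff prime_dvd_square by blast
      then show False using nd X Z by blast
    qed
    then show "Legendre a (int p) = 1" using legendre_eq_1I eq1 assms(2) by blast
  next
    assume "Legendre a (int p) = 1"
    then obtain s where s: "padic_cauchy p s" "(\<lambda>n. s n * s n - of_int a) \<in> padic_null p"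
      using padic_sqrt_exists[OF assms(1,2)] by blast
    show "hilbert_symbol p (c ^ 2 * of_int a) (of_int (int p * b)) = 1"
      unfolding hilbert_symbol_eq_1_iff
      using s assms(4) padic_cauchy_const padic_null_const_iff
      by (intro exI[of _ "\<lambda>n. 1 / c"] exI[of _ "\<lambda>n. 0"] exI[of _ s]) (auto simp: power2_eq_square)
  qed
  moreover have "Legendre a (int p) \<in> {1, -1}" using assms(2) by (auto simp: Legendre_def cong_0_iff)
  ultimately show ?thesis using sign_eq_iff[OF hilbert_symbol_values] by blast
qed

text \<open>
  Here \<open>p\<close> divides \<open>z\<close>, so modulo \<open>p\<^sup>2\<close> a solution forces \<open>a x\<^sup>2 + b y\<^sup>2 = 0\<close> modulo \<open>p\<close>.  Conversely
  \<open>x = b / c, y = \<surd>(- a b), z = 0\<close> is a solution.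
\<close>
lemma hilbert_symbol_uniformizer:
  assumes "2 < p" "\<not> int p dvd a" "\<not> int p dvd b" "c \<noteq> 0"
  shows "hilbert_symbol p (c ^ 2 * of_int (int p * a)) (of_int (int p * b)) = Legendre (- (a * b)) (int p)"
proof -
  have nab: "\<not> int p dvd - (a * b)" using assms(2,3) prime_int_p by (simp add: prime_dvd_mult_iff)
  have "hilbert_symbol p (c ^ 2 * of_int (int p * a)) (of_int (int p * b)) = 1 \<longleftrightarrow> Legendre (- (a * b)) (int p) = 1"
  proof
    assume "hilbert_symbol p (c ^ 2 * of_int (int p * a)) (of_int (int p * b)) = 1"
    from hilbert_symbol_primitive_solution[OF this assms(4), of 2] obtain X Y Z where
      nd: "\<not> (int p dvd X \<and> int p dvd Y \<and> int p dvd Z)"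
      and eq: "int p ^ 2 dvd Z ^ 2 - (int p * a * X ^ 2 + int p * b * Y ^ 2)" by blast
    have "int p dvd Z ^ 2 - (int p * a * X ^ 2 + int p * b * Y ^ 2)" using eq by (meson dvd_trans dvd_power pos2)
    then have "int p dvd Z ^ 2 - (int p * a * X ^ 2 + int p * b * Y ^ 2) + int p * (a * X ^ 2 + b * Y ^ 2)"
      by (intro dvd_add) auto
    then have "int p dvd Z ^ 2" by (simp add: algebra_simps)
    then have Z: "int p dvd Z" by (simp add: prime_dvd_square)
    from dvd_diff[OF dvd_power_same[OF Z] eq] have "int p * int p dvd int p * (a * X ^ 2 + b * Y ^ 2)" by (simp add: power2_eq_square algebra_simps)
    moreover have "int p \<noteq> 0" using prime_int_p by auto
    ultimately have eq1: "int p dvd a * X ^ 2 + b * Y ^ 2" by (simp only: dvd_mult_cancel_left) auto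
    have X: "\<not> int p dvd X"
    proof
      assume X: "int p dvd X"
      then have "int p dvd a * X ^ 2 + b * Y ^ 2 - a * X ^ 2" using eq1 by (intro dvd_diff) (simp_all add: power2_eq_square)
      then have "int p dvd b * Y ^ 2" by simp
      then have "int p dvd Y" using assms(3) prime_int_p prime_dvd_mult_iff prime_dvd_square by blast
      then show False using nd X Z by blast
    qed
    have "(b * Y) ^ 2 - (- (a * b)) * X ^ 2 = b * (a * X ^ 2 + b * Y ^ 2)" by (simp add: power2_eq_square algebra_simps)
    then have "int p dvd (b * Y) ^ 2 - (- (a * b)) * X ^ 2" using eq1 by simp
    then show "Legendre (- (a * b)) (int p) = 1" using legendre_eq_1I X nab by blast
  next
    assume "Legendre (- (a * b)) (int p) = 1"
    then obtain s where s: "padic_cauchy p s" "(\<lambda>n. s n * s n - of_int (- (a * b))) \<in> padic_null p"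
      using padic_sqrt_exists[OF assms(1) nab] by blast
    have b0: "b \<noteq> 0" using assms(3) by auto
    have "(\<lambda>n. (s n * s n - of_int (- (a * b))) * (- of_int (int p * b))) \<in> padic_null p"
      by (rule padic_null_mult[OF s(2) padic_cauchy_const])
    moreover have "(\<lambda>n. (s n * s n - of_int (- (a * b))) * (- of_int (int p * b))) =
      (\<lambda>n. 0 * 0 - (c ^ 2 * of_int (int p * a) * (of_int b / c * (of_int b / c)) + of_int (int p * b) * (s n * s n)))"
      using assms(4) by (intro ext) (simp add: field_simps power2_eq_square)
    ultimately show "hilbert_symbol p (c ^ 2 * of_int (int p * a)) (of_int (int p * b)) = 1"
      unfolding hilbert_symbol_eq_1_iff
      using s assms(4) b0 padic_cauchy_const padic_null_const_iff
      by (intro exI[of _ "\<lambda>n. of_int b / c"] exI[of _ s] exI[of _ "\<lambda>n. 0"]) auto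
  qed
  moreover have "Legendre (- (a * b)) (int p) \<in> {1, -1}" using nab by (auto simp: Legendre_def cong_0_iff)
  ultimately show ?thesis using sign_eq_iff[OF hilbert_symbol_values] by blast
qed

text \<open>
  An even power of \<open>p\<close> in \<open>a\<close> can be moved into the square \<open>c\<^sup>2\<close>, which leaves the two cases above.  As
  \<open>p\<close> is 1 modulo 4, -1 is a square modulo \<open>p\<close> and the sign in the second case disappears.
\<close>
lemma hilbert_symbol_eq_tame_symbol:
  assumes "p mod 4 = 1" "int p dvd d" "\<not> int p ^ 2 dvd d" "a \<noteq> 0" "c \<noteq> 0"
  shows "hilbert_symbol p (c ^ 2 * of_int a) (of_int d) = tame_symbol p a d"
proof -
  have p2: "2 < p" using assms p prime_ge_2_nat[of p] by (cases "p = 2") auto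
  obtain b where b: "d = int p * b" using assms(2) by blast
  have nb: "\<not> int p dvd b" using assms(3) b by (auto simp: power2_eq_square)
  define k where "k = multiplicity (int p) a"
  obtain a' where a': "a = int p ^ k * a'" "\<not> int p dvd a'"
    using multiplicity_decompose'[of a "int p"] assms(4) prime_int_p unfolding k_def by (metis not_prime_unit)
  have p0: "int p \<noteq> 0" using p2 by simp
  have tame: "tame_symbol p a d = Legendre a' (int p) * Legendre b (int p) ^ k"
    unfolding tame_symbol_def k_def[symmetric] using a'(1) b p0 by simp
  have Lb: "Legendre b (int p) * Legendre b (int p) = 1" by (rule legendre_sq[OF p p2 nb])
  have cj: "c * of_nat p ^ j \<noteq> 0" for j using assms(5) p2 by simp
  show ?thesis
  proof (cases "even k")
    case True
    then obtain j where j: "k = 2 * j" by blast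
    have ca: "c ^ 2 * of_int a = (c * of_nat p ^ j) ^ 2 * of_int a'"
      by (simp add: a'(1) j power_mult_distrib power_mult[symmetric] mult.commute)
    have "hilbert_symbol p ((c * of_nat p ^ j) ^ 2 * of_int a') (of_int d) = Legendre a' (int p)"
      unfolding b by (rule hilbert_symbol_unit[OF p2 a'(2) nb cj])
    then show ?thesis unfolding ca tame using Lb by (simp add: j power_mult power2_eq_square)
  next
    case False
    then obtain j where j: "k = 2 * j + 1" by (elim oddE)
    have ca: "c ^ 2 * of_int a = (c * of_nat p ^ j) ^ 2 * of_int (int p * a')"
      by (simp add: a'(1) j power_mult_distrib power_mult[symmetric] mult.commute mult.left_commute)
    have "Legendre (- (a' * b)) (int p) = Legendre a' (int p) * Legendre b (int p)"
      using legendre_mult[OF p p2, of "-1" "a' * b"] legendre_mult[OF p p2, of a' b] legendre_minus_one[OF p assms(1)]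
      by simp
    moreover have "hilbert_symbol p ((c * of_nat p ^ j) ^ 2 * of_int (int p * a')) (of_int d)
        = Legendre (- (a' * b)) (int p)"
      unfolding b by (rule hilbert_symbol_uniformizer[OF p2 a'(2) nb cj])
    ultimately show ?thesis unfolding ca tame using Lb by (simp add: j power_mult power2_eq_square)
  qed
qed

end

section \<open>Algebraic integers of degree two\<close>

text \<open>
  Gauss's lemma: the content of \<open>q\<close> must be \<open>\<bar>a\<bar>\<close>, so comparing leading coefficients leaves a unit.
\<close>
lemma lead_coeff_unit_of_common_root:
  fixes f p :: "int poly"
  assumes f: "content f = 1" and p: "lead_coeff p = 1"
    and mult: "Polynomial.smult a p = f * q" "a \<noteq> 0"
  shows "\<bar>lead_coeff f\<bar> = 1"
proof -
  have "content p dvd 1" using content_dvd_coeff[of p "degree p"] p by simp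
  then have cp: "content p = 1" by (metis is_unit_normalize normalize_content)
  have "content (f * q) = normalize a * content p" unfolding mult(1)[symmetric] by (simp add: content_smult)
  then have "content q = \<bar>a\<bar>" using f cp by (simp add: content_mult)
  then have "a dvd lead_coeff q" using content_dvd_coeff[of q "degree q"] by simp
  then obtain t where "lead_coeff q = a * t" by blast
  moreover have "a = lead_coeff f * lead_coeff q"
    using arg_cong[OF mult(1), of lead_coeff] p mult(2) unfolding lead_coeff_mult lead_coeff_smult by simp
  ultimately have "a * (lead_coeff f * t) = a * 1" by simp
  then have "lead_coeff f * t = 1" using mult(2) by (simp only: mult_cancel_left) simp
  from dvdI[OF this[symmetric]] show ?thesis by (simp only: zdvd1_eq)
qed

lemma poly_of_int_add:
  "poly (map_poly of_int (g + h)) x = poly (map_poly of_int g) x + poly (map_poly of_int h) (x :: complex)"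
  by (induction g h rule: poly_induct2) (simp_all add: map_poly_pCons algebra_simps)

lemma poly_of_int_smult:
  "poly (map_poly of_int (Polynomial.smult a h)) x = of_int a * poly (map_poly of_int h) (x :: complex)"
  by (induction h) (simp_all add: map_poly_pCons algebra_simps)

lemma poly_of_int_mult:
  "poly (map_poly of_int (g * h)) x = poly (map_poly of_int g) x * poly (map_poly of_int h) (x :: complex)"
  by (induction g) (simp_all add: map_poly_pCons poly_of_int_add poly_of_int_smult algebra_simps)

text \<open>
  The primitive integral multiple \<open>f\<close> of the minimal polynomial divides a multiple of every integral
  polynomial vanishing at \<open>x\<close>, because a nonzero remainder would be linear with a non-real root.
  Applied to a monic polynomial this makes \<open>f\<close> monic up to sign.
\<close>
lemma complex_quadratic_integer:
  fixes x :: complex and T r :: rat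
  assumes "algebraic_int x" and "Im x \<noteq> 0" and x: "x * x - of_rat T * x + of_rat r = 0"
  shows "T \<in> \<int> \<and> r \<in> \<int>"
proof -
  obtain p :: "int poly" where p: "poly (map_poly of_int p) x = 0" "lead_coeff p = 1"
    using assms(1) algebraic_int_altdef_ipoly by blast
  obtain t1 t2 where T: "T = of_int t1 / of_int t2" "t2 \<noteq> 0"
    by (metis quotient_of_div quotient_of_denom_pos less_irrefl surj_pair)
  obtain r1 r2 where r: "r = of_int r1 / of_int r2" "r2 \<noteq> 0"
    by (metis quotient_of_div quotient_of_denom_pos less_irrefl surj_pair)
  define f0 where "f0 = [:r1 * t2, - t1 * r2, t2 * r2:]"
  define f where "f = primitive_part f0"
  have f00: "f0 \<noteq> 0" using T r by (simp add: f0_def)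
  have f: "content f = 1" "f0 = Polynomial.smult (content f0) f"
    using f00 by (auto simp: f_def content_primitive_part)
  have c0: "content f0 \<noteq> 0" using f00 by simp
  have degf: "degree f = 2" using T r unfolding f_def by (simp add: f0_def)
  have cTr: "(of_rat T :: complex) = of_int t1 / of_int t2" "(of_rat r :: complex) = of_int r1 / of_int r2"
    using T r by (simp_all add: of_rat_divide)
  have "poly (map_poly of_int f0) x = of_int (t2 * r2) * (x * x - of_rat T * x + of_rat r)"
    unfolding cTr using T(2) r(2) by (simp add: f0_def map_poly_pCons field_simps)
  then have "of_int (content f0) * poly (map_poly of_int f) x = 0"
    using x f(2) poly_of_int_smult[of "content f0" f x] by simp
  then have fx: "poly (map_poly of_int f) x = (0::complex)" using c0 by simp
  obtain a q where aq: "a \<noteq> 0" "Polynomial.smult a p = f * q + pseudo_mod p f"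
    using pseudo_mod(1)[of f p] f(1) by force
  define g where "g = pseudo_mod p f"
  have "g = 0 \<or> degree g < degree f" unfolding g_def using pseudo_mod(2)[of f p] f(1) by force
  have "g = 0"
  proof (rule ccontr)
    assume g0: "g \<noteq> 0"
    then have "degree g < 2" using \<open>g = 0 \<or> degree g < degree f\<close> degf by simp
    obtain u g1 where g1: "g = pCons u g1" by (cases g)
    have "degree g1 = 0" using \<open>degree g < 2\<close> unfolding g1 by (cases "g1 = 0") auto
    then obtain v where "g1 = [:v:]" by (rule degree_eq_zeroE)
    then have g: "g = [:u, v:]" using g1 by simp
    have "poly (map_poly of_int (Polynomial.smult a p)) x = poly (map_poly of_int (f * q + g)) x"
      using aq(2) g_def by simp
    then have "poly (map_poly of_int g) x = (0::complex)"
      using p(1) fx by (simp add: poly_of_int_add poly_of_int_smult poly_of_int_mult)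
    then have "of_int u + x * of_int v = 0" by (simp add: g map_poly_pCons)
    then have "v = 0" "u = 0" using assms(2) by (auto simp: complex_eq_iff)
    then show False using g0 g by simp
  qed
  then have "Polynomial.smult a p = f * q" using aq(2) g_def by simp
  then have "\<bar>lead_coeff f\<bar> = 1" using lead_coeff_unit_of_common_root f(1) p(2) aq(1) by blast
  then have l: "Polynomial.coeff f 2 = 1 \<or> Polynomial.coeff f 2 = -1" using degf by (simp add: abs_if split: if_splits)
  have cf: "Polynomial.coeff f0 i = content f0 * Polynomial.coeff f i" for i using arg_cong[OF f(2), of "\<lambda>h. Polynomial.coeff h i"] by simp
  have "t2 * r2 = content f0 * Polynomial.coeff f 2" "- t1 * r2 = content f0 * Polynomial.coeff f 1" "r1 * t2 = content f0 * Polynomial.coeff f 0"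
    using cf[of 2] cf[of 1] cf[of 0] by (simp_all add: f0_def numeral_2_eq_2)
  moreover have "T = of_int (t1 * r2) / of_int (t2 * r2)" "r = of_int (r1 * t2) / of_int (t2 * r2)"
    using T r by simp_all
  ultimately have "T = of_int (- (content f0 * Polynomial.coeff f 1)) / of_int (content f0 * Polynomial.coeff f 2)"
    "r = of_int (content f0 * Polynomial.coeff f 0) / of_int (content f0 * Polynomial.coeff f 2)" by (metis minus_minus mult_minus_left)+
  then have "T = - of_int (Polynomial.coeff f 1) / of_int (Polynomial.coeff f 2)" "r = of_int (Polynomial.coeff f 0) / of_int (Polynomial.coeff f 2)"
    using c0 by simp_all
  then show ?thesis using l by auto
qed

section \<open>Arithmetic of the quadratic field\<close>

text \<open>
  For \<open>d = 1\<close> modulo 4 the integers of the field are the elements \<open>(X + Y \<surd>d) / 2\<close> with \<open>X\<close> and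
  \<open>Y\<close> of the same parity, and all ideals are handled in these coordinates.
\<close>
locale imaginary_quadratic =
  fixes d :: int
  assumes neg: "d < 0" and sqfree: "squarefree d" and mod4: "d mod 4 = 1"
begin

definition sqrtd :: complex where "sqrtd = csqrt (of_int d)"

definition quad :: "int \<Rightarrow> int \<Rightarrow> complex" where
  "quad X Y = (of_int X + of_int Y * sqrtd) / 2"

lemma sqrtd_sq: "sqrtd * sqrtd = of_int d"
  by (simp add: sqrtd_def power2_eq_square[symmetric])

lemma sqrtd_eq: "sqrtd = \<i> * of_real (sqrt (real_of_int (- d)))"
proof -
  have "csqrt (of_int d) = \<i> * of_real (sqrt \<bar>Re (of_int d)\<bar>)"
    using neg by (intro csqrt_of_real_nonpos) auto
  then show ?thesis using neg by (simp add: sqrtd_def)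
qed

lemma Re_sqrtd: "Re sqrtd = 0" and Im_sqrtd: "Im sqrtd \<noteq> 0" and cnj_sqrtd: "cnj sqrtd = - sqrtd"
  using neg by (auto simp: sqrtd_eq complex_eq_iff)

lemma quad_eq_iff: "quad X Y = quad U V \<longleftrightarrow> X = U \<and> Y = V"
  using Im_sqrtd Re_sqrtd by (auto simp: quad_def complex_eq_iff)

lemma quad_add: "quad X Y + quad U V = quad (X + U) (Y + V)"
  by (simp add: quad_def field_simps)

lemma quad_minus: "- quad X Y = quad (- X) (- Y)"
  by (simp add: quad_def field_simps)

lemma quad_scale: "of_int n * quad X Y = quad (n * X) (n * Y)"
  by (simp add: quad_def field_simps)

lemma quad_of_int: "of_int n = quad (2 * n) 0"
  by (simp add: quad_def)

lemma quad_sqrtd: "sqrtd = quad 0 2"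
  by (simp add: quad_def)

lemma cnj_quad: "cnj (quad X Y) = quad X (- Y)"
  by (simp add: quad_def cnj_sqrtd)

lemma quad_eq_0_iff: "quad X Y = 0 \<longleftrightarrow> X = 0 \<and> Y = 0"
  using quad_eq_iff[of X Y 0 0] by (simp add: quad_def)

lemma quad_mult_double: "2 * (quad U V * quad X Y) = quad (U * X + d * (V * Y)) (U * Y + V * X)"
proof -
  have "2 * (quad U V * quad X Y) = (of_int U * of_int X + of_int V * of_int Y * (sqrtd * sqrtd)
      + (of_int U * of_int Y + of_int V * of_int X) * sqrtd) / 2"
    by (simp add: quad_def field_simps)
  then show ?thesis unfolding sqrtd_sq by (simp add: quad_def field_simps)
qed

text \<open>
  Divisibility of the coordinates by 2 is where \<open>d = 1\<close> modulo 4 enters.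
\<close>
lemma quad_mult:
  assumes "even (U - V)" "even (X - Y)"
  obtains P Q where "quad U V * quad X Y = quad P Q" "even (P - Q)"
    "2 * P = U * X + d * (V * Y)" "2 * Q = U * Y + V * X"
proof -
  obtain k where k: "U = V + 2 * k" using assms(1) by (metis add.commute diff_add_cancel dvd_def)
  obtain l where l: "X = Y + 2 * l" using assms(2) by (metis add.commute diff_add_cancel dvd_def)
  obtain m where m: "d = 4 * m + 1" using mod4 by (metis mod_div_decomp mult.commute)
  define P Q where "P = V * Y + V * l + k * Y + 2 * k * l + 2 * m * (V * Y)" and "Q = V * Y + k * Y + V * l"
  have PQ: "2 * P = U * X + d * (V * Y)" "2 * Q = U * Y + V * X"
    by (simp_all add: k l m P_def Q_def algebra_simps)
  show ?thesis
  proof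
    have "2 * (quad U V * quad X Y) = 2 * quad P Q"
      unfolding quad_mult_double PQ[symmetric] using quad_scale[of 2 P Q] by simp
    then show "quad U V * quad X Y = quad P Q" by simp
    have "P - Q = 2 * (k * l + m * (V * Y))" by (simp add: P_def Q_def algebra_simps)
    then show "even (P - Q)" by simp
  qed (fact PQ)+
qed

lemma quad_norm: "4 * (quad X Y * cnj (quad X Y)) = of_int (X ^ 2 - d * Y ^ 2)"
proof -
  have "4 * (quad X Y * cnj (quad X Y)) = of_int X * of_int X - of_int Y * of_int Y * (sqrtd * sqrtd)"
    unfolding cnj_quad unfolding quad_def by (simp add: field_simps)
  then show ?thesis unfolding sqrtd_sq by (simp add: power2_eq_square)
qed

lemma norm_form_pos: "X \<noteq> 0 \<or> Y \<noteq> 0 \<Longrightarrow> X ^ 2 - d * Y ^ 2 > 0"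
proof -
  assume *: "X \<noteq> 0 \<or> Y \<noteq> 0"
  have 1: "X ^ 2 \<ge> 0" "- (d * Y ^ 2) \<ge> 0" using neg by (auto simp: mult_nonpos_nonneg)
  show "X ^ 2 - d * Y ^ 2 > 0"
  proof (cases "X = 0")
    case True
    then have "- d * Y ^ 2 > 0" using * neg by (intro mult_pos_pos) auto
    then show ?thesis using True by simp
  next
    case False
    then have "X ^ 2 > 0" by simp
    then show ?thesis using 1(2) by linarith
  qed
qed

abbreviation "F \<equiv> quad_field d"
abbreviation "OK \<equiv> quad_integers d"

lemma mem_F_iff: "x \<in> F \<longleftrightarrow> (\<exists>n X Y. n > 0 \<and> of_int n * x = quad X Y)"
proof
  assume "x \<in> F"
  then obtain a b where x: "x = of_rat a + of_rat b * sqrtd" by (auto simp: quad_field_def sqrtd_def)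
  obtain a1 a2 where a: "quotient_of a = (a1, a2)" by fastforce
  obtain b1 b2 where b: "quotient_of b = (b1, b2)" by fastforce
  have pos: "a2 > 0" "b2 > 0" using a b quotient_of_denom_pos by auto
  have ab: "(of_rat a :: complex) = of_int a1 / of_int a2" "(of_rat b :: complex) = of_int b1 / of_int b2"
    using quotient_of_div[OF a] quotient_of_div[OF b] by (simp_all add: of_rat_divide)
  have "of_int (a2 * b2) * x = quad (2 * a1 * b2) (2 * b1 * a2)"
    using pos unfolding x ab by (simp add: quad_def field_simps)
  then show "\<exists>n X Y. n > 0 \<and> of_int n * x = quad X Y"
    using pos by (meson mult_pos_pos)
next
  assume "\<exists>n X Y. n > 0 \<and> of_int n * x = quad X Y"
  then obtain n X Y where "n > 0" "of_int n * x = quad X Y" by blast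
  then have "x = of_rat (of_int X / of_int (2 * n)) + of_rat (of_int Y / of_int (2 * n)) * sqrtd"
    by (simp add: quad_def of_rat_divide of_rat_mult field_simps)
  then show "x \<in> F" unfolding quad_field_def sqrtd_def by blast
qed

lemma mem_FE: assumes "x \<in> F" obtains n X Y where "n > 0" "of_int n * x = quad X Y"
  using assms mem_F_iff by blast

lemma quad_in_F: "quad X Y \<in> F"
  unfolding mem_F_iff by (rule exI[of _ 1]) auto

lemma of_int_in_F: "of_int n \<in> F"
  using quad_in_F quad_of_int by simp

lemma F_add: "x \<in> F \<Longrightarrow> y \<in> F \<Longrightarrow> x + y \<in> F"
proof -
  assume "x \<in> F" "y \<in> F"
  then obtain n X Y m U V where *: "n > 0" "of_int n * x = quad X Y" "m > 0" "of_int m * y = quad U V"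
    by (meson mem_FE)
  have "of_int (n * m) * (x + y) = of_int m * (of_int n * x) + of_int n * (of_int m * y)"
    by (simp add: algebra_simps)
  also have "\<dots> = quad (m * X + n * U) (m * Y + n * V)" by (simp only: * quad_scale quad_add)
  finally have "of_int (n * m) * (x + y) = quad (m * X + n * U) (m * Y + n * V)" "n * m > 0"
    using * by simp_all
  then show ?thesis unfolding mem_F_iff by blast
qed

lemma F_mult: "x \<in> F \<Longrightarrow> y \<in> F \<Longrightarrow> x * y \<in> F"
proof -
  assume "x \<in> F" "y \<in> F"
  then obtain n X Y m U V where *: "n > 0" "of_int n * x = quad X Y" "m > 0" "of_int m * y = quad U V"
    by (meson mem_FE)
  have "of_int (2 * n * m) * (x * y) = 2 * ((of_int n * x) * (of_int m * y))" by (simp add: algebra_simps)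
  then have "of_int (2 * n * m) * (x * y) = quad (X * U + d * (Y * V)) (X * V + Y * U)" "2 * n * m > 0"
    using * by (simp_all add: quad_mult_double)
  then show ?thesis unfolding mem_F_iff by blast
qed

lemma F_minus: "x \<in> F \<Longrightarrow> - x \<in> F"
  using F_mult[of "of_int (- 1)" x] of_int_in_F[of "- 1"] by simp

lemma F_inverse: "x \<in> F \<Longrightarrow> inverse x \<in> F"
proof (cases "x = 0")
  case True then show ?thesis using of_int_in_F[of 0] by simp
next
  case False
  assume "x \<in> F"
  then obtain n X Y where *: "n > 0" "of_int n * x = quad X Y" by (meson mem_FE)
  then have "quad X Y \<noteq> 0" using False by auto
  then have "X ^ 2 - d * Y ^ 2 > 0" using norm_form_pos by (simp add: quad_eq_0_iff)
  moreover have "of_int (X ^ 2 - d * Y ^ 2) * inverse x = quad (4 * n * X) (- 4 * n * Y)"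
  proof -
    have "of_int (X ^ 2 - d * Y ^ 2) * inverse x = 4 * (of_int n * x) * quad X (- Y) * inverse x"
      unfolding *(2) quad_norm[symmetric] cnj_quad by (simp add: mult.assoc)
    also have "\<dots> = of_int (4 * n) * quad X (- Y)" using False by (simp add: field_simps)
    finally show ?thesis unfolding quad_scale by simp
  qed
  ultimately show ?thesis unfolding mem_F_iff by blast
qed

lemma F_divide: "x \<in> F \<Longrightarrow> y \<in> F \<Longrightarrow> x / y \<in> F"
  by (simp add: divide_inverse F_mult F_inverse)

lemma of_real_of_rat_eq: "of_real (of_rat q) = (of_rat q :: complex)"
  by (cases q) (simp add: of_rat_rat)

lemma squarefree_dvd_square:
  fixes D z :: int
  assumes "squarefree D" "D dvd z ^ 2" shows "D dvd z"
proof -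
  define g where "g = gcd D z"
  have "D \<noteq> 0" using assms(1) by auto
  then have g0: "g \<noteq> 0" by (simp add: g_def)
  obtain D' z' where D': "D = D' * g" "z = z' * g" and cop: "coprime D' z'"
    using gcd_coprime_exists[of D z] g0 unfolding g_def by blast
  have "g * D' dvd g * (g * z' ^ 2)" using assms(2) D' by (simp add: power2_eq_square mult_ac)
  then have "D' dvd g * z' ^ 2" using g0 by (simp only: dvd_mult_cancel_left) auto
  moreover have "coprime D' (z' ^ 2)" using cop by simp
  ultimately have "D' dvd g" by (simp add: coprime_dvd_mult_left_iff)
  then have "D' ^ 2 dvd D" unfolding D'(1) power2_eq_square by (simp add: mult_dvd_mono)
  then have "D' dvd 1" using assms(1) squarefreeD by blast
  then have "D dvd g" unfolding D'(1) using mult_dvd_mono[of D' 1 g g] by simp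
  then show ?thesis using D'(2) by (metis dvd_mult dvd_trans dvd_refl)
qed

lemma quad_in_OK: assumes "even (X - Y)" shows "quad X Y \<in> OK"
proof -
  obtain k where k: "X = Y + 2 * k" using assms by (metis add.commute diff_add_cancel dvd_def)
  obtain m where m: "d = 4 * m + 1" using mod4 by (metis mod_div_decomp mult.commute)
  define N where "N = Y * k + k ^ 2 - m * Y ^ 2"
  have N: "4 * N = X ^ 2 - d * Y ^ 2" by (simp add: N_def k m power2_eq_square algebra_simps)
  define p where "p = [:of_int N, - of_int X, 1 :: complex:]"
  have "quad X Y * cnj (quad X Y) = of_int N" using quad_norm[of X Y] unfolding N[symmetric] by simp
  moreover have "quad X Y + cnj (quad X Y) = of_int X" by (simp add: cnj_quad quad_add) (simp add: quad_def)
  moreover have "poly p (quad X Y) = of_int N - of_int X * quad X Y + quad X Y * quad X Y" by (simp add: p_def algebra_simps)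
  ultimately have "poly p (quad X Y) = quad X Y * cnj (quad X Y) - (quad X Y + cnj (quad X Y)) * quad X Y + quad X Y * quad X Y"
    by simp
  then have "poly p (quad X Y) = 0" by (simp add: algebra_simps)
  moreover have "lead_coeff p = 1" "\<forall>i. Polynomial.coeff p i \<in> \<int>" by (auto simp: p_def coeff_pCons split: nat.splits)
  ultimately have "algebraic_int (quad X Y)" by (intro algebraic_int.intros)
  then show ?thesis using quad_in_F by (simp add: quad_integers_def)
qed

text \<open>
  Trace and norm of an integer \<open>a + b \<surd>d\<close> are integral.  Hence \<open>2 a\<close> is an integer \<open>X\<close> and \<open>d (2 b)\<^sup>2\<close> is
  one too, and \<open>2 b\<close> is an integer \<open>Y\<close> because \<open>d\<close> is squarefree.  Modulo 4 the
  norm shows that \<open>X\<close> and \<open>Y\<close> have the same parity.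
\<close>
lemma mem_OK_iff: "x \<in> OK \<longleftrightarrow> (\<exists>X Y. even (X - Y) \<and> x = quad X Y)"
proof
  assume "x \<in> OK"
  then have xF: "x \<in> F" and xa: "algebraic_int x" by (auto simp: quad_integers_def)
  obtain a b where x: "x = of_rat a + of_rat b * sqrtd" using xF by (auto simp: quad_field_def sqrtd_def)
  show "\<exists>X Y. even (X - Y) \<and> x = quad X Y"
  proof (cases "b = 0")
    case True
    then have "x \<in> \<rat>" using x by auto
    then have "x \<in> \<int>" using rational_algebraic_int_is_int xa by blast
    then obtain n where "x = of_int n" by (auto simp: Ints_def)
    then show ?thesis using quad_of_int by (intro exI[of _ "2 * n"] exI[of _ 0]) auto
  next
    case False
    have "x = of_real (of_rat a) + of_real (of_rat b) * sqrtd" by (simp add: x of_real_of_rat_eq)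
    then have Im: "Im x \<noteq> 0" using False Im_sqrtd by simp
    define r where "r = a * a - of_int d * (b * b)"
    have "x * x - of_rat (2 * a) * x + of_rat r = of_rat (b * b) * (sqrtd * sqrtd - of_int d)"
      unfolding x r_def by (simp add: of_rat_diff of_rat_mult algebra_simps)
    then have "x * x - of_rat (2 * a) * x + of_rat r = 0" by (simp add: sqrtd_sq)
    from complex_quadratic_integer[OF xa Im this] obtain X N where X: "2 * a = of_int X" and N: "r = of_int N"
      by (auto simp: Ints_def)
    obtain y1 y2 where y: "quotient_of (2 * b) = (y1, y2)" by fastforce
    have y2: "y2 > 0" and cop: "coprime y1 y2" and bq: "2 * b = of_int y1 / of_int y2"
      using y quotient_of_denom_pos quotient_of_coprime quotient_of_div by auto
    have "of_int (4 * N) = (2 * a) * (2 * a) - of_int d * ((2 * b) * (2 * b))" using N by (simp add: r_def)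
    then have "of_int (d * (y1 * y1)) = (of_int ((X * X - 4 * N) * (y2 * y2)) :: rat)"
      unfolding X bq using y2 by (simp add: field_simps)
    then have eq: "d * (y1 * y1) = (X * X - 4 * N) * (y2 * y2)" by linarith
    then have "y2 ^ 2 dvd d * y1 ^ 2" by (simp add: power2_eq_square)
    moreover have "coprime (y2 ^ 2) (y1 ^ 2)" using cop by (simp add: coprime_commute)
    ultimately have "y2 ^ 2 dvd d" by (simp add: coprime_dvd_mult_left_iff)
    then have "y2 dvd 1" using sqfree unfolding squarefree_def by blast
    then have y2: "y2 = 1" using y2 by auto
    define Y where "Y = y1"
    have Y: "2 * b = of_int Y" using bq y2 by (simp add: Y_def)
    obtain m where m: "d = 4 * m + 1" using mod4 by (metis mod_div_decomp mult.commute)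
    have "X * X = 4 * (N + m * (Y * Y)) + Y * Y" using eq y2 by (simp add: Y_def m algebra_simps)
    then have "even (X * X - Y * Y)" by simp
    then have "even (X - Y)" by simp
    moreover have "x = quad X Y"
    proof -
      have "a = of_int X / 2" "b = of_int Y / 2" using X Y by simp_all
      then have "(of_rat a :: complex) = of_int X / 2" "(of_rat b :: complex) = of_int Y / 2"
        by (simp_all only: of_rat_divide of_rat_of_int_eq of_rat_numeral_eq)
      then show ?thesis unfolding x by (simp add: quad_def field_simps)
    qed
    ultimately show ?thesis by blast
  qed
qed (use quad_in_OK in blast)

lemma mem_OKE: assumes "x \<in> OK" obtains X Y where "even (X - Y)" "x = quad X Y"
  using assms mem_OK_iff by blast

lemma OK_subset_F: "OK \<subseteq> F" by (auto simp: quad_integers_def)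

lemma of_int_in_OK: "of_int n \<in> OK" unfolding quad_of_int by (rule quad_in_OK) auto

lemma one_in_OK: "1 \<in> OK" and zero_in_OK: "0 \<in> OK"
  using of_int_in_OK[of 1] of_int_in_OK[of 0] by auto

lemma OK_add: "x \<in> OK \<Longrightarrow> y \<in> OK \<Longrightarrow> x + y \<in> OK"
proof -
  assume "x \<in> OK" "y \<in> OK"
  then obtain X Y U V where "even (X - Y)" "x = quad X Y" "even (U - V)" "y = quad U V" by (meson mem_OKE)
  then show ?thesis by (simp add: quad_add quad_in_OK)
qed

lemma OK_mult: "x \<in> OK \<Longrightarrow> y \<in> OK \<Longrightarrow> x * y \<in> OK"
proof -
  assume "x \<in> OK" "y \<in> OK"
  then obtain X Y U V where *: "even (X - Y)" "x = quad X Y" "even (U - V)" "y = quad U V" by (meson mem_OKE)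
  obtain P Q where "quad X Y * quad U V = quad P Q" "even (P - Q)" using quad_mult[OF *(1,3)] by blast
  then show ?thesis using * by (simp add: quad_in_OK)
qed

lemma OK_cnj: "x \<in> OK \<Longrightarrow> cnj x \<in> OK"
proof -
  assume "x \<in> OK"
  then obtain X Y where *: "even (X - Y)" "x = quad X Y" by (meson mem_OKE)
  then show ?thesis by (simp add: cnj_quad quad_in_OK)
qed

lemma OK_minus: "x \<in> OK \<Longrightarrow> - x \<in> OK"
  using OK_mult[of "of_int (- 1)" x] of_int_in_OK[of "- 1"] by simp

lemma OK_int_dvd:
  assumes "x \<in> OK" "of_int v * x = of_int u" shows "v dvd u"
proof -
  obtain X Y where *: "even (X - Y)" "x = quad X Y" using assms(1) by (meson mem_OKE)
  have "quad (v * X) (v * Y) = quad (2 * u) 0"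
    using assms(2) unfolding *(2) quad_scale[of v X Y] quad_of_int[of u] .
  then have vX: "v * X = 2 * u" "v * Y = 0" by (simp_all add: quad_eq_iff)
  show ?thesis
  proof (cases "v = 0")
    case False
    then have "even X" using vX(2) *(1) by simp
    then obtain X' where "X = 2 * X'" by blast
    then have "u = v * X'" using vX(1) by simp
    then show ?thesis by simp
  qed (use vX(1) in simp)
qed

lemma OK_norm_int:
  assumes "x \<in> OK" "x \<noteq> 0"
  obtains N where "N > 0" "x * cnj x = of_int N"
proof -
  obtain X Y where *: "even (X - Y)" "x = quad X Y" using assms(1) by (meson mem_OKE)
  obtain P Q where "quad X Y * quad X (- Y) = quad P Q" "even (P - Q)"
    "2 * P = X * X + d * (Y * - Y)" "2 * Q = X * - Y + Y * X"
    using quad_mult[of X Y X "- Y"] *(1) by auto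
  then have "Q = 0" "even P" and P: "2 * P = X ^ 2 - d * Y ^ 2" by (auto simp: power2_eq_square)
  then obtain N where N: "P = 2 * N" by blast
  show ?thesis
  proof
    have "X \<noteq> 0 \<or> Y \<noteq> 0" using assms(2) * by (auto simp: quad_def)
    then show "N > 0" using norm_form_pos[of X Y] P N by simp
    show "x * cnj x = of_int N"
      using \<open>quad X Y * quad X (- Y) = quad P Q\<close> \<open>Q = 0\<close> N * by (simp add: cnj_quad quad_of_int)
  qed
qed

end

section \<open>Fractional ideals, classes and ramified ideals\<close>

lemma complex_subring_simps:
  "carrier (complex_subring S) = S" "x \<otimes>\<^bsub>complex_subring S\<^esub> y = x * y" "\<one>\<^bsub>complex_subring S\<^esub> = 1"
  "\<zero>\<^bsub>complex_subring S\<^esub> = 0" "x \<oplus>\<^bsub>complex_subring S\<^esub> y = x + y"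
  by (simp_all add: complex_subring_def)

lemma additive_subgroup_complex_subring_iff:
  assumes "0 \<in> S" "\<And>x. x \<in> S \<Longrightarrow> - x \<in> S"
  shows "additive_subgroup I (complex_subring S) \<longleftrightarrow>
    I \<subseteq> S \<and> 0 \<in> I \<and> (\<forall>x\<in>I. \<forall>y\<in>I. x + y \<in> I) \<and> (\<forall>x\<in>I. - x \<in> I)"
proof -
  have inv: "inv\<^bsub>add_monoid (complex_subring S)\<^esub> x = - x" if "x \<in> S" for x
    unfolding m_inv_def
  proof (rule the_equality)
    show "- x \<in> carrier (add_monoid (complex_subring S)) \<and>
        x \<otimes>\<^bsub>add_monoid (complex_subring S)\<^esub> - x = \<one>\<^bsub>add_monoid (complex_subring S)\<^esub> \<and>
        - x \<otimes>\<^bsub>add_monoid (complex_subring S)\<^esub> x = \<one>\<^bsub>add_monoid (complex_subring S)\<^esub>"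
      using assms(2)[OF that] by (simp add: complex_subring_simps)
  next
    fix y assume "y \<in> carrier (add_monoid (complex_subring S)) \<and>
        x \<otimes>\<^bsub>add_monoid (complex_subring S)\<^esub> y = \<one>\<^bsub>add_monoid (complex_subring S)\<^esub> \<and>
        y \<otimes>\<^bsub>add_monoid (complex_subring S)\<^esub> x = \<one>\<^bsub>add_monoid (complex_subring S)\<^esub>"
    then have "x + y = 0" by (simp add: complex_subring_simps)
    then show "y = - x" by (simp add: add_eq_0_iff)
  qed
  show ?thesis
  proof
    assume "additive_subgroup I (complex_subring S)"
    then have sg: "subgroup I (add_monoid (complex_subring S))" by (simp add: additive_subgroup_def)
    have sub: "I \<subseteq> S" using subgroup.subset[OF sg] by (simp add: complex_subring_simps)
    show "I \<subseteq> S \<and> 0 \<in> I \<and> (\<forall>x\<in>I. \<forall>y\<in>I. x + y \<in> I) \<and> (\<forall>x\<in>I. - x \<in> I)"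
      using sub subgroup.one_closed[OF sg] subgroup.m_closed[OF sg] subgroup.m_inv_closed[OF sg] inv
      by (auto simp: complex_subring_simps subset_iff)
  next
    assume *: "I \<subseteq> S \<and> 0 \<in> I \<and> (\<forall>x\<in>I. \<forall>y\<in>I. x + y \<in> I) \<and> (\<forall>x\<in>I. - x \<in> I)"
    show "additive_subgroup I (complex_subring S)"
      unfolding additive_subgroup_def
      by (rule subgroup.intro) (use * inv in \<open>auto simp: complex_subring_simps subset_iff\<close>)
  qed
qed

lemma prod_prime_factors_squarefree:
  assumes "squarefree (D :: nat)" shows "\<Prod>(prime_factors D) = D"
proof -
  have D0: "D \<noteq> 0" using assms not_squarefree_0 by metis
  have "D = (\<Prod>q\<in>prime_factors D. q ^ multiplicity q D)"
    using prod_prime_factors[of D] D0 by simp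
  also have "\<dots> = (\<Prod>q\<in>prime_factors D. q)"
    using assms squarefree_factorial_semiring'[OF D0] by (intro prod.cong) auto
  finally show ?thesis by simp
qed

definition scale :: "complex \<Rightarrow> complex set \<Rightarrow> complex set" where
  "scale x I = (\<lambda>y. x * y) ` I"

lemma scale_scale: "scale x (scale y I) = scale (x * y) I"
  by (simp add: scale_def image_image mult.assoc)

lemma scale_one: "scale 1 I = I"
  by (simp add: scale_def)

context imaginary_quadratic
begin

abbreviation iprod (infixl "**" 70) where
  "I ** J \<equiv> ideal_prod (complex_subring F) I J"

lemma iprodI: "x \<in> I \<Longrightarrow> y \<in> J \<Longrightarrow> x * y \<in> I ** J"
  using ideal_prod.prod[of x I y J "complex_subring F"] by (simp add: complex_subring_simps)

lemma iprod_add: "x \<in> I ** J \<Longrightarrow> y \<in> I ** J \<Longrightarrow> x + y \<in> I ** J"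
  using ideal_prod.sum[of x "complex_subring F" I J y] by (simp add: complex_subring_simps)

lemma iprod_induct [consumes 1, case_names prod add]:
  assumes "z \<in> I ** J" "\<And>x y. x \<in> I \<Longrightarrow> y \<in> J \<Longrightarrow> P (x * y)"
    "\<And>x y. P x \<Longrightarrow> P y \<Longrightarrow> P (x + y)"
  shows "P z"
  using assms(1) by (induction rule: ideal_prod.induct) (auto simp: complex_subring_simps assms(2,3))

lemma iprod_subsetI:
  assumes "\<And>x y. x \<in> I \<Longrightarrow> y \<in> J \<Longrightarrow> x * y \<in> K" "\<And>x y. x \<in> K \<Longrightarrow> y \<in> K \<Longrightarrow> x + y \<in> K"
  shows "I ** J \<subseteq> K"
proof
  fix z assume "z \<in> I ** J" then show "z \<in> K" by (induction rule: iprod_induct) (use assms in auto)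
qed

lemma iprod_commute: "I ** J = J ** I"
proof -
  have "I ** J \<subseteq> J ** I" for I J
    by (rule iprod_subsetI) (metis iprodI mult.commute, rule iprod_add)
  then show ?thesis by blast
qed

lemma iprod_assoc: "I ** J ** K = I ** (J ** K)"
proof -
  have 1: "I ** J ** K \<subseteq> I ** (J ** K)" for I J K
  proof (rule iprod_subsetI[OF _ iprod_add])
    fix x y assume "x \<in> I ** J" and y: "y \<in> K"
    then show "x * y \<in> I ** (J ** K)"
      by (induction rule: iprod_induct) (auto simp: mult.assoc distrib_right intro: iprod_add iprodI)
  qed
  have "I ** (J ** K) = K ** J ** I" by (metis iprod_commute)
  also have "\<dots> \<subseteq> K ** (J ** I)" by (rule 1)
  also have "\<dots> = I ** J ** K" by (metis iprod_commute)
  finally show ?thesis using 1 by blast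
qed

lemma frac_iff:
  "I \<in> fractional_ideals d \<longleftrightarrow> I \<subseteq> F \<and> 0 \<in> I \<and> (\<forall>x\<in>I. \<forall>y\<in>I. x + y \<in> I) \<and>
    (\<forall>r\<in>OK. \<forall>x\<in>I. r * x \<in> I) \<and> I \<noteq> {0} \<and> (\<exists>c\<in>OK. c \<noteq> 0 \<and> (\<forall>x\<in>I. c * x \<in> OK))"
proof -
  have "(\<forall>r\<in>OK. \<forall>x\<in>I. r * x \<in> I) \<Longrightarrow> (\<forall>x\<in>I. - x \<in> I)"
    using OK_minus[OF one_in_OK] by (metis mult_minus1)
  moreover have "additive_subgroup I (complex_subring F) \<longleftrightarrow>
    I \<subseteq> F \<and> 0 \<in> I \<and> (\<forall>x\<in>I. \<forall>y\<in>I. x + y \<in> I) \<and> (\<forall>x\<in>I. - x \<in> I)"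
    using of_int_in_F[of 0] F_minus by (intro additive_subgroup_complex_subring_iff) auto
  ultimately show ?thesis
    unfolding fractional_ideals_def mem_Collect_eq by blast
qed

lemma fracD:
  assumes "I \<in> fractional_ideals d"
  shows "I \<subseteq> F" "0 \<in> I" "\<And>x y. x \<in> I \<Longrightarrow> y \<in> I \<Longrightarrow> x + y \<in> I"
    "\<And>r x. r \<in> OK \<Longrightarrow> x \<in> I \<Longrightarrow> r * x \<in> I" "\<exists>x\<in>I. x \<noteq> 0"
    "\<exists>c\<in>OK. c \<noteq> 0 \<and> (\<forall>x\<in>I. c * x \<in> OK)"
  using assms unfolding frac_iff by auto

lemma fracI:
  assumes "I \<subseteq> F" "0 \<in> I" "\<And>x y. x \<in> I \<Longrightarrow> y \<in> I \<Longrightarrow> x + y \<in> I"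
    "\<And>r x. r \<in> OK \<Longrightarrow> x \<in> I \<Longrightarrow> r * x \<in> I" "x \<in> I" "x \<noteq> 0"
    "c \<in> OK" "c \<noteq> 0" "\<And>x. x \<in> I \<Longrightarrow> c * x \<in> OK"
  shows "I \<in> fractional_ideals d"
  unfolding frac_iff using assms by auto

lemma frac_int_denominator:
  assumes "I \<in> fractional_ideals d"
  obtains n where "n > 0" "\<And>x. x \<in> I \<Longrightarrow> of_int n * x \<in> OK"
proof -
  obtain c where c: "c \<in> OK" "c \<noteq> 0" "\<And>x. x \<in> I \<Longrightarrow> c * x \<in> OK" using fracD(6)[OF assms] by blast
  obtain N where N: "N > 0" "c * cnj c = of_int N" using OK_norm_int[OF c(1,2)] by blast
  show ?thesis
  proof
    fix x assume "x \<in> I"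
    then have "cnj c * (c * x) \<in> OK" using c OK_mult OK_cnj by blast
    then show "of_int N * x \<in> OK" unfolding N(2)[symmetric] by (simp add: mult_ac)
  qed (fact N)
qed

lemma frac_OK: "OK \<in> fractional_ideals d"
  by (rule fracI[of _ 1 1]) (auto simp: zero_in_OK one_in_OK OK_add OK_mult intro: subsetD[OF OK_subset_F])

lemma frac_scale:
  assumes "I \<in> fractional_ideals d" "x \<in> F" "x \<noteq> 0"
  shows "scale x I \<in> fractional_ideals d"
proof -
  obtain n where n: "n > 0" "\<And>x. x \<in> I \<Longrightarrow> of_int n * x \<in> OK" using frac_int_denominator[OF assms(1)] by blast
  obtain y where y: "y \<in> I" "y \<noteq> 0" using fracD(5)[OF assms(1)] by blast
  obtain m X Y where m: "m > 0" "of_int m * x = quad X Y" using mem_FE[OF assms(2)] by blast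
  \<comment> \<open>Doubling makes the parities of the coordinates agree.\<close>
  have "of_int (2 * m) * x = quad (2 * X) (2 * Y)" using m(2) quad_scale[of 2 X Y] by (simp add: mult.assoc)
  then have mx: "of_int (2 * m) * x \<in> OK" by (simp add: quad_in_OK)
  show ?thesis
  proof (rule fracI)
    show "x * y \<in> scale x I" "x * y \<noteq> 0" using y assms by (auto simp: scale_def)
    show "of_int (n * (2 * m)) \<in> OK" "(of_int (n * (2 * m)) :: complex) \<noteq> 0" using n m of_int_in_OK by (blast, simp)
    fix z assume "z \<in> scale x I"
    then obtain w where w: "w \<in> I" "z = x * w" by (auto simp: scale_def)
    have "(of_int n * w) * (of_int (2 * m) * x) \<in> OK" using n(2)[OF w(1)] mx by (rule OK_mult)
    then show "of_int (n * (2 * m)) * z \<in> OK" by (simp add: w mult_ac)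
  next
    fix r z assume "r \<in> OK" "z \<in> scale x I"
    then show "r * z \<in> scale x I" using fracD(4)[OF assms(1)] by (force simp: scale_def mult.left_commute)
  next
    fix u v assume "u \<in> scale x I" "v \<in> scale x I"
    then obtain u' v' where "u = x * u'" "v = x * v'" "u' \<in> I" "v' \<in> I" by (auto simp: scale_def)
    then show "u + v \<in> scale x I" using fracD(3)[OF assms(1), of u' v'] by (auto simp: scale_def distrib_left[symmetric])
  qed (use fracD[OF assms(1)] assms(2) F_mult in \<open>auto simp: scale_def\<close>)
qed

lemma frac_prod:
  assumes "I \<in> fractional_ideals d" "J \<in> fractional_ideals d"
  shows "I ** J \<in> fractional_ideals d"
proof -
  note I = fracD[OF assms(1)] and J = fracD[OF assms(2)]
  obtain n where n: "n > 0" "\<And>x. x \<in> I \<Longrightarrow> of_int n * x \<in> OK" using frac_int_denominator[OF assms(1)] by blast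
  obtain m where m: "m > 0" "\<And>x. x \<in> J \<Longrightarrow> of_int m * x \<in> OK" using frac_int_denominator[OF assms(2)] by blast
  obtain x y where xy: "x \<in> I" "y \<in> J" "x \<noteq> 0" "y \<noteq> 0" using I(5) J(5) by blast
  show ?thesis
  proof (rule fracI)
    show "x * y \<in> I ** J" "x * y \<noteq> 0" using xy iprodI by auto
    show "0 \<in> I ** J" using iprodI[OF I(2) J(2)] by simp
    show "I ** J \<subseteq> F" using I(1) J(1) by (intro iprod_subsetI) (auto intro: F_mult F_add)
    show "of_int (n * m) \<in> OK" "(of_int (n * m) :: complex) \<noteq> 0" using n m of_int_in_OK by (blast, simp)
    fix z assume "z \<in> I ** J"
    then show "of_int (n * m) * z \<in> OK"
    proof (induction rule: iprod_induct)
      case (prod u v)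
      have "(of_int n * u) * (of_int m * v) \<in> OK" using n(2) m(2) prod OK_mult by blast
      then show ?case by (simp add: mult_ac)
    next
      case (add u v)
      then show ?case using OK_add by (simp add: distrib_left)
    qed
  next
    fix r z assume r: "r \<in> OK" and "z \<in> I ** J"
    from this(2) show "r * z \<in> I ** J"
    proof (induction rule: iprod_induct)
      case (prod u v)
      have "(r * u) * v \<in> I ** J" using prod I(4) r by (intro iprodI) auto
      then show ?case by (simp add: mult_ac)
    next
      case (add u v)
      then show ?case using iprod_add by (simp add: distrib_left)
    qed
  qed (rule iprod_add)
qed

lemma frac_OK_prod:
  assumes "I \<in> fractional_ideals d" shows "OK ** I = I"
proof
  show "OK ** I \<subseteq> I" using fracD[OF assms] by (intro iprod_subsetI) auto
  show "I \<subseteq> OK ** I" using iprodI[OF one_in_OK] by force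
qed

lemma ideal_group_simps:
  "carrier (ideal_group d) = fractional_ideals d" "I \<otimes>\<^bsub>ideal_group d\<^esub> J = I ** J" "\<one>\<^bsub>ideal_group d\<^esub> = OK"
  by (simp_all add: ideal_group_def)

text \<open>
  Allows the finite product that defines a ramified ideal to be computed one prime at a time.
\<close>
lemma comm_monoid_ideal_group: "comm_monoid (ideal_group d)"
  by (rule comm_monoidI)
     (simp_all add: ideal_group_simps frac_prod frac_OK frac_OK_prod iprod_assoc, rule iprod_commute)

lemma scale_prod: "scale x I ** scale y J = scale (x * y) (I ** J)"
proof
  show "scale x I ** scale y J \<subseteq> scale (x * y) (I ** J)"
  proof (rule iprod_subsetI)
    fix u v assume "u \<in> scale x I" "v \<in> scale y J"
    then obtain u' v' where "u = x * u'" "v = y * v'" "u' \<in> I" "v' \<in> J" by (auto simp: scale_def)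
    then have "u * v = (x * y) * (u' * v')" "u' * v' \<in> I ** J" using iprodI by (auto simp: mult_ac)
    then show "u * v \<in> scale (x * y) (I ** J)" unfolding scale_def by blast
  next
    fix u v assume "u \<in> scale (x * y) (I ** J)" "v \<in> scale (x * y) (I ** J)"
    then obtain u' v' where "u = x * y * u'" "v = x * y * v'" "u' \<in> I ** J" "v' \<in> I ** J" by (auto simp: scale_def)
    then show "u + v \<in> scale (x * y) (I ** J)"
      using iprod_add[of u' I J v'] by (auto simp: scale_def distrib_left[symmetric])
  qed
  show "scale (x * y) (I ** J) \<subseteq> scale x I ** scale y J"
  proof
    fix z assume "z \<in> scale (x * y) (I ** J)"
    then obtain w where "w \<in> I ** J" "z = x * y * w" by (auto simp: scale_def)
    moreover from this(1) have "x * y * w \<in> scale x I ** scale y J"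
    proof (induction rule: iprod_induct)
      case (prod u v)
      then have "(x * u) * (y * v) \<in> scale x I ** scale y J" by (intro iprodI) (auto simp: scale_def)
      then show ?case by (simp add: mult_ac)
    next
      case (add u v)
      then show ?case using iprod_add by (simp add: distrib_left)
    qed
    ultimately show "z \<in> scale x I ** scale y J" by simp
  qed
qed

lemma principal_ideal_eq: "principal_ideal d x = scale x OK"
  by (simp add: principal_ideal_def scale_def mult.commute)

lemma principal_prod:
  assumes "I \<in> fractional_ideals d" shows "principal_ideal d x ** I = scale x I"
  using scale_prod[of x OK 1 I] frac_OK_prod[OF assms] by (simp add: principal_ideal_eq scale_one)

lemma ideal_class_eq:
  assumes "I \<in> fractional_ideals d"
  shows "ideal_class d I = {scale x I | x. x \<in> F \<and> x \<noteq> 0}"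
  using principal_prod[OF assms]
  by (auto simp: ideal_class_def r_coset_def principal_ideals_def ideal_group_simps)

text \<open>
  A class is the set of all scalar multiples of an ideal \<open>b\<close>, and products of multiples of \<open>b\<close> are the multiples of \<open>b\<^sup>2\<close>.
\<close>
lemma ideal_class_squareE:
  assumes "c \<in> class_squares d"
  obtains b where "b \<in> fractional_ideals d" "c = ideal_class d (b ** b)"
proof -
  obtain c' where c': "c' \<in> carrier (class_group d)" "c = c' \<otimes>\<^bsub>class_group d\<^esub> c'"
    using assms by (auto simp: class_squares_def)
  then obtain b where b: "b \<in> fractional_ideals d" "c' = ideal_class d b"
    by (auto simp: class_group_def FactGroup_def RCOSETS_def ideal_class_def ideal_group_simps)
  have "c = c' <#>\<^bsub>ideal_group d\<^esub> c'" using c'(2) by (simp add: class_group_def FactGroup_def)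
  also have "\<dots> = {scale x b ** scale y b | x y. x \<in> F \<and> x \<noteq> 0 \<and> y \<in> F \<and> y \<noteq> 0}"
    unfolding b(2) ideal_class_eq[OF b(1)] set_mult_def ideal_group_simps by blast
  also have "\<dots> = {scale x (b ** b) | x. x \<in> F \<and> x \<noteq> 0}"
  proof -
    have "\<exists>u v. scale x (b ** b) = scale (u * v) (b ** b) \<and> u \<in> F \<and> u \<noteq> 0 \<and> v \<in> F \<and> v \<noteq> 0"
      if "x \<in> F" "x \<noteq> 0" for x
      using that of_int_in_F[of 1] by (intro exI[of _ x] exI[of _ 1]) auto
    moreover have "\<exists>w. scale (u * v) (b ** b) = scale w (b ** b) \<and> w \<in> F \<and> w \<noteq> 0"
      if "u \<in> F" "u \<noteq> 0" "v \<in> F" "v \<noteq> 0" for u v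
      using that F_mult by (intro exI[of _ "u * v"]) auto
    ultimately show ?thesis unfolding scale_prod by blast
  qed
  also have "\<dots> = ideal_class d (b ** b)" using ideal_class_eq[OF frac_prod[OF b(1) b(1)]] by simp
  finally show ?thesis using that b(1) by blast
qed

lemma same_classE:
  assumes "I \<in> fractional_ideals d" "J \<in> fractional_ideals d" "ideal_class d I = ideal_class d J"
  obtains x where "x \<in> F" "x \<noteq> 0" "I = scale x J"
proof -
  have "I \<in> ideal_class d I"
    unfolding ideal_class_eq[OF assms(1)] using of_int_in_F[of 1] scale_one[of I] by force
  then show ?thesis using that unfolding assms(3) ideal_class_eq[OF assms(2)] by blast
qed

text \<open>
  For \<open>D\<close> dividing \<open>d\<close> this is the ideal whose square is \<open>(D)\<close>.  The description by one divisibility makes closure under addition and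
  membership immediate.
\<close>
definition sqrt_ideal :: "int \<Rightarrow> complex set" where
  "sqrt_ideal D = {quad X Y | X Y. even (X - Y) \<and> D dvd X}"

lemma sqrt_ideal_one: "sqrt_ideal 1 = OK"
  unfolding sqrt_ideal_def set_eq_iff mem_Collect_eq mem_OK_iff by (metis one_dvd)

lemma odd_d: "odd d" using mod4 by presburger

lemma odd_dvd: "D dvd d \<Longrightarrow> odd D" using odd_d dvd_trans by blast

lemma odd_dvd_half: "odd (D::int) \<Longrightarrow> D dvd 2 * P \<Longrightarrow> D dvd P"
  by (meson coprime_dvd_mult_right_iff coprime_right_2_iff_odd)

lemma d_nonzero: "d \<noteq> 0" using neg by simp

lemma sqrt_ideal_subset_OK: "sqrt_ideal D \<subseteq> OK"
  unfolding sqrt_ideal_def by (blast intro: quad_in_OK)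

lemma sqrt_ideal_mono: "a dvd b \<Longrightarrow> sqrt_ideal b \<subseteq> sqrt_ideal a"
  unfolding sqrt_ideal_def by (blast intro: dvd_trans)

lemma sqrt_ideal_add: "x \<in> sqrt_ideal D \<Longrightarrow> y \<in> sqrt_ideal D \<Longrightarrow> x + y \<in> sqrt_ideal D"
proof -
  assume "x \<in> sqrt_ideal D" "y \<in> sqrt_ideal D"
  then obtain X Y U V where "even (X - Y)" "D dvd X" "x = quad X Y" "even (U - V)" "D dvd U" "y = quad U V"
    unfolding sqrt_ideal_def by blast
  then have "x + y = quad (X + U) (Y + V)" "even (X + U - (Y + V))" "D dvd X + U" by (auto simp: quad_add)
  then show ?thesis unfolding sqrt_ideal_def by blast
qed

lemma sqrt_ideal_mult:
  assumes "D dvd d" "r \<in> OK" "x \<in> sqrt_ideal D" shows "r * x \<in> sqrt_ideal D"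
proof -
  obtain X Y where "even (X - Y)" "D dvd X" "x = quad X Y" using assms(3) unfolding sqrt_ideal_def by blast
  moreover obtain U V where "even (U - V)" "r = quad U V" using assms(2) by (rule mem_OKE)
  ultimately have *: "even (X - Y)" "D dvd X" "x = quad X Y" "even (U - V)" "r = quad U V" by blast+
  obtain P Q where PQ: "quad U V * quad X Y = quad P Q" "even (P - Q)" "2 * P = U * X + d * (V * Y)"
    using quad_mult[OF *(4,1)] by blast
  have "D dvd 2 * P" unfolding PQ(3) using *(2) assms(1) by simp
  then have "D dvd P" using odd_dvd_half odd_dvd assms(1) by blast
  then show ?thesis unfolding sqrt_ideal_def using * PQ by blast
qed

lemma of_int_mult_in_sqrt_ideal: "x \<in> OK \<Longrightarrow> of_int D * x \<in> sqrt_ideal D"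
proof -
  assume "x \<in> OK"
  then obtain X Y where "even (X - Y)" "x = quad X Y" by (rule mem_OKE)
  then have "of_int D * x = quad (D * X) (D * Y)" "even (D * X - D * Y)" "D dvd D * X"
    by (simp_all add: quad_scale right_diff_distrib[symmetric])
  then show ?thesis unfolding sqrt_ideal_def by blast
qed

lemma of_int_in_sqrt_ideal: "of_int D \<in> sqrt_ideal D"
  using of_int_mult_in_sqrt_ideal[OF one_in_OK] by simp

lemma sqrtd_in_sqrt_ideal: "sqrtd \<in> sqrt_ideal D"
  unfolding sqrt_ideal_def quad_sqrtd mem_Collect_eq by (intro exI[of _ 0] exI[of _ 2]) simp

lemma frac_sqrt_ideal: "D dvd d \<Longrightarrow> sqrt_ideal D \<in> fractional_ideals d"
proof (rule fracI)
  assume D: "D dvd d"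
  show "sqrt_ideal D \<subseteq> F" using sqrt_ideal_subset_OK OK_subset_F by blast
  show "0 \<in> sqrt_ideal D" using of_int_mult_in_sqrt_ideal[OF zero_in_OK] by simp
  show "of_int D \<in> sqrt_ideal D" by (rule of_int_in_sqrt_ideal)
  show "(of_int D :: complex) \<noteq> 0" using D d_nonzero by auto
  show "1 \<in> OK" by (rule one_in_OK)
  show "1 * x \<in> OK" if "x \<in> sqrt_ideal D" for x using that sqrt_ideal_subset_OK by auto
qed (auto intro: sqrt_ideal_add sqrt_ideal_mult)

text \<open>
  The inclusion from right to left multiplies \<open>x\<close> by \<open>1 = k m + l n\<close>.
\<close>
lemma sqrt_ideal_prod_coprime:
  assumes "m * n dvd d" "coprime m n"
  shows "sqrt_ideal m ** sqrt_ideal n = sqrt_ideal (m * n)"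
proof
  have odd: "odd (m * n)" using assms(1) odd_dvd by blast
  show "sqrt_ideal m ** sqrt_ideal n \<subseteq> sqrt_ideal (m * n)"
  proof (rule iprod_subsetI[OF _ sqrt_ideal_add])
    fix x y assume "x \<in> sqrt_ideal m" "y \<in> sqrt_ideal n"
    then obtain X Y U V where *: "even (X - Y)" "m dvd X" "x = quad X Y" "even (U - V)" "n dvd U" "y = quad U V"
      unfolding sqrt_ideal_def by blast
    obtain P Q where PQ: "quad X Y * quad U V = quad P Q" "even (P - Q)" "2 * P = X * U + d * (Y * V)"
      using quad_mult[OF *(1,4)] by blast
    have "m * n dvd 2 * P" unfolding PQ(3) using *(2,5) assms(1) by (simp add: mult_dvd_mono)
    then have "m * n dvd P" using odd odd_dvd_half by blast
    then show "x * y \<in> sqrt_ideal (m * n)" unfolding sqrt_ideal_def using * PQ by blast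
  qed
  show "sqrt_ideal (m * n) \<subseteq> sqrt_ideal m ** sqrt_ideal n"
  proof
    fix x assume x: "x \<in> sqrt_ideal (m * n)"
    then have xm: "x \<in> sqrt_ideal m" and xn: "x \<in> sqrt_ideal n"
      using sqrt_ideal_mono[of m "m * n"] sqrt_ideal_mono[of n "m * n"] by auto
    obtain k l where kl: "k * m + l * n = 1" using bezout_int[of m n] assms(2) by auto
    have "of_int m * (of_int k * x) \<in> sqrt_ideal m ** sqrt_ideal n"
      using xn of_int_in_OK sqrt_ideal_mult[of n] assms(1) by (intro iprodI of_int_in_sqrt_ideal) (auto dest: dvd_mult_right)
    moreover have "(of_int l * x) * of_int n \<in> sqrt_ideal m ** sqrt_ideal n"
      using xm of_int_in_OK sqrt_ideal_mult[of m] assms(1) by (intro iprodI of_int_in_sqrt_ideal) (auto dest: dvd_mult_left)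
    ultimately have "of_int m * (of_int k * x) + (of_int l * x) * of_int n \<in> sqrt_ideal m ** sqrt_ideal n" by (rule iprod_add)
    also have "of_int m * (of_int k * x) + (of_int l * x) * of_int n = of_int (k * m + l * n) * x"
      by (simp add: algebra_simps)
    finally show "x \<in> sqrt_ideal m ** sqrt_ideal n" using kl by simp
  qed
qed

text \<open>
  The square contains \<open>D\<^sup>2\<close> and \<open>(\<surd>d)\<^sup>2 = D e\<close>, and \<open>D\<close> and \<open>e\<close> are coprime because \<open>d\<close> is squarefree.
\<close>
lemma sqrt_ideal_square:
  assumes "D dvd d"
  shows "sqrt_ideal D ** sqrt_ideal D = scale (of_int D) OK"
proof
  obtain e where e: "d = D * e" using assms by blast
  show "sqrt_ideal D ** sqrt_ideal D \<subseteq> scale (of_int D) OK"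
  proof (rule iprod_subsetI)
    fix x y assume "x \<in> sqrt_ideal D" "y \<in> sqrt_ideal D"
    then obtain X Y U V where *: "even (X - Y)" "D dvd X" "x = quad X Y" "even (U - V)" "D dvd U" "y = quad U V"
      unfolding sqrt_ideal_def by blast
    obtain P Q where PQ: "quad X Y * quad U V = quad P Q" "even (P - Q)" "2 * P = X * U + d * (Y * V)" "2 * Q = X * V + Y * U"
      using quad_mult[OF *(1,4)] by blast
    have "D dvd 2 * P" "D dvd 2 * Q" unfolding PQ using *(2,5) assms by simp_all
    then have "D dvd P" "D dvd Q" using odd_dvd_half odd_dvd assms by blast+
    then obtain P' Q' where P': "P = D * P'" "Q = D * Q'" by blast
    have "odd D" using odd_dvd assms by blast
    then have "even (P' - Q')" using PQ(2) unfolding P' by simp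
    then have "x * y = of_int D * quad P' Q'" "quad P' Q' \<in> OK" using * PQ P' by (simp_all add: quad_scale quad_in_OK)
    then show "x * y \<in> scale (of_int D) OK" unfolding scale_def by blast
  next
    fix u v assume "u \<in> scale (of_int D) OK" "v \<in> scale (of_int D) OK"
    then show "u + v \<in> scale (of_int D) OK" unfolding scale_def by (auto simp: distrib_left[symmetric] intro: OK_add)
  qed
  have "coprime D e"
  proof (rule coprimeI)
    fix c assume "c dvd D" "c dvd e"
    then have "c ^ 2 dvd d" unfolding e power2_eq_square by (rule mult_dvd_mono)
    then show "is_unit c" using sqfree squarefreeD by blast
  qed
  then obtain k l where kl: "k * D + l * e = 1" using bezout_int[of D e] by auto
  show "scale (of_int D) OK \<subseteq> sqrt_ideal D ** sqrt_ideal D"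
  proof
    fix x assume "x \<in> scale (of_int D) OK"
    then obtain r where r: "r \<in> OK" "x = of_int D * r" by (auto simp: scale_def)
    have "(r * (of_int k * of_int D)) * of_int D \<in> sqrt_ideal D ** sqrt_ideal D"
      using r(1) sqrt_ideal_mult[OF assms] of_int_in_OK of_int_in_sqrt_ideal by (intro iprodI) auto
    moreover have "(r * (of_int l * sqrtd)) * sqrtd \<in> sqrt_ideal D ** sqrt_ideal D"
      using r(1) sqrt_ideal_mult[OF assms] of_int_in_OK sqrtd_in_sqrt_ideal by (intro iprodI) auto
    ultimately have "(r * (of_int k * of_int D)) * of_int D + (r * (of_int l * sqrtd)) * sqrtd \<in> sqrt_ideal D ** sqrt_ideal D"
      by (rule iprod_add)
    also have "(r * (of_int k * of_int D)) * of_int D + (r * (of_int l * sqrtd)) * sqrtd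
        = of_int D * (of_int (k * D + l * e)) * r"
    proof -
      have "(r * (of_int l * sqrtd)) * sqrtd = r * of_int l * (sqrtd * sqrtd)" by (simp add: mult_ac)
      then show ?thesis unfolding sqrtd_sq by (simp add: e algebra_simps)
    qed
    finally show "x \<in> sqrt_ideal D ** sqrt_ideal D" using kl r by simp
  qed
qed

text \<open>
  Characterizes the ideal above \<open>q\<close> by its square alone, which yields uniqueness in \<open>ramified_prime_eq\<close>.
\<close>
lemma mem_sqrt_ideal_prime_iff:
  assumes "prime q" "q dvd d" "x \<in> OK"
  shows "x \<in> sqrt_ideal q \<longleftrightarrow> x * x \<in> scale (of_int q) OK"
proof
  assume "x \<in> sqrt_ideal q"
  then show "x * x \<in> scale (of_int q) OK" using sqrt_ideal_square[OF assms(2)] iprodI by blast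
next
  assume "x * x \<in> scale (of_int q) OK"
  then obtain r where r: "r \<in> OK" "x * x = of_int q * r" by (auto simp: scale_def)
  obtain X Y where XY: "even (X - Y)" "x = quad X Y" using assms(3) by (rule mem_OKE)
  obtain P Q where PQ: "quad X Y * quad X Y = quad P Q" "2 * P = X * X + d * (Y * Y)" using quad_mult[OF XY(1) XY(1)] by blast
  obtain U V where UV: "r = quad U V" using r(1) by (rule mem_OKE)
  have "P = q * U" using r(2) PQ(1) unfolding XY UV quad_scale by (simp add: quad_eq_iff)
  then have "q dvd X * X + d * (Y * Y) - d * (Y * Y)" using assms(2) PQ(2) by (metis dvd_diff dvd_mult dvd_mult2 dvd_triv_left)
  then have "q dvd X" using assms(1) by (simp add: prime_dvd_mult_iff)
  then show "x \<in> sqrt_ideal q" unfolding sqrt_ideal_def using XY by blast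
qed

lemma cring_OK: "cring (complex_subring OK)"
proof (rule cringI)
  show "abelian_group (complex_subring OK)"
    by (rule abelian_groupI)
       (auto simp: complex_subring_simps OK_add zero_in_OK add_ac intro: bexI[of _ "- _"] OK_minus add.left_inverse)
  show "comm_monoid (complex_subring OK)"
    by (rule comm_monoidI) (auto simp: complex_subring_simps OK_mult one_in_OK mult_ac)
qed (auto simp: complex_subring_simps distrib_right)

lemma primeideal_sqrt_ideal:
  assumes "prime q" "q dvd d"
  shows "primeideal (sqrt_ideal q) (complex_subring OK)"
proof (rule primeidealI)
  show "ideal (sqrt_ideal q) (complex_subring OK)"
  proof (rule idealI)
    show "ring (complex_subring OK)" using cring_OK by (rule cring.axioms)
    have "sqrt_ideal q \<subseteq> OK \<and> 0 \<in> sqrt_ideal q \<and> (\<forall>x\<in>sqrt_ideal q. \<forall>y\<in>sqrt_ideal q. x + y \<in> sqrt_ideal q) \<and>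
        (\<forall>x\<in>sqrt_ideal q. - x \<in> sqrt_ideal q)"
      using sqrt_ideal_subset_OK sqrt_ideal_add sqrt_ideal_mult[OF assms(2) OK_minus[OF one_in_OK]]
        of_int_mult_in_sqrt_ideal[OF zero_in_OK] by auto
    then have "additive_subgroup (sqrt_ideal q) (complex_subring OK)"
      using additive_subgroup_complex_subring_iff[of OK "sqrt_ideal q"] zero_in_OK OK_minus by blast
    then show "subgroup (sqrt_ideal q) (add_monoid (complex_subring OK))" by (simp add: additive_subgroup_def)
  next
    fix x r assume "x \<in> sqrt_ideal q" "r \<in> carrier (complex_subring OK)"
    then show "r \<otimes>\<^bsub>complex_subring OK\<^esub> x \<in> sqrt_ideal q" "x \<otimes>\<^bsub>complex_subring OK\<^esub> r \<in> sqrt_ideal q"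
      using sqrt_ideal_mult[OF assms(2), of r x] by (simp_all add: complex_subring_simps mult.commute)
  qed
  show "cring (complex_subring OK)" by (rule cring_OK)
  show "carrier (complex_subring OK) \<noteq> sqrt_ideal q"
  proof
    assume "carrier (complex_subring OK) = sqrt_ideal q"
    then have "quad 2 0 \<in> sqrt_ideal q" using quad_in_OK[of 2 0] by (simp add: complex_subring_simps)
    then have "q dvd 2" unfolding sqrt_ideal_def by (auto simp: quad_eq_iff)
    moreover have "odd q" using odd_dvd assms by blast
    ultimately show False using assms(1) by (metis odd_dvd_half mult.right_neutral not_prime_unit)
  qed
next
  fix x y assume "x \<in> carrier (complex_subring OK)" "y \<in> carrier (complex_subring OK)"
    and xy: "x \<otimes>\<^bsub>complex_subring OK\<^esub> y \<in> sqrt_ideal q"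
  then have "x \<in> OK" "y \<in> OK" by (simp_all add: complex_subring_simps)
  then obtain X Y U V where *: "even (X - Y)" "x = quad X Y" "even (U - V)" "y = quad U V" by (meson mem_OKE)
  obtain P Q where PQ: "quad X Y * quad U V = quad P Q" "2 * P = X * U + d * (Y * V)" using quad_mult[OF *(1,3)] by blast
  have "q dvd P" using xy PQ(1) * unfolding sqrt_ideal_def by (auto simp: complex_subring_simps quad_eq_iff)
  then have "q dvd 2 * P - d * (Y * V)" using assms(2) by simp
  then have "q dvd X \<or> q dvd U" using PQ(2) assms(1) by (simp add: prime_dvd_mult_iff)
  then show "x \<in> sqrt_ideal q \<or> y \<in> sqrt_ideal q" unfolding sqrt_ideal_def using * by blast
qed

text \<open>
  If a prime ideal \<open>P\<close> has square \<open>(q)\<close>, then \<open>x\<close> lies in \<open>P\<close> exactly when \<open>x\<^sup>2\<close> lies in \<open>(q)\<close>.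
\<close>
lemma ramified_prime_eq:
  assumes "prime q" "int q dvd d"
  shows "ramified_prime d q = sqrt_ideal (int q)"
  unfolding ramified_prime_def
proof (rule the_equality)
  have q: "prime (int q)" using assms(1) by simp
  have pr: "principal_ideal d (of_nat q) = scale (of_int (int q)) OK" by (simp add: principal_ideal_eq)
  show "primeideal (sqrt_ideal (int q)) (complex_subring OK) \<and>
      sqrt_ideal (int q) \<otimes>\<^bsub>ideal_group d\<^esub> sqrt_ideal (int q) = principal_ideal d (of_nat q)"
    using primeideal_sqrt_ideal[OF q assms(2)] sqrt_ideal_square[OF assms(2)] unfolding pr ideal_group_simps by blast
  fix P assume P: "primeideal P (complex_subring OK) \<and> P \<otimes>\<^bsub>ideal_group d\<^esub> P = principal_ideal d (of_nat q)"
  then have PP: "P ** P = scale (of_int (int q)) OK" unfolding pr ideal_group_simps by blast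
  interpret P: primeideal P "complex_subring OK" using P by blast
  have PO: "P \<subseteq> OK" using P.Icarr by (auto simp: complex_subring_simps)
  have sub: "P ** P \<subseteq> P"
    using P.I_l_closed additive_subgroup.a_closed[OF P.is_additive_subgroup] PO by (intro iprod_subsetI) (auto simp: complex_subring_simps subset_iff)
  show "P = sqrt_ideal (int q)"
  proof
    show "P \<subseteq> sqrt_ideal (int q)"
    proof
      fix x assume x: "x \<in> P"
      have "x * x \<in> P ** P" using x x by (rule iprodI)
      then show "x \<in> sqrt_ideal (int q)"
        using mem_sqrt_ideal_prime_iff[OF q assms(2) subsetD[OF PO x]] PP by simp
    qed
    show "sqrt_ideal (int q) \<subseteq> P"
    proof
      fix x assume x: "x \<in> sqrt_ideal (int q)"
      then have xO: "x \<in> OK" using sqrt_ideal_subset_OK by blast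
      then have "x * x \<in> P ** P" using x mem_sqrt_ideal_prime_iff[OF q assms(2) xO] PP by simp
      then have "x * x \<in> P" using sub by blast
      then show "x \<in> P" using P.I_prime[of x x] xO by (simp add: complex_subring_simps)
    qed
  qed
qed

lemma ramified_ideal_eq:
  assumes "squarefree D" "int D dvd d"
  shows "ramified_ideal d D = sqrt_ideal (int D)"
proof -
  interpret G: comm_monoid "ideal_group d" by (rule comm_monoid_ideal_group)
  have prod: "\<Prod>(prime_factors D) = D"
    by (rule prod_prime_factors_squarefree[OF assms(1)])
  have "finprod (ideal_group d) (ramified_prime d) S = sqrt_ideal (int (\<Prod>S))"
    if "finite S" "S \<subseteq> prime_factors D" for S
    using that
  proof (induction S rule: finite_induct)
    case empty then show ?case by (simp add: ideal_group_simps sqrt_ideal_one)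
  next
    case (insert q S)
    have q: "prime q" "q dvd D" using insert.prems by auto
    have pS: "prime r" "int r dvd d" if "r \<in> insert q S" for r
    proof -
      have "r \<in> prime_factors D" using that insert.prems by blast
      then have "prime r" "r dvd D" by auto
      then show "prime r" "int r dvd d" using dvd_trans[OF _ assms(2), of "int r"] by simp_all
    qed
    have carr: "ramified_prime d r \<in> carrier (ideal_group d)" if "r \<in> insert q S" for r
      using ramified_prime_eq[OF pS[OF that]] frac_sqrt_ideal pS[OF that] by (simp add: ideal_group_simps)
    have cop: "coprime (int q) (int (\<Prod>S))"
    proof -
      have "coprime q r" if "r \<in> S" for r
        using that insert.hyps(2) pS[of q] pS[of r] primes_coprime by (metis insertI1 insertI2)
      then show ?thesis by (auto intro: prod_coprime_right)
    qed
    have "\<Prod>(insert q S) dvd \<Prod>(prime_factors D)" using insert.prems by (intro prod_dvd_prod_subset) auto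
    then have "q * \<Prod>S dvd D" unfolding prod using insert.hyps by simp
    then have "int (q * \<Prod>S) dvd int D" by (simp only: int_dvd_int_iff)
    then have dv: "int q * int (\<Prod>S) dvd d" using assms(2) unfolding of_nat_mult by (rule dvd_trans)
    have "finprod (ideal_group d) (ramified_prime d) (insert q S) =
        ramified_prime d q \<otimes>\<^bsub>ideal_group d\<^esub> finprod (ideal_group d) (ramified_prime d) S"
      using insert.hyps carr by (intro G.finprod_insert) auto
    also have "\<dots> = sqrt_ideal (int q) ** sqrt_ideal (int (\<Prod>S))"
      using insert ramified_prime_eq pS[of q] by (simp add: ideal_group_simps)
    also have "\<dots> = sqrt_ideal (int (\<Prod>(insert q S)))"
      unfolding sqrt_ideal_prod_coprime[OF dv cop] of_nat_mult[symmetric] using insert.hyps by simp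
    finally show ?case .
  qed
  then show ?thesis unfolding ramified_ideal_def using prod by (metis finite_set_mset subset_refl)
qed

end

section \<open>Lattice bases of ideals and the norm equation\<close>

lemma int_subgroup_cyclic:
  fixes G :: "int set"
  assumes "\<And>x y. x \<in> G \<Longrightarrow> y \<in> G \<Longrightarrow> x + y \<in> G" "\<And>x. x \<in> G \<Longrightarrow> - x \<in> G" "m \<in> G" "m > 0"
  shows "\<exists>k>0. \<forall>x. x \<in> G \<longleftrightarrow> k dvd x"
proof -
  have mult: "x * z \<in> G" if "x \<in> G" for x z
  proof -
    have nat: "x * int n \<in> G" for n
    proof (induction n)
      case 0
      then show ?case using assms(1)[OF assms(3) assms(2)[OF assms(3)]] by simp
    next
      case (Suc n)
      then show ?case using assms(1)[OF that Suc] by (simp add: distrib_left)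
    qed
    show ?thesis
    proof (cases "z \<ge> 0")
      case True then show ?thesis using nat[of "nat z"] by simp
    next
      case False then show ?thesis using assms(2)[OF nat[of "nat (- z)"]] by simp
    qed
  qed
  define k where "k = (LEAST n. n > 0 \<and> int n \<in> G)"
  have "nat m > 0 \<and> int (nat m) \<in> G" using assms by simp
  then have k: "k > 0" "int k \<in> G" unfolding k_def by (metis (mono_tags, lifting) LeastI)+
  show ?thesis
  proof (intro exI[of _ "int k"] conjI allI)
    show "int k > 0" using k by simp
    fix x show "x \<in> G \<longleftrightarrow> int k dvd x"
    proof
      assume x: "x \<in> G"
      have "x mod int k = x + int k * (- (x div int k))" by (simp add: minus_div_mult_eq_mod[symmetric])
      then have "x mod int k \<in> G" using assms(1)[OF x mult[OF k(2), of "- (x div int k)"]] by (simp only:)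
      then have r: "int (nat (x mod int k)) \<in> G" using k(1) by simp
      have "nat (x mod int k) < k" using k(1) by (simp add: nat_less_iff)
      then have "nat (x mod int k) = 0" using r not_less_Least[of "nat (x mod int k)" "\<lambda>n. n > 0 \<and> int n \<in> G"]
        unfolding k_def[symmetric] by (metis neq0_conv)
      then have "x mod int k = 0" using k(1) pos_mod_sign[of "int k" x] by linarith
      then show "int k dvd x" by (simp add: dvd_eq_mod_eq_0)
    qed (use mult k(2) in \<open>auto elim!: dvdE\<close>)
  qed
qed

context imaginary_quadratic
begin

lemma quad_diff: "quad X Y - quad U V = quad (X - U) (Y - V)"
  by (simp add: quad_def field_simps)

text \<open>
  The lattice spanned by \<open>a\<close> and \<open>(B + \<surd>d) / 2\<close>, in coordinates.
\<close>
definition lattice :: "int \<Rightarrow> int \<Rightarrow> complex set" where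
  "lattice a B = {quad (2 * (x * a) + y * B) y | x y. True}"

lemma four_dvd_odd_square: "odd B \<Longrightarrow> 4 dvd B ^ 2 - d"
proof -
  assume "odd B"
  then obtain b where "B = 2 * b + 1" by (elim oddE)
  moreover obtain m where "d = 4 * m + 1" using mod4 by (metis mod_div_decomp mult.commute)
  ultimately have "B ^ 2 - d = 4 * (b ^ 2 + b - m)" by (simp add: power2_eq_square algebra_simps)
  then show ?thesis by simp
qed

text \<open>
  The coordinates at \<open>\<surd>d\<close> of the elements of \<open>J\<close> form a subgroup \<open>k Z\<close>, the rational integers in \<open>J\<close> a subgroup
  \<open>m Z\<close>, and \<open>J\<close> is spanned by \<open>m\<close> and any element with coordinate \<open>k\<close>.  Multiplying by
  \<open>(1 + \<surd>d) / 2\<close> and by \<open>(B - \<surd>d) / 2\<close> shows that \<open>k\<close> divides everything and that \<open>a = m / k\<close> divides the norm of \<open>(B + \<surd>d) / 2\<close>.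
\<close>
lemma integral_ideal_lattice:
  assumes J: "J \<in> fractional_ideals d" "J \<subseteq> OK"
  obtains k a B where "k > 0" "a > 0" "odd B" "4 * a dvd B ^ 2 - d" "J = scale (of_int k) (lattice a B)"
proof -
  note JD = fracD[OF J(1)]
  have Jm: "- x \<in> J" if "x \<in> J" for x using JD(4)[OF OK_minus[OF one_in_OK] that] by simp
  obtain x where x: "x \<in> J" "x \<noteq> 0" using JD(5) by blast
  obtain N where N: "N > 0" "x * cnj x = of_int N" using OK_norm_int[of x] x J(2) by blast
  have NJ: "of_int N \<in> J" using JD(4)[OF OK_cnj x(1), of x] x(1) J(2) N(2) by (auto simp: mult.commute)
  have tau: "quad 1 1 \<in> OK" by (simp add: quad_in_OK)
  have tau_int: "quad n n \<in> J" if "of_int n \<in> J" for n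
    using JD(4)[OF tau that] quad_scale[of n 1 1] by (simp add: mult.commute)
  define T where "T = {Y. \<exists>X. quad X Y \<in> J}"
  have T_iff: "Y \<in> T \<longleftrightarrow> (\<exists>X. quad X Y \<in> J)" for Y by (simp add: T_def)
  have T_add: "Y + V \<in> T" if YV: "Y \<in> T" "V \<in> T" for Y V
  proof -
    obtain X U where "quad X Y \<in> J" "quad U V \<in> J" using YV T_iff by blast
    then have "quad (X + U) (Y + V) \<in> J" unfolding quad_add[symmetric] by (rule JD(3))
    then show ?thesis using T_iff by blast
  qed
  have T_minus: "- Y \<in> T" if YT: "Y \<in> T" for Y
  proof -
    obtain X where "quad X Y \<in> J" using YT T_iff by blast
    then have "quad (- X) (- Y) \<in> J" unfolding quad_minus[symmetric] by (rule Jm)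
    then show ?thesis using T_iff by blast
  qed
  have NT: "N \<in> T" using tau_int[OF NJ] T_iff by blast
  have "\<exists>k>0. \<forall>Y. Y \<in> T \<longleftrightarrow> k dvd Y"
    by (rule int_subgroup_cyclic) (fact T_add, fact T_minus, fact NT, fact N(1))
  then obtain k where k: "k > 0" "\<And>Y. Y \<in> T \<longleftrightarrow> k dvd Y" by blast
  define Z where "Z = {n. of_int n \<in> J}"
  have Z_iff: "n \<in> Z \<longleftrightarrow> of_int n \<in> J" for n by (simp add: Z_def)
  have Z_add: "n + n' \<in> Z" if "n \<in> Z" "n' \<in> Z" for n n' using that JD(3) by (simp add: Z_iff)
  have Z_minus: "- n \<in> Z" if "n \<in> Z" for n using Jm[of "of_int n"] that by (simp add: Z_iff)
  have NZ: "N \<in> Z" using NJ Z_iff by blast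
  have "\<exists>m>0. \<forall>n. n \<in> Z \<longleftrightarrow> m dvd n"
    by (rule int_subgroup_cyclic) (fact Z_add, fact Z_minus, fact NZ, fact N(1))
  then obtain m where m: "m > 0" "\<And>n. n \<in> Z \<longleftrightarrow> m dvd n" by blast
  note k2 = k(2)[unfolded T_iff] and m2 = m(2)[unfolded Z_iff]
  have "of_int m \<in> J" using m2[of m] by simp
  then have "k dvd m" using tau_int k2[of m] by blast
  then obtain a where a: "m = k * a" by blast
  have a0: "a > 0" using a m(1) k(1) by (simp add: zero_less_mult_iff)
  obtain X0 where X0: "quad X0 k \<in> J" using k2[of k] by auto
  have ev: "even (X0 - k)" using X0 J(2) mem_OK_iff[of "quad X0 k"] by (auto simp: quad_eq_iff)
  then obtain P Q where PQ: "quad 1 1 * quad X0 k = quad P Q" "2 * Q = 1 * k + 1 * X0" using quad_mult[OF _ ev, of 1 1] by (metis diff_self dvd_0_right)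
  have "quad P Q \<in> J" using JD(4)[OF tau X0] PQ(1) by simp
  then have "k dvd Q" using k2[of Q] by blast
  then obtain z where "Q = k * z" by blast
  define B where "B = 2 * z - 1"
  have XB: "X0 = k * B" using PQ(2) \<open>Q = k * z\<close> by (simp add: B_def algebra_simps)
  have oddB: "odd B" by (simp add: B_def)
  obtain N' where N': "B ^ 2 - d = 4 * N'" using four_dvd_odd_square[OF oddB] by blast
  have "quad B (- 1) * quad X0 k = of_int (k * N')"
  proof -
    have "4 * (quad B (- 1) * quad X0 k) = of_int k * (4 * (quad B 1 * cnj (quad B 1)))"
      unfolding XB using quad_scale[of k B 1] by (simp add: cnj_quad mult_ac)
    also have "\<dots> = of_int k * of_int (4 * N')" unfolding quad_norm using N' by simp
    finally show ?thesis by simp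
  qed
  then have "of_int (k * N') \<in> J" using JD(4)[OF quad_in_OK X0, of B "- 1"] oddB by simp
  then have "k * a dvd k * N'" using m2[of "k * N'"] a by blast
  then have "a dvd N'" using k(1) by simp
  then have fa: "4 * a dvd B ^ 2 - d" unfolding N' by simp
  have "J = scale (of_int k) (lattice a B)"
  proof
    show "J \<subseteq> scale (of_int k) (lattice a B)"
    proof
      fix x assume xJ: "x \<in> J"
      then obtain X Y where XY: "even (X - Y)" "x = quad X Y" using J(2) by (meson mem_OKE subsetD)
      then have "k dvd Y" using k2[of Y] xJ by blast
      then obtain y where y: "Y = k * y" by blast
      have "- (of_int y * quad X0 k) \<in> J" using JD(4)[OF of_int_in_OK X0] Jm by blast
      from JD(3)[OF xJ this] have diff: "quad (X - y * X0) 0 \<in> J"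
        unfolding XY(2) quad_scale quad_minus quad_add by (simp add: y mult.commute)
      then have "even (X - y * X0)" using J(2) mem_OK_iff[of "quad (X - y * X0) 0"] by (auto simp: quad_eq_iff)
      then obtain n where n: "X - y * X0 = 2 * n" by blast
      then have "of_int n \<in> J" using diff quad_of_int[of n] by simp
      then have "m dvd n" using m2[of n] by blast
      then obtain x' where x': "n = k * a * x'" using a by blast
      have "x = of_int k * quad (2 * (x' * a) + y * B) y"
        unfolding quad_scale XY(2) using n x' y XB by (simp add: quad_eq_iff algebra_simps)
      then show "x \<in> scale (of_int k) (lattice a B)" unfolding scale_def lattice_def by blast
    qed
    show "scale (of_int k) (lattice a B) \<subseteq> J"
    proof
      fix v assume "v \<in> scale (of_int k) (lattice a B)"
      then obtain x y where v: "v = of_int k * quad (2 * (x * a) + y * B) y" unfolding scale_def lattice_def by blast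
      have "of_int (k * a * x) \<in> J" using m2[of "k * a * x"] a by simp
      moreover have "of_int y * quad X0 k \<in> J" by (rule JD(4)[OF of_int_in_OK X0])
      ultimately have "of_int (k * a * x) + of_int y * quad X0 k \<in> J" by (rule JD(3))
      also have "of_int (k * a * x) + of_int y * quad X0 k = v"
        unfolding v XB quad_scale quad_of_int[of "k * a * x"] quad_add by (simp add: quad_eq_iff algebra_simps)
      finally show "v \<in> J" .
    qed
  qed
  then show ?thesis using that[OF k(1) a0 oddB fa] by blast
qed

text \<open>
  The elements \<open>i + j (1 + \<surd>d) / 2\<close> with \<open>0 \<le> i < k a\<close> and \<open>0 \<le> j < k\<close> represent the cosets.
\<close>
lemma card_lattice_quotient:
  assumes J: "J \<in> fractional_ideals d" "J = scale (of_int k) (lattice a B)" and pos: "k > 0" "a > 0" and "odd B"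
  shows "card (carrier (complex_subring OK Quot J)) = nat (k * k * a)"
proof -
  note JD = fracD[OF J(1)]
  have Jm: "- x \<in> J" if "x \<in> J" for x using JD(4)[OF OK_minus[OF one_in_OK] that] by simp
  define co where "co x = (\<lambda>h. h + x) ` J" for x
  have carr: "carrier (complex_subring OK Quot J) = co ` OK"
    by (auto simp: FactRing_def A_RCOSETS_def' a_r_coset_def' complex_subring_simps co_def)
  have co_eq: "co x = co y \<longleftrightarrow> x - y \<in> J" for x y
  proof
    assume "co x = co y"
    moreover have "0 + x \<in> co x" using JD(2) unfolding co_def by blast
    ultimately obtain h where "h \<in> J" "0 + x = h + y" unfolding co_def by blast
    then have "x - y = h" by (simp add: algebra_simps)
    then show "x - y \<in> J" using \<open>h \<in> J\<close> by simp
  next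
    have sub: "co x \<subseteq> co y" if "x - y \<in> J" for x y
    proof
      fix z assume "z \<in> co x"
      then obtain h where "h \<in> J" "z = h + x" unfolding co_def by blast
      then have "z = (h + (x - y)) + y" "h + (x - y) \<in> J" using JD(3) that by auto
      then show "z \<in> co y" unfolding co_def by blast
    qed
    assume "x - y \<in> J"
    moreover from Jm[OF this] have "y - x \<in> J" by simp
    ultimately show "co x = co y" using sub by blast
  qed
  have memJ: "quad U V \<in> J \<longleftrightarrow> (\<exists>x y. U = k * (2 * (x * a) + y * B) \<and> V = k * y)" for U V
  proof -
    have "quad U V \<in> J \<longleftrightarrow> (\<exists>x y. quad U V = of_int k * quad (2 * (x * a) + y * B) y)"
      unfolding J(2) scale_def lattice_def by blast
    then show ?thesis unfolding quad_scale quad_eq_iff .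
  qed
  define f where "f = (\<lambda>(i, j). co (quad (2 * i + j) j))"
  obtain b where b: "B = 2 * b + 1" using \<open>odd B\<close> by (elim oddE)
  have "bij_betw f ({0..<k * a} \<times> {0..<k}) (co ` OK)"
    unfolding bij_betw_def
  proof
    show "inj_on f ({0..<k * a} \<times> {0..<k})"
    proof (rule inj_onI, clarsimp simp: f_def co_eq)
      fix i j i' j' assume r: "0 \<le> i" "i < k * a" "0 \<le> j" "j < k" "0 \<le> i'" "i' < k * a" "0 \<le> j'" "j' < k"
        and "quad (2 * i + j) j - quad (2 * i' + j') j' \<in> J"
      then have "quad (2 * i + j - (2 * i' + j')) (j - j') \<in> J"
        by (simp only: quad_diff)
      then obtain x y where xy: "2 * i + j - (2 * i' + j') = k * (2 * (x * a) + y * B)" "j - j' = k * y"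
        unfolding memJ by blast
      have small: "z = 0" if "\<bar>k' * z\<bar> < k'" for z k' :: int
      proof (rule ccontr)
        assume "z \<noteq> 0"
        then have "\<bar>k'\<bar> * 1 \<le> \<bar>k'\<bar> * \<bar>z\<bar>" by (intro mult_left_mono) auto
        then show False using that unfolding abs_mult by linarith
      qed
      have "\<bar>k * y\<bar> < k" using xy(2) r by linarith
      then have y: "y = 0" by (rule small)
      then have "i - i' = k * a * x" using xy by (simp add: algebra_simps)
      moreover from this have "\<bar>k * a * x\<bar> < k * a" using r by linarith
      then have "x = 0" by (rule small)
      ultimately show "i = i' \<and> j = j'" using xy(2) y by simp
    qed
    show "f ` ({0..<k * a} \<times> {0..<k}) = co ` OK"
    proof
      show "f ` ({0..<k * a} \<times> {0..<k}) \<subseteq> co ` OK" by (auto simp: f_def intro!: imageI quad_in_OK)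
      show "co ` OK \<subseteq> f ` ({0..<k * a} \<times> {0..<k})"
      proof
        fix C assume "C \<in> co ` OK"
        then obtain U V where UV: "even (U - V)" "C = co (quad U V)" by (auto elim!: mem_OKE)
        obtain u where u: "U = V + 2 * u" using UV(1) by (metis add.commute diff_add_cancel dvd_def)
        define y j where "y = V div k" and "j = V mod k"
        have V: "V = k * y + j" by (simp add: y_def j_def)
        define x i where "x = (u - k * y * b) div (k * a)" and "i = (u - k * y * b) mod (k * a)"
        have uu: "u - k * y * b = k * a * x + i" by (simp add: x_def i_def)
        have "quad U V - quad (2 * i + j) j = quad (U - (2 * i + j)) (V - j)"
          by (rule quad_diff)
        also have "\<dots> \<in> J" unfolding memJ
          by (intro exI[of _ x] exI[of _ y]) (use uu V u b in \<open>simp add: algebra_simps\<close>)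
        finally have "C = f (i, j)" unfolding UV(2) f_def by (simp add: co_eq)
        moreover have "(i, j) \<in> {0..<k * a} \<times> {0..<k}" using pos by (simp add: i_def j_def)
        ultimately show "C \<in> f ` ({0..<k * a} \<times> {0..<k})" by blast
      qed
    qed
  qed
  then have "card (co ` OK) = card ({0..<k * a} \<times> {0..<k})" by (metis bij_betw_same_card)
  also have "\<dots> = nat (k * k * a)" using pos by (simp add: card_cartesian_product nat_mult_distrib mult_ac)
  finally show ?thesis unfolding carr .
qed

text \<open>
  The rational factor between an ideal and a lattice of norm \<open>a\<close> contributes a square to the norm,
  which Hilbert symbols ignore.
\<close>
lemma ideal_norm_lattice:
  assumes I: "I \<in> fractional_ideals d"
  obtains c k a B where "c > 0" "k > 0" "a > 0" "odd B" "4 * a dvd B ^ 2 - d"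
    "scale (of_nat c) I = scale (of_int k) (lattice a B)"
    "ideal_norm d I = (of_int k / of_nat c) ^ 2 * of_int a"
proof -
  obtain n where n: "n > 0" "\<And>x. x \<in> I \<Longrightarrow> of_int n * x \<in> OK" using frac_int_denominator[OF I] by blast
  define P where "P c \<longleftrightarrow> c > 0 \<and> (\<forall>x\<in>I. of_nat c * x \<in> OK)" for c :: nat
  define c where "c = (LEAST c. P c)"
  have "P (nat n)" using n by (simp add: P_def of_nat_nat)
  then have "P c" unfolding c_def by (rule LeastI)
  then have c: "c > 0" "\<And>x. x \<in> I \<Longrightarrow> of_nat c * x \<in> OK" by (auto simp: P_def)
  define J where "J = scale (of_nat c) I"
  have J: "J \<in> fractional_ideals d" "J \<subseteq> OK"
    using frac_scale[OF I, of "of_nat c"] c of_int_in_F[of "int c"] by (auto simp: J_def scale_def)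
  from integral_ideal_lattice[OF J] obtain k a B where
    k: "k > 0" "a > 0" "odd B" "4 * a dvd B ^ 2 - d" "J = scale (of_int k) (lattice a B)" by blast
  have "ideal_norm d I = of_nat (card (carrier (complex_subring OK Quot J))) / of_nat (c\<^sup>2)"
    by (simp add: ideal_norm_def Let_def c_def[unfolded P_def, symmetric] J_def scale_def)
  also have "\<dots> = (of_int k / of_nat c) ^ 2 * of_int a"
    unfolding card_lattice_quotient[OF J(1) k(5,1,2,3)]
    using k by (simp add: of_nat_nat power2_eq_square)
  finally show ?thesis using that[OF c(1) k(1-4)] k(5) J_def by blast
qed

lemma cnj_iprod: "cnj ` (I ** J) = (cnj ` I) ** (cnj ` J)"
proof -
  have sub: "cnj ` (I ** J) \<subseteq> (cnj ` I) ** (cnj ` J)" for I J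
  proof
    fix z assume "z \<in> cnj ` (I ** J)"
    then obtain w where "w \<in> I ** J" "z = cnj w" by blast
    moreover from this(1) have "cnj w \<in> (cnj ` I) ** (cnj ` J)"
      by (induction rule: iprod_induct) (auto intro: iprodI iprod_add)
    ultimately show "z \<in> (cnj ` I) ** (cnj ` J)" by simp
  qed
  have "cnj ` cnj ` X = X" for X by (simp add: image_image)
  then show ?thesis using sub[of I J] sub[of "cnj ` I" "cnj ` J"] by (metis image_mono subset_antisym)
qed

lemma cnj_scale: "cnj ` scale x I = scale (cnj x) (cnj ` I)"
  by (auto simp: scale_def image_image)

lemma cnj_sqrt_ideal: "cnj ` sqrt_ideal D = sqrt_ideal D"
proof -
  have sub: "cnj ` sqrt_ideal D \<subseteq> sqrt_ideal D"
  proof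
    fix z assume "z \<in> cnj ` sqrt_ideal D"
    then obtain X Y where "even (X - Y)" "D dvd X" "z = cnj (quad X Y)" unfolding sqrt_ideal_def by blast
    then have "z = quad X (- Y)" "even (X - - Y)" "D dvd X" by (auto simp: cnj_quad)
    then show "z \<in> sqrt_ideal D" unfolding sqrt_ideal_def by blast
  qed
  then have "cnj ` cnj ` sqrt_ideal D \<subseteq> cnj ` sqrt_ideal D" by (rule image_mono)
  then show ?thesis using sub by (simp add: image_image)
qed

lemma lattice_gens: "of_int a \<in> lattice a B" "quad B 1 \<in> lattice a B"
  unfolding lattice_def quad_of_int mem_Collect_eq
  by (intro exI[of _ 1] exI[of _ 0], simp) (intro exI[of _ 0] exI[of _ 1], simp)

lemma lattice_subset_OK: "odd B \<Longrightarrow> lattice a B \<subseteq> OK"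
  unfolding lattice_def by (auto intro!: quad_in_OK)

text \<open>
  The product contains \<open>a\<^sup>2\<close>, \<open>a\<close> times the trace \<open>B\<close> of \<open>\<omega>\<close>, and the norm \<open>a c\<close> of \<open>\<omega>\<close>.  A common divisor of
  \<open>a, B, c\<close> would have its square dividing \<open>B\<^sup>2 - 4 a c = d\<close>, so they generate \<open>a\<close>.
\<close>
lemma lattice_cnj_prod:
  assumes L: "L = lattice a B" "L \<in> fractional_ideals d" and "odd B" "4 * a dvd B ^ 2 - d"
  shows "L ** (cnj ` L) = scale (of_int a) OK"
proof
  define \<omega> where "\<omega> = quad B 1"
  obtain c where c: "B ^ 2 - d = 4 * a * c" using assms(4) by blast
  have \<omega>O: "\<omega> \<in> OK" using \<open>odd B\<close> by (simp add: \<omega>_def quad_in_OK)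
  have norm: "\<omega> * cnj \<omega> = of_int (a * c)" using quad_norm[of B 1] c by (simp add: \<omega>_def)
  have trace: "\<omega> + cnj \<omega> = of_int B" by (simp add: \<omega>_def cnj_quad quad_add quad_of_int[of B])
  have mem: "\<exists>x y. z = of_int x * of_int a + of_int y * \<omega>" if zL: "z \<in> L" for z
  proof -
    obtain x y where "z = quad (2 * (x * a) + y * B) y" using zL unfolding L(1) lattice_def by blast
    then have "z = of_int x * of_int a + of_int y * \<omega>" by (simp add: \<omega>_def quad_def field_simps)
    then show ?thesis by blast
  qed
  show "L ** (cnj ` L) \<subseteq> scale (of_int a) OK"
  proof (rule iprod_subsetI)
    fix u v assume "u \<in> L" "v \<in> cnj ` L"
    then obtain x y x' y' where uv: "u = of_int x * of_int a + of_int y * \<omega>"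
      "v = cnj (of_int x' * of_int a + of_int y' * \<omega>)" using mem by blast
    define r where "r = of_int (x * x' * a) + of_int (x * y') * cnj \<omega> + of_int (x' * y) * \<omega> + of_int (y * y' * c)"
    have "r \<in> OK" unfolding r_def using \<omega>O by (intro OK_add OK_mult of_int_in_OK OK_cnj)
    moreover have "u * v = of_int a * (of_int (x * x' * a) + of_int (x * y') * cnj \<omega> + of_int (x' * y) * \<omega>)
        + of_int (y * y') * (\<omega> * cnj \<omega>)"
      unfolding uv by (simp add: algebra_simps)
    then have "u * v = of_int a * r" unfolding norm r_def by (simp add: algebra_simps)
    ultimately show "u * v \<in> scale (of_int a) OK" unfolding scale_def by blast
  next
    fix u v assume "u \<in> scale (of_int a) OK" "v \<in> scale (of_int a) OK"
    then show "u + v \<in> scale (of_int a) OK" unfolding scale_def by (auto simp: distrib_left[symmetric] intro: OK_add)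
  qed
  have cnjL: "cnj x \<in> cnj ` L" if "x \<in> L" for x using that by blast
  have gens: "of_int a \<in> L" "\<omega> \<in> L" using lattice_gens L(1) \<omega>_def by auto
  define P where "P = L ** (cnj ` L)"
  have P_add: "x + y \<in> P" if "x \<in> P" "y \<in> P" for x y using that unfolding P_def by (rule iprod_add)
  have P_mult: "r * z \<in> P" if "r \<in> OK" "z \<in> P" for r z
    using that(2) unfolding P_def
  proof (induction rule: iprod_induct)
    case (prod u v)
    have "(r * u) * v \<in> L ** (cnj ` L)" using prod fracD(4)[OF L(2) that(1)] by (intro iprodI)
    then show ?case by (simp add: mult.assoc)
  next
    case (add u v) then show ?case using iprod_add by (simp add: distrib_left)
  qed
  have 1: "of_int a * of_int a \<in> P" using iprodI[OF gens(1) cnjL[OF gens(1)]] by (simp add: P_def)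
  have "\<omega> * of_int a + of_int a * cnj \<omega> \<in> P"
    using iprodI[OF gens(2) cnjL[OF gens(1)]] iprodI[OF gens(1) cnjL[OF gens(2)]] P_add by (simp add: P_def)
  also have "\<omega> * of_int a + of_int a * cnj \<omega> = of_int a * (\<omega> + cnj \<omega>)" by (simp add: algebra_simps)
  finally have 2: "of_int a * of_int B \<in> P" unfolding trace .
  have 3: "of_int a * of_int c \<in> P" using iprodI[OF gens(2) cnjL[OF gens(2)]] norm by (simp add: P_def)
  \<comment> \<open>Now show that \<open>a, B, c\<close> have no common divisor.\<close>
  define g where "g = gcd a (gcd B c)"
  have "g dvd a" "g dvd B" "g dvd c" unfolding g_def by (auto intro: dvd_trans)
  then have "g ^ 2 dvd B ^ 2 - 4 * (a * c)" unfolding power2_eq_square by (intro dvd_diff dvd_mult[of _ _ 4] mult_dvd_mono)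
  also have "B ^ 2 - 4 * (a * c) = d" using c by (simp add: algebra_simps)
  finally have "g dvd 1" using sqfree squarefreeD by blast
  then have g1: "g = 1" unfolding g_def by simp
  obtain p q where pq: "p * B + q * c = gcd B c" using bezout_int by blast
  obtain r s where rs: "r * a + s * gcd B c = 1" using bezout_int[of a "gcd B c"] g1 g_def by auto
  have one: "r * a + s * p * B + s * q * c = 1" using rs unfolding pq[symmetric] by (simp add: algebra_simps)
  have "of_int r * (of_int a * of_int a) + of_int (s * p) * (of_int a * of_int B) + of_int (s * q) * (of_int a * of_int c) \<in> P"
    by (rule P_add[OF P_add]) (rule P_mult[OF of_int_in_OK], fact)+
  also have "of_int r * (of_int a * of_int a) + of_int (s * p) * (of_int a * of_int B) + of_int (s * q) * (of_int a * of_int c)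
      = (of_int a * of_int (r * a + s * p * B + s * q * c) :: complex)" by (simp add: algebra_simps)
  finally have "of_int a \<in> P" unfolding one by simp
  then show "scale (of_int a) OK \<subseteq> L ** (cnj ` L)"
    unfolding P_def[symmetric] scale_def using P_mult by (auto simp: mult.commute[of "of_int a"])
qed

text \<open>
  Let \<open>\<beta> = \<gamma> D\<close>, an integer.  Multiplying \<open>L\<^sup>2\<close> by its conjugate gives
  \<open>(a\<^sup>2 D) = (\<beta>) (\<beta>')\<close> with \<open>\<beta>'\<close> conjugate to \<open>\<beta>\<close>, hence an equality of positive integers, which is the norm equation
  multiplied by \<open>D\<close>.  If a prime \<open>l\<close> divides \<open>a\<close> and \<open>\<beta>\<close>, then it divides \<open>D \<omega>\<^sup>2\<close>, since \<open>\<omega>\<^sup>2\<close> lies in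
  \<open>\<gamma> a\<^sub>D\<close>.  So it divides \<open>D B\<close>, and \<open>B\<^sup>2 - d\<close> is a multiple of \<open>a\<close>.
\<close>
lemma lattice_square_equation:
  assumes L: "L = lattice a B" "L \<in> fractional_ideals d" and B: "odd B" "4 * a dvd B ^ 2 - d" and "a > 0"
    and D: "D dvd d" "D > 0" and \<gamma>: "\<gamma> \<noteq> 0" "L ** L = scale \<gamma> (sqrt_ideal D)"
  obtains u w where "4 * a ^ 2 = D * u ^ 2 - (d div D) * w ^ 2"
    "\<And>l. prime l \<Longrightarrow> l dvd a \<Longrightarrow> l dvd u \<Longrightarrow> l dvd w \<Longrightarrow> 2 * l dvd u - w \<Longrightarrow> l dvd d"
proof -
  define \<beta> where "\<beta> = \<gamma> * of_int D"
  have LLO: "L ** L \<subseteq> OK" using lattice_subset_OK[OF B(1)] L(1) by (intro iprod_subsetI) (auto intro: OK_mult OK_add)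
  have "\<beta> \<in> L ** L" unfolding \<gamma>(2) \<beta>_def scale_def using of_int_in_sqrt_ideal by blast
  then have \<beta>O: "\<beta> \<in> OK" using LLO by blast
  have \<beta>0: "\<beta> \<noteq> 0" using \<gamma>(1) D by (simp add: \<beta>_def)
  obtain M where M: "M > 0" "\<beta> * cnj \<beta> = of_int M" using OK_norm_int[OF \<beta>O \<beta>0] by blast
  define L' where "L' = cnj ` L"
  have LL': "L ** L' = scale (of_int a) OK" unfolding L'_def by (rule lattice_cnj_prod[OF L B])
  have "(L ** L) ** (L' ** L') = (L ** L') ** (L ** L')" by (metis iprod_assoc iprod_commute)
  also have "\<dots> = scale (of_int a * of_int a) OK"
    unfolding LL' scale_prod frac_OK_prod[OF frac_OK] ..
  finally have e1: "(L ** L) ** (L' ** L') = scale (of_int a * of_int a) OK" .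
  have "L' ** L' = scale (cnj \<gamma>) (sqrt_ideal D)" unfolding L'_def cnj_iprod[symmetric] \<gamma>(2) cnj_scale cnj_sqrt_ideal ..
  then have "(L ** L) ** (L' ** L') = scale (\<gamma> * cnj \<gamma> * of_int D) OK"
    unfolding \<gamma>(2) by (simp add: scale_prod sqrt_ideal_square[OF D(1)] scale_scale)
  then have "scale (of_int D) (scale (of_int a * of_int a) OK) = scale (of_int D) (scale (\<gamma> * cnj \<gamma> * of_int D) OK)"
    using e1 by simp
  moreover have "of_int D * (\<gamma> * cnj \<gamma> * of_int D) = of_int M" unfolding M(2)[symmetric] by (simp add: \<beta>_def mult_ac)
  ultimately have eq: "scale (of_int (D * a ^ 2)) OK = scale (of_int M) OK"
    by (simp add: scale_scale power2_eq_square mult_ac)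
  have dv: "v dvd u" if uv: "scale (of_int u) OK = scale (of_int v) OK" for u v
  proof -
    have "of_int u * 1 \<in> scale (of_int u) OK" unfolding scale_def using one_in_OK by blast
    then obtain r where "r \<in> OK" "of_int v * r = of_int u" unfolding uv by (auto simp: scale_def)
    then show ?thesis by (rule OK_int_dvd)
  qed
  have "D * a ^ 2 = M"
    using dv[OF eq] dv[OF eq[symmetric]] M(1) D(2) by (intro zdvd_antisym_nonneg) auto
  obtain X w where Xw: "even (X - w)" "\<beta> = quad X w" using \<beta>O by (rule mem_OKE)
  have N: "X ^ 2 - d * w ^ 2 = 4 * (D * a ^ 2)"
  proof -
    have "(of_int (X ^ 2 - d * w ^ 2) :: complex) = of_int (4 * M)" unfolding quad_norm[symmetric] Xw(2)[symmetric] M(2) by simp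
    then show ?thesis unfolding \<open>D * a ^ 2 = M\<close> by (simp only: of_int_eq_iff)
  qed
  obtain e where e: "d = D * e" using D(1) by blast
  have "X ^ 2 = D * (4 * a ^ 2 + e * w ^ 2)" using N e by (simp add: algebra_simps)
  then have "D dvd X ^ 2" by simp
  then have "D dvd X" using squarefree_dvd_square squarefree_mono[OF D(1) sqfree] by blast
  then obtain u where u: "X = D * u" by blast
  show ?thesis
  proof
    have "D * (D * u ^ 2 - e * w ^ 2) = D * (4 * a ^ 2)" using N u e by (simp add: power2_eq_square algebra_simps)
    then have "D * u ^ 2 - e * w ^ 2 = 4 * a ^ 2" using D(2) by simp
    then show "4 * a ^ 2 = D * u ^ 2 - (d div D) * w ^ 2" using e D(2) by simp
  next
    fix l assume l: "prime l" "l dvd a" "l dvd u" "l dvd w" "2 * l dvd u - w"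
    obtain u' w' where uw: "u = l * u'" "w = l * w'" using l(3,4) by blast
    have l0: "l \<noteq> 0" using l(1) by auto
    have "l * 2 dvd l * (u' - w')" using l(5) uw by (simp add: algebra_simps)
    then have "even (u' - w')" using l0 by (simp only: dvd_mult_cancel_left) auto
    then have par: "even (D * u' - w')" using odd_dvd[OF D(1)] by simp
    have \<beta>l: "\<beta> = of_int l * quad (D * u') w'" unfolding quad_scale Xw(2) u uw by (simp add: mult_ac)
    have "quad B 1 * quad B 1 \<in> L ** L" using lattice_gens(2) L(1) by (intro iprodI) auto
    then obtain x where x: "x \<in> sqrt_ideal D" "quad B 1 * quad B 1 = \<gamma> * x" unfolding \<gamma>(2) scale_def by blast
    have "of_int D * (quad B 1 * quad B 1) = of_int l * (quad (D * u') w' * x)"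
      using \<beta>l unfolding x(2) \<beta>_def by (simp add: mult_ac)
    moreover have "quad (D * u') w' * x \<in> OK" using par x(1) sqrt_ideal_subset_OK by (intro OK_mult quad_in_OK) auto
    then obtain P Q where "quad (D * u') w' * x = quad P Q" by (elim mem_OKE)
    moreover have B1: "even (B - 1)" using B(1) by simp
    moreover obtain P' Q' where PQ': "quad B 1 * quad B 1 = quad P' Q'" "2 * Q' = B * 1 + 1 * B"
      using quad_mult[OF B1 B1] by blast
    ultimately have "D * Q' = l * Q" by (simp add: quad_scale quad_eq_iff)
    then have "l dvd D * B" using PQ'(2) by simp
    then consider "l dvd D" | "l dvd B" using l(1) prime_dvd_mult_iff by blast
    then show "l dvd d"
    proof cases
      case 1 then show ?thesis using D(1) dvd_trans by blast
    next
      case 2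
      have "l dvd B ^ 2 - d" using l(2) B(2) by (meson dvd_mult dvd_trans)
      moreover have "l dvd B ^ 2" using 2 by (simp add: power2_eq_square)
      ultimately have "l dvd B ^ 2 - (B ^ 2 - d)" by (rule dvd_diff[rotated])
      then show ?thesis by simp
    qed
  qed
qed

end

section \<open>The form on the diagonal\<close>

context imaginary_quadratic
begin

text \<open>
  Stated for every ideal whose square has the class of the ramified ideal, so that it covers the one that the
  definition of the form picks by choice.
\<close>
lemma genus_char_square_root:
  assumes D: "squarefree D" "int D dvd d" "\<And>q. q \<in> prime_factors D \<Longrightarrow> q mod 4 = 1"
    and b: "b \<in> fractional_ideals d"
    and cls: "ideal_class d (b ** b) = ideal_class d (ramified_ideal d D)"
  shows "genus_char d D b = quartic_symbol (d div int D) D"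
proof -
  have D0: "D > 0" using D(2) d_nonzero by (cases "D = 0") auto
  obtain \<gamma> where \<gamma>: "\<gamma> \<in> F" "\<gamma> \<noteq> 0" "b ** b = scale \<gamma> (sqrt_ideal (int D))"
    using same_classE[OF frac_prod[OF b b] frac_sqrt_ideal[OF D(2)]] cls
    unfolding ramified_ideal_eq[OF D(1,2)] by blast
  from ideal_norm_lattice[OF b] obtain c k a B where c: "c > 0" "k > 0" "a > 0" "odd B" "4 * a dvd B ^ 2 - d"
    and cb: "scale (of_nat c) b = scale (of_int k) (lattice a B)"
    and norm: "ideal_norm d b = (of_int k / of_nat c) ^ 2 * of_int a" by blast
  define z where "z = (of_nat c / of_int k :: complex)"
  have z: "z \<in> F" "z \<noteq> 0"
    using F_divide[OF of_int_in_F of_int_in_F, of "int c" k] c by (auto simp: z_def)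
  define L where "L = lattice a B"
  have "L = scale (1 / of_int k) (scale (of_int k) (lattice a B))"
    using c by (simp add: scale_scale L_def scale_one)
  then have L: "L = scale z b" unfolding cb[symmetric] by (simp add: scale_scale z_def)
  have LL: "L ** L = scale (z * z * \<gamma>) (sqrt_ideal (int D))"
    unfolding L scale_prod \<gamma>(3) scale_scale ..
  have "L \<in> fractional_ideals d" unfolding L using frac_scale[OF b] z by blast
  from lattice_square_equation[OF L_def this c(4,5,3) D(2) _ _ LL] obtain u w where
    eq: "4 * a ^ 2 = int D * u ^ 2 - (d div int D) * w ^ 2"
    and prim: "\<And>l. prime l \<Longrightarrow> l dvd a \<Longrightarrow> l dvd u \<Longrightarrow> l dvd w \<Longrightarrow> 2 * l dvd u - w \<Longrightarrow> l dvd d"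
    using D0 z \<gamma>(2) by auto
  have prod: "\<Prod>(prime_factors D) = D"
    by (rule prod_prime_factors_squarefree[OF D(1)])
  have S: "prime q \<and> q mod 4 = 1" if "q \<in> prime_factors D" for q using that D(3) by auto
  have "hilbert_symbol q (ideal_norm d b) (of_int d) = tame_symbol q a d" if q: "q \<in> prime_factors D" for q
  proof -
    have "int q dvd int D" using q by auto
    then have "int q dvd d" using D(2) dvd_trans by blast
    moreover have "\<not> int q ^ 2 dvd d"
      using sqfree squarefreeD[of d "int q"] S[OF q] by (auto simp: prime_nat_iff)
    moreover have "of_int k / of_nat c \<noteq> (0 :: rat)" using c by simp
    ultimately show ?thesis unfolding norm
      using S[OF q] c(3) by (intro hilbert_symbol_eq_tame_symbol) auto
  qed
  then have "genus_char d D b = (\<Prod>q\<in>prime_factors D. tame_symbol q a d)"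
    unfolding genus_char_def by (intro prod.cong) auto
  also have "\<dots> = (\<Prod>q\<in>prime_factors D. quartic_symbol_prime (d div int D) q)"
  proof (rule prod_tame_symbol_eq_quartic_symbol[OF _ S])
    show "d = int (\<Prod>(prime_factors D)) * (d div int D)" unfolding prod using D(2) by simp
    show "4 * a ^ 2 = int (\<Prod>(prime_factors D)) * u ^ 2 - (d div int D) * w ^ 2" unfolding prod by (rule eq)
  qed (use sqfree mod4 c(3) prim in auto)
  finally show ?thesis by (simp add: quartic_symbol_def)
qed

lemma form_Q_eq_quartic_symbol:
  assumes D: "squarefree D" "int D dvd d" "\<And>q. q \<in> prime_factors D \<Longrightarrow> q mod 4 = 1"
    and sq: "ideal_class d (ramified_ideal d D) \<in> class_squares d"
  shows "form_Q d D = xi (quartic_symbol (d div int D) D)"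
proof -
  let ?P = "\<lambda>b. b \<in> fractional_ideals d \<and>
      ideal_class d (b \<otimes>\<^bsub>ideal_group d\<^esub> b) = ideal_class d (ramified_ideal d D)"
  obtain b where "b \<in> fractional_ideals d" "ideal_class d (ramified_ideal d D) = ideal_class d (b ** b)"
    using ideal_class_squareE[OF sq] by blast
  then have "?P b" by (simp add: ideal_group_simps)
  then have "?P (SOME b. ?P b)" by (rule someI)
  then show ?thesis
    unfolding form_Q_def form_B_def using genus_char_square_root[OF D] by (simp add: ideal_group_simps)
qed

end

theorem theorem3p3:
  fixes t :: nat and p :: "nat \<Rightarrow> nat" and \<Delta> :: int
  assumes "t \<ge> 1"
    and "\<And>i. i \<in> {1..t} \<Longrightarrow> prime (p i)"
    and "inj_on p {1..t}"
    and "\<And>i. i \<in> {1..<t} \<Longrightarrow> [p i = 1] (mod 4)"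
    and "[p t = 3] (mod 4)"
    and "\<Delta> = - (\<Prod>i=1..t. int (p i))"
  shows "\<forall>D \<in> V0 \<Delta> t p. form_Q \<Delta> D = xi (quartic_symbol (\<Delta> div int D) D)"
proof
  fix D assume D: "D \<in> V0 \<Delta> t p"
  define m where "m = (\<Prod>i=1..<t. p i)"
  have split: "(\<Prod>i=1..t. p i) = m * p t"
    unfolding m_def using assms(1) by (cases t) (simp_all add: prod.atLeastLessThan_Suc atLeastLessThanSuc_atLeastAtMost[symmetric])
  have \<Delta>: "\<Delta> = - int (m * p t)" using assms(6) unfolding split[symmetric] by simp
  have m4: "m mod 4 = 1"
  proof -
    have "[(\<Prod>i=1..<t. p i) = (\<Prod>i=1..<t. 1)] (mod 4)" using assms(4) by (intro cong_prod)
    then show ?thesis by (simp add: m_def cong_def)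
  qed
  have sqf: "squarefree (m * p t)"
    unfolding split[symmetric]
  proof (rule squarefree_prod_coprime)
    fix i j assume ij: "i \<in> {1..t}" "j \<in> {1..t}" "i \<noteq> j"
    then show "coprime (p i) (p j)" using assms(2,3) by (meson inj_on_eq_iff primes_coprime)
  qed (use assms(2) squarefree_prime in blast)
  interpret imaginary_quadratic \<Delta>
  proof
    have "m * p t > 0" using sqf not_squarefree_0 by (metis neq0_conv)
    then show "\<Delta> < 0" unfolding \<Delta> by linarith
    show "squarefree \<Delta>"
    proof (rule squarefreeI)
      fix x assume "x ^ 2 dvd \<Delta>"
      then have "int (nat \<bar>x\<bar> ^ 2) dvd int (m * p t)" unfolding \<Delta> by simp
      then have "nat \<bar>x\<bar> ^ 2 dvd m * p t" by (simp only: int_dvd_int_iff)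
      then have "nat \<bar>x\<bar> dvd 1" using sqf squarefreeD by blast
      then show "x dvd 1" by simp
    qed
    have "(m mod 4) * (p t mod 4) mod 4 = 3" using m4 assms(5) by (simp add: cong_def)
    then have "(m * p t) mod 4 = 3" by (simp add: mod_mult_eq)
    then have "int (m * p t) mod 4 = 3" by presburger
    then show "\<Delta> mod 4 = 1" unfolding \<Delta> by presburger
  qed
  have Dm: "D dvd m" "D > 0" and cls: "ideal_class \<Delta> (ramified_ideal \<Delta> D) \<in> class_squares \<Delta>"
    using D by (auto simp: V0_def V'_def m_def)
  show "form_Q \<Delta> D = xi (quartic_symbol (\<Delta> div int D) D)"
  proof (rule form_Q_eq_quartic_symbol[OF _ _ _ cls])
    show "squarefree D" using squarefree_mono[OF _ sqf] Dm(1) by simp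
    show "int D dvd \<Delta>" unfolding \<Delta> using Dm(1) by simp
    fix q assume "q \<in> prime_factors D"
    then have q: "prime q" "q dvd m" using Dm(1) dvd_trans by auto
    then obtain i where i: "i \<in> {1..<t}" "q dvd p i" unfolding m_def by (auto simp: prime_dvd_prod_iff)
    then have "q = p i" using q(1) assms(2)[of i] primes_dvd_imp_eq by auto
    then show "q mod 4 = 1" using assms(4)[OF i(1)] by (simp add: cong_def)
  qed
qed

end
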